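(* Let $\zeta_n=e^{2\pi i/n}$, $\underline{\mathcal O}_n={\mathbf Z}[\zeta_n+\zeta_n^{-1}]$ and $\underline{R}_n=\underline{\mathcal O}_n[1/2]$, with $n\ge 8$. (a) If $n=2^s$, then every totally positive unit of $\underline{\mathcal O}_n$ is a square in $\underline{\mathcal O}_n^\times$, the narrow class number $\tilde h(\underline{\mathcal O}_n)$ and the class number $h(\underline{\mathcal O}_n)$ are odd, and $\underline{R}_{n+}^\times/(\underline{R}_n^\times)^2\cong{\mathbf Z}/2{\mathbf Z}$. (b) If $n=3\cdot 2^s$, then $h(\underline{\mathcal O}_n)=\tilde h(\underline{R}_n)$ is odd, $\tilde h(\underline{\mathcal O}_n)=2h(\underline{\mathcal O}_n)$ (so $\tilde h(\underline{\mathcal O}_n)\equiv 2\pmod 4$), and $\underline{R}_{n+}^\times/(\underline{R}_n^\times)^2\cong{\mathbf Z}/2{\mathbf Z}$.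
   Context: $\underline{R}_{n+}^\times$ denotes the group of totally positive units of $\underline{R}_n$; $\tilde h$ denotes the narrow class number. *)

theory Defs
  imports Complex_Main "HOL-Computational_Algebra.Polynomial"
begin

(* All rings are realised as subrings of the reals, via the real embedding
   zeta_n + zeta_n^{-1} = 2 cos(2 pi / n). *)

definition theta :: "nat \<Rightarrow> real" where
  "theta n = 2 * cos (2 * pi / real n)"

(* the k-th conjugate of theta n, i.e. image of zeta+zeta^{-1} under zeta \<mapsto> zeta^k *)
definition theta_conj :: "nat \<Rightarrow> nat \<Rightarrow> real" where
  "theta_conj n k = 2 * cos (2 * pi * real k / real n)"

definition Ocyc :: "nat \<Rightarrow> real set" where
  "Ocyc n = {poly (map_poly of_int p) (theta n) | p :: int poly. True}"

definition Rcyc :: "nat \<Rightarrow> real set" where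
  "Rcyc n = {x / 2 ^ m | x m. x \<in> Ocyc n}"

(* totally positive: every real embedding (sigma_k, k coprime to n) is positive.
   An element x = p(theta)/2^m has conjugates p(theta_k)/2^m. *)
definition tpos :: "nat \<Rightarrow> real \<Rightarrow> bool" where
  "tpos n x \<longleftrightarrow> (\<forall>(p :: int poly) (m :: nat).
      poly (map_poly of_int p) (theta n) = x * 2 ^ m \<longrightarrow>
      (\<forall>k :: nat. coprime k n \<longrightarrow> poly (map_poly of_int p) (theta_conj n k) > 0))"

definition units_of_ring :: "real set \<Rightarrow> real set" where
  "units_of_ring A = {u \<in> A. u \<noteq> 0 \<and> 1 / u \<in> A}"

definition is_ideal :: "real set \<Rightarrow> real set \<Rightarrow> bool" where
  "is_ideal A I \<longleftrightarrow> I \<subseteq> A \<and> 0 \<in> I \<and> (\<forall>x\<in>I. \<forall>y\<in>I. x + y \<in> I)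
      \<and> (\<forall>a\<in>A. \<forall>x\<in>I. a * x \<in> I)"

definition nonzero_ideals :: "real set \<Rightarrow> real set set" where
  "nonzero_ideals A = {I. is_ideal A I \<and> I \<noteq> {0}}"

(* I ~ J iff a I = b J for nonzero a, b in A satisfying P.
   P = (\<lambda>_. True): ideal classes; P = tpos n: narrow ideal classes. *)
definition ideal_equiv :: "real set \<Rightarrow> (real \<Rightarrow> bool) \<Rightarrow> (real set \<times> real set) set" where
  "ideal_equiv A P = {(I, J). I \<in> nonzero_ideals A \<and> J \<in> nonzero_ideals A \<and>
      (\<exists>a b. a \<in> A \<and> b \<in> A \<and> a \<noteq> 0 \<and> b \<noteq> 0 \<and> P a \<and> P b \<and>
         (\<lambda>x. a * x) ` I = (\<lambda>x. b * x) ` J)}"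

definition class_number :: "real set \<Rightarrow> nat" where
  "class_number A = card (nonzero_ideals A // ideal_equiv A (\<lambda>_. True))"

definition narrow_class_number :: "nat \<Rightarrow> real set \<Rightarrow> nat" where
  "narrow_class_number n A = card (nonzero_ideals A // ideal_equiv A (tpos n))"

definition tpos_units :: "nat \<Rightarrow> real set \<Rightarrow> real set" where
  "tpos_units n A = {u \<in> units_of_ring A. tpos n u}"

definition tpos_units_mod_squares_card :: "nat \<Rightarrow> real set \<Rightarrow> nat" where
  "tpos_units_mod_squares_card n A =
     card (tpos_units n A // {(x, y). x \<in> tpos_units n A \<and> y \<in> tpos_units n A \<and>
              (\<exists>v \<in> units_of_ring A. x = y * v ^ 2)})"

end

theory Submission
  imports Defs "HOL-Analysis.Kronecker_Approximation_Theorem"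
begin

text \<open>
  The proof climbs the towers \<open>n \<mapsto> 2 n\<close> starting at \<open>n = 4\<close> and \<open>n = 12\<close>, and avoids class field
  theory. After inverting 2, each step is a quadratic extension \<open>B = A[\<theta>]\<close> with 2 and \<open>\<theta>\<close> units and
  \<open>\<sigma> \<theta> = - \<theta>\<close>, so every \<open>\<sigma>\<close>-invariant ideal of \<open>B\<close> is extended from \<open>A\<close>. If every unit of \<open>A\<close> is the
  norm of a unit of \<open>B\<close>, Hilbert's Theorem 90
    shows that the class group of \<open>B\<close> has no element of order 2
  when that of \<open>A\<close> has none, and that a unit of norm 1 is, up to squares, the norm of a unit. The norms
  are surjective on units because modulo squares the units are generated by values of integer
  polynomials with \<open>q(x) q(- x) = q(x\<^sup>2 - 2)\<close>, which form norm-coherent sequences. The same norm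
  arguments control the totally positive units and the signatures. Finally the prime over 2 is
  principal, which relates the rings with and without 1/2: its generator can be chosen totally
  positive for \<open>n = 2^s\<close>, whereas for \<open>n = 3 \<cdot> 2^s\<close> there is a generator of norm -2 while all units
  have norm 1.
\<close>

section \<open>Ideals and quadratic extensions\<close>

text \<open>Surjectivity of the norm on units is the hinge because of an ambiguity: if
  \<open>I\<close> has square \<open>(x)\<close>, its relative norm is a principal ideal
  \<open>(a)\<close>, but \<open>a ^ 2\<close> agrees with the norm of \<open>x\<close> only up to a
  unit of the lower ring. The decomposition of units modulo squares climbs by the same device: a
  unit divided by a norm-coherent lift of its norm has norm 1. Signatures climb through the trace:
  if the norm of \<open>y\<close> is totally positive, then \<open>y\<close> and its conjugate have
  equal signs at every place, and \<open>y + \<sigma> y\<close> lies below with those signs.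
  Conjugations of real numbers make sense only while each adjoined square root is new, so
  nonsquareness is part of the induction. Invertibility of ideals likewise climbs, through relative
  norms of ideals. Finiteness of the class group is proved separately, since \<open>card\<close> of
  an infinite set is 0 and hence even.\<close>

definition subring :: "real set \<Rightarrow> bool" where
  "subring A \<longleftrightarrow> 1 \<in> A \<and> (\<forall>x\<in>A. \<forall>y\<in>A. x + y \<in> A \<and> x * y \<in> A) \<and> (\<forall>x\<in>A. - x \<in> A)"

lemma subringD:
  assumes "subring A"
  shows "1 \<in> A" "0 \<in> A" "x \<in> A \<Longrightarrow> - x \<in> A"
    "x \<in> A \<Longrightarrow> y \<in> A \<Longrightarrow> x + y \<in> A" "x \<in> A \<Longrightarrow> y \<in> A \<Longrightarrow> x * y \<in> A"
    "x \<in> A \<Longrightarrow> y \<in> A \<Longrightarrow> x - y \<in> A" "x \<in> A \<Longrightarrow> x ^ k \<in> A"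
    "of_int m \<in> A" "of_nat j \<in> A" "numeral w \<in> A"
proof -
  show 1: "1 \<in> A" and neg: "\<And>x. x \<in> A \<Longrightarrow> - x \<in> A"
    and add: "\<And>x y. x \<in> A \<Longrightarrow> y \<in> A \<Longrightarrow> x + y \<in> A"
    and mult: "\<And>x y. x \<in> A \<Longrightarrow> y \<in> A \<Longrightarrow> x * y \<in> A"
    using assms by (auto simp: subring_def)
  from add[OF 1 neg[OF 1]] show 0: "0 \<in> A" by simp
  show "x \<in> A \<Longrightarrow> y \<in> A \<Longrightarrow> x - y \<in> A"
    using add[of x "- y"] neg[of y] by simp
  show "x \<in> A \<Longrightarrow> x ^ k \<in> A" by (induction k) (auto intro: 1 mult)
  have nat: "of_nat j \<in> A" for j by (induction j) (auto intro: 0 1 add)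
  show "of_nat j \<in> A" by (rule nat)
  show "of_int m \<in> A"
  proof (cases m rule: int_cases2)
    case (nonneg k) then show ?thesis using nat[of k] by simp
  next
    case (nonpos k) then show ?thesis using neg[OF nat[of k]] by simp
  qed
  show "numeral w \<in> A" using nat[of "numeral w"] by simp
qed

lemma subring_sum: "subring A \<Longrightarrow> (\<And>i. i \<in> S \<Longrightarrow> f i \<in> A) \<Longrightarrow> sum f S \<in> A"
  by (induction S rule: infinite_finite_induct) (auto intro: subringD)

section \<open>Dilations, units and ideals\<close>

abbreviation scl :: "real \<Rightarrow> real set \<Rightarrow> real set" where
  "scl a I \<equiv> (\<lambda>x. a * x) ` I"

lemma scl_scl: "scl a (scl b I) = scl (a * b) I"
  by (simp add: image_image mult.assoc)

lemma scl_1 [simp]: "scl 1 I = I"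
  by simp

lemma scl_cancel: "a \<noteq> 0 \<Longrightarrow> scl a I = scl a J \<Longrightarrow> I = J"
  using inj_image_eq_iff[of "\<lambda>x. a * x" I J] by (simp add: inj_on_def)

lemma units_iff: "u \<in> units_of_ring A \<longleftrightarrow> u \<in> A \<and> u \<noteq> 0 \<and> 1 / u \<in> A"
  by (simp add: units_of_ring_def)

lemma units_1: "subring A \<Longrightarrow> 1 \<in> units_of_ring A"
  by (simp add: units_iff subringD)

lemma units_mult: "subring A \<Longrightarrow> u \<in> units_of_ring A \<Longrightarrow> v \<in> units_of_ring A \<Longrightarrow> u * v \<in> units_of_ring A"
  using subringD(5)[of A "1 / u" "1 / v"] by (simp add: units_iff subringD)

lemma units_inverse: "u \<in> units_of_ring A \<Longrightarrow> 1 / u \<in> units_of_ring A"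
  by (simp add: units_iff)

lemma units_power: "subring A \<Longrightarrow> u \<in> units_of_ring A \<Longrightarrow> u ^ k \<in> units_of_ring A"
  by (induction k) (auto intro: units_1 units_mult)

lemma units_divide: "subring A \<Longrightarrow> u \<in> units_of_ring A \<Longrightarrow> v \<in> units_of_ring A \<Longrightarrow> u / v \<in> units_of_ring A"
  using units_mult[OF _ _ units_inverse] by fastforce

lemma units_minus: "subring A \<Longrightarrow> u \<in> units_of_ring A \<Longrightarrow> - u \<in> units_of_ring A"
  using subringD(3)[of A "1 / u"] by (simp add: units_iff subringD)

lemma units_mult_cancel: "subring A \<Longrightarrow> u * v \<in> units_of_ring A \<Longrightarrow> u \<in> A \<Longrightarrow> v \<in> A \<Longrightarrow> u \<in> units_of_ring A"
  using subringD(5)[of A v "1 / (u * v)"] by (auto simp: units_iff)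

lemma idealD:
  assumes "is_ideal A I"
  shows "x \<in> I \<Longrightarrow> x \<in> A" "0 \<in> I" "x \<in> I \<Longrightarrow> y \<in> I \<Longrightarrow> x + y \<in> I"
    "a \<in> A \<Longrightarrow> x \<in> I \<Longrightarrow> a * x \<in> I" "a \<in> A \<Longrightarrow> x \<in> I \<Longrightarrow> x * a \<in> I"
  using assms by (auto simp: is_ideal_def mult.commute)

lemma ideal_minus: "subring A \<Longrightarrow> is_ideal A I \<Longrightarrow> x \<in> I \<Longrightarrow> - x \<in> I"
  using idealD(4)[of A I "-1" x] by (simp add: subringD)

lemma ideal_diff: "subring A \<Longrightarrow> is_ideal A I \<Longrightarrow> x \<in> I \<Longrightarrow> y \<in> I \<Longrightarrow> x - y \<in> I"
  using idealD(3)[of A I x "- y"] ideal_minus[of A I y] by simp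

lemma ideal_ring: "subring A \<Longrightarrow> is_ideal A A"
  by (auto simp: is_ideal_def subringD)

lemma ideal_scl:
  assumes I: "is_ideal A I" and sub: "scl a I \<subseteq> A"
  shows "is_ideal A (scl a I)"
  unfolding is_ideal_def
proof (intro conjI ballI)
  show "0 \<in> scl a I" using idealD(2)[OF I] by force
  show "x + y \<in> scl a I" if "x \<in> scl a I" "y \<in> scl a I" for x y
  proof -
    obtain x' y' where "x' \<in> I" "y' \<in> I" "x = a * x'" "y = a * y'"
      using \<open>x \<in> scl a I\<close> \<open>y \<in> scl a I\<close> by blast
    then have "x + y = a * (x' + y')" "x' + y' \<in> I" using idealD(3)[OF I] by (auto simp: distrib_left)
    then show ?thesis by blast
  qed
  show "c * x \<in> scl a I" if "c \<in> A" "x \<in> scl a I" for c x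
  proof -
    obtain x' where "x' \<in> I" "x = a * x'" using \<open>x \<in> scl a I\<close> by blast
    then have "c * x = a * (c * x')" "c * x' \<in> I" using idealD(4)[OF I \<open>c \<in> A\<close>] by auto
    then show ?thesis by blast
  qed
qed (rule sub)

lemma ideal_scl': "subring A \<Longrightarrow> is_ideal A I \<Longrightarrow> a \<in> A \<Longrightarrow> is_ideal A (scl a I)"
  by (rule ideal_scl) (auto intro!: subringD(5) dest: idealD(1))

lemma nonzero_idealsE:
  assumes "I \<in> nonzero_ideals A"
  obtains x where "x \<in> I" "x \<in> A" "x \<noteq> 0" "is_ideal A I"
  using assms by (auto simp: nonzero_ideals_def is_ideal_def)

lemma nonzero_idealsD:
  assumes "I \<in> nonzero_ideals A"
  shows "is_ideal A I" "\<exists>x\<in>I. x \<noteq> 0"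
  using assms by (auto elim: nonzero_idealsE)

lemma nonzero_ideals_ring: "subring A \<Longrightarrow> A \<in> nonzero_ideals A"
  using subringD(1)[of A] by (auto simp: nonzero_ideals_def ideal_ring)

lemma nonzero_idealsI: "is_ideal A I \<Longrightarrow> x \<in> I \<Longrightarrow> x \<noteq> 0 \<Longrightarrow> I \<in> nonzero_ideals A"
  by (auto simp: nonzero_ideals_def)

lemma nonzero_ideals_scl: "subring A \<Longrightarrow> I \<in> nonzero_ideals A \<Longrightarrow> a \<in> A \<Longrightarrow> a \<noteq> 0 \<Longrightarrow> scl a I \<in> nonzero_ideals A"
proof -
  assume *: "subring A" "I \<in> nonzero_ideals A" "a \<in> A" "a \<noteq> 0"
  then obtain x where "x \<in> I" "x \<noteq> 0" using nonzero_idealsD(2) by blast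
  then show ?thesis
    using * nonzero_idealsI[OF ideal_scl' imageI, of A I a x] nonzero_idealsD(1) by simp
qed

lemma scl_unit: "subring A \<Longrightarrow> is_ideal A I \<Longrightarrow> u \<in> units_of_ring A \<Longrightarrow> scl u I = I"
proof (intro equalityI subsetI)
  fix x assume *: "subring A" "is_ideal A I" "u \<in> units_of_ring A" "x \<in> I"
  then have "x = u * (1 / u * x)" "1 / u * x \<in> I"
    using idealD(4)[of A I "1 / u" x] by (auto simp: units_iff)
  then show "x \<in> scl u I" by blast
qed (auto simp: units_iff intro: idealD(2-5))

lemma scl_ring_eqE:
  assumes "subring A" "scl a A = scl b A" "b \<noteq> 0"
  obtains u where "u \<in> units_of_ring A" "a = b * u"
proof -
  have "a \<in> scl a A" "b \<in> scl b A" using subringD(1)[OF assms(1)] by force+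
  then obtain u v where "u \<in> A" "v \<in> A" "a = b * u" "b = a * v" using assms(2) by blast
  moreover from this have "u * v = 1" using assms(3) by (auto simp: mult.commute)
  moreover from this have "1 / u = v" "u \<noteq> 0"
    by (metis nonzero_eq_divide_eq mult.commute mult_zero_left zero_neq_one) (use \<open>u * v = 1\<close> in auto)
  ultimately show ?thesis using that[of u] by (simp add: units_iff)
qed

section \<open>Products of ideals\<close>

inductive_set iprod :: "real set \<Rightarrow> real set \<Rightarrow> real set" for I J where
  mult: "x \<in> I \<Longrightarrow> y \<in> J \<Longrightarrow> x * y \<in> iprod I J"
| add: "x \<in> iprod I J \<Longrightarrow> y \<in> iprod I J \<Longrightarrow> x + y \<in> iprod I J"

lemma iprod_commute: "iprod I J = iprod J I"
proof -
  have "x \<in> iprod I J \<Longrightarrow> x \<in> iprod J I" for x I J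
    by (induction rule: iprod.induct) (metis iprod.mult mult.commute, rule iprod.add)
  then show ?thesis by blast
qed

text \<open>It suffices to prove one inclusion for all triples: commutativity reverses the order of
  the factors and turns it into the other.\<close>

lemma iprod_assoc: "iprod (iprod I J) K = iprod I (iprod J K)"
proof -
  have sub: "iprod (iprod I J) K \<subseteq> iprod I (iprod J K)" for I J K
  proof
    have *: "x * z \<in> iprod I (iprod J K)" if "x \<in> iprod I J" "z \<in> K" for x z
      using that by (induction rule: iprod.induct)
        (auto intro: iprod.intros simp: mult.assoc distrib_right)
    show "x \<in> iprod (iprod I J) K \<Longrightarrow> x \<in> iprod I (iprod J K)" for x
      by (induction rule: iprod.induct) (auto intro: * iprod.intros)
  qed
  have "iprod I (iprod J K) = iprod (iprod K J) I"
    by (simp only: iprod_commute[of J K] iprod_commute[of I])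
  also have "\<dots> \<subseteq> iprod K (iprod J I)" by (rule sub)
  also have "\<dots> = iprod (iprod I J) K"
    by (simp only: iprod_commute[of I J] iprod_commute[of K])
  finally show ?thesis using sub by blast
qed

lemma iprod_left_commute: "iprod I (iprod J K) = iprod J (iprod I K)"
  by (metis iprod_assoc iprod_commute)

lemmas iprod_ac = iprod_assoc iprod_commute iprod_left_commute

lemma iprod_scl_left: "iprod (scl a I) J = scl a (iprod I J)"
proof (intro equalityI subsetI)
  show "x \<in> iprod (scl a I) J \<Longrightarrow> x \<in> scl a (iprod I J)" for x
  proof (induction rule: iprod.induct)
    case (mult x y) then show ?case by (auto simp: mult.assoc intro: iprod.mult)
  next
    case (add x y)
    then obtain x' y' where "x = a * x'" "y = a * y'" "x' \<in> iprod I J" "y' \<in> iprod I J" by auto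
    then have "x + y = a * (x' + y')" "x' + y' \<in> iprod I J"
      by (auto simp: distrib_left intro: iprod.add)
    then show ?case by blast
  qed
next
  have *: "a * x \<in> iprod (scl a I) J" if "x \<in> iprod I J" for x
    using that
  proof (induction rule: iprod.induct)
    case (mult x y)
    then have "(a * x) * y \<in> iprod (scl a I) J" by (intro iprod.mult) auto
    then show ?case by (simp add: mult.assoc)
  qed (auto simp: distrib_left intro: iprod.add)
  show "x \<in> scl a (iprod I J) \<Longrightarrow> x \<in> iprod (scl a I) J" for x using * by auto
qed

lemma iprod_scl_right: "iprod I (scl a J) = scl a (iprod I J)"
  by (metis iprod_commute iprod_scl_left)

lemma iprod_subset: "is_ideal A I \<Longrightarrow> J \<subseteq> A \<Longrightarrow> iprod I J \<subseteq> I"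
proof
  show "x \<in> iprod I J \<Longrightarrow> is_ideal A I \<Longrightarrow> J \<subseteq> A \<Longrightarrow> x \<in> I" for x
    by (induction rule: iprod.induct) (auto intro: idealD(2-5))
qed

lemma iprod_ring: "subring A \<Longrightarrow> is_ideal A I \<Longrightarrow> iprod I A = I"
  using iprod_subset[of A I A] iprod.mult[of _ I 1 A] subringD(1)[of A] by fastforce

lemma iprod_ideal: "is_ideal A I \<Longrightarrow> is_ideal A J \<Longrightarrow> is_ideal A (iprod I J)"
proof -
  assume *: "is_ideal A I" "is_ideal A J"
  have "a * x \<in> iprod I J" if "x \<in> iprod I J" "a \<in> A" for a x
    using that
  proof (induction rule: iprod.induct)
    case (mult x y)
    then have "(a * x) * y \<in> iprod I J" using * by (intro iprod.mult idealD(4)[of A I])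
    then show ?case by (simp add: mult.assoc)
  qed (auto simp: distrib_left intro: iprod.add)
  moreover have "0 \<in> iprod I J" using iprod.mult[of 0 I 0 J] *[THEN idealD(2)] by simp
  moreover have "iprod I J \<subseteq> A" using iprod_subset[of A I J] * by (auto simp: is_ideal_def)
  ultimately show ?thesis by (auto simp: is_ideal_def intro: iprod.add)
qed

lemma iprod_nonzero_ideals:
  "I \<in> nonzero_ideals A \<Longrightarrow> J \<in> nonzero_ideals A \<Longrightarrow> iprod I J \<in> nonzero_ideals A"
proof -
  assume "I \<in> nonzero_ideals A" "J \<in> nonzero_ideals A"
  then obtain x y where "is_ideal A I" "is_ideal A J" "x \<in> I" "y \<in> J" "x \<noteq> 0" "y \<noteq> 0"
    using nonzero_idealsD by blast
  then show ?thesis using nonzero_idealsI[OF iprod_ideal iprod.mult, of A I J x y] by simp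
qed

text \<open>The real factor \<open>a\<close> takes the place of fractional ideals: \<open>J\<close>
  represents the inverse class of \<open>I\<close>.\<close>

definition ideals_invertible :: "real set \<Rightarrow> bool" where
  "ideals_invertible A \<longleftrightarrow>
     (\<forall>I\<in>nonzero_ideals A. \<exists>J\<in>nonzero_ideals A. \<exists>a. a \<noteq> 0 \<and> iprod I J = scl a A)"

text \<open>Stated with squares of ideals, so that it makes sense before the classes are known to
  form a group. \<open>a\<close> and \<open>b\<close> range over all reals; as 1 lies in
  \<open>A\<close>, each belongs to the ideal it generates.\<close>

definition no_two_torsion :: "real set \<Rightarrow> bool" where
  "no_two_torsion A \<longleftrightarrow>
     (\<forall>I\<in>nonzero_ideals A. \<forall>a. iprod I I = scl a A \<longrightarrow> (\<exists>b. I = scl b A))"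

lemma pid_imp:
  assumes "subring A" "\<And>I. I \<in> nonzero_ideals A \<Longrightarrow> \<exists>b. I = scl b A"
  shows "ideals_invertible A" "no_two_torsion A"
proof -
  show "no_two_torsion A" using assms(2) by (auto simp: no_two_torsion_def)
  show "ideals_invertible A" unfolding ideals_invertible_def
  proof
    fix I assume I: "I \<in> nonzero_ideals A"
    then obtain b where b: "I = scl b A" using assms(2) by blast
    with I have "b \<noteq> 0" using subringD(2)[OF assms(1)]
      by (auto simp: nonzero_ideals_def image_constant_conv split: if_splits)
    moreover have "iprod I A = scl b A"
      using b I iprod_ring[OF assms(1)] by (auto simp: nonzero_ideals_def)
    ultimately show "\<exists>J\<in>nonzero_ideals A. \<exists>a. a \<noteq> 0 \<and> iprod I J = scl a A"
      using nonzero_ideals_ring[OF assms(1)] by blast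
  qed
qed

text \<open>The model is \<open>A = Rcyc n\<close> and \<open>B = Rcyc (2 * n)\<close>, with
  \<open>\<sigma>\<close> the nontrivial automorphism. As \<open>\<sigma>\<close> is a total
  function on the reals, its laws are restricted to \<open>B\<close>, and \<open>A\<close> is its
  fixed ring there.\<close>

locale quadratic_ext =
  fixes A B :: "real set" and \<sigma> :: "real \<Rightarrow> real" and \<theta> :: real
  assumes subring_A: "subring A" and subring_B: "subring B"
    and A_iff: "\<And>x. x \<in> A \<longleftrightarrow> x \<in> B \<and> \<sigma> x = x"
    and half: "1 / 2 \<in> A"
    and theta_unit: "\<theta> \<in> units_of_ring B" and \<sigma>_theta: "\<sigma> \<theta> = - \<theta>"
    and \<sigma>_closed: "\<And>x. x \<in> B \<Longrightarrow> \<sigma> x \<in> B"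
    and \<sigma>_add: "\<And>x y. x \<in> B \<Longrightarrow> y \<in> B \<Longrightarrow> \<sigma> (x + y) = \<sigma> x + \<sigma> y"
    and \<sigma>_mult: "\<And>x y. x \<in> B \<Longrightarrow> y \<in> B \<Longrightarrow> \<sigma> (x * y) = \<sigma> x * \<sigma> y"
    and \<sigma>_\<sigma>: "\<And>x. x \<in> B \<Longrightarrow> \<sigma> (\<sigma> x) = x"
begin

lemmas A_closed = subringD[OF subring_A]
lemmas B_closed = subringD[OF subring_B]

lemma AB: "x \<in> A \<Longrightarrow> x \<in> B" and \<sigma>_A: "x \<in> A \<Longrightarrow> \<sigma> x = x"
  using A_iff by auto

lemma \<sigma>_0 [simp]: "\<sigma> 0 = 0" and \<sigma>_1 [simp]: "\<sigma> 1 = 1"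
  using A_closed \<sigma>_A by auto

lemma \<sigma>_minus: "x \<in> B \<Longrightarrow> \<sigma> (- x) = - \<sigma> x"
  using \<sigma>_add[of x "- x"] B_closed(3)[of x] by simp

lemma \<sigma>_eq_0: "x \<in> B \<Longrightarrow> \<sigma> x = 0 \<Longrightarrow> x = 0"
  using \<sigma>_\<sigma>[of x] by simp

lemma theta_B: "\<theta> \<in> B" and theta_0: "\<theta> \<noteq> 0" and theta_inv: "1 / \<theta> \<in> B"
  using theta_unit by (auto simp: units_iff)

lemma units_AB: "u \<in> units_of_ring A \<Longrightarrow> u \<in> units_of_ring B"
  by (auto simp: units_iff AB)

lemma \<sigma>_unit:
  assumes "u \<in> units_of_ring B"
    shows "\<sigma> u \<in> units_of_ring B" "\<sigma> (1 / u) = 1 / \<sigma> u"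
proof -
  have *: "u \<in> B" "1 / u \<in> B" "u \<noteq> 0" using assms by (auto simp: units_iff)
  then have "\<sigma> u * \<sigma> (1 / u) = 1" using \<sigma>_mult[of u "1 / u"] by simp
  then show "\<sigma> (1 / u) = 1 / \<sigma> u"
    by (metis eq_divide_imp mult.commute mult_zero_left zero_neq_one)
  then show "\<sigma> u \<in> units_of_ring B"
    using * \<sigma>_closed[of u] \<sigma>_closed[of "1 / u"] \<sigma>_eq_0[of u]
    by (auto simp: units_iff)
qed

section \<open>Relative norms and traces\<close>

definition nm :: "real \<Rightarrow> real" where "nm x = x * \<sigma> x"

lemma nm_A: "x \<in> B \<Longrightarrow> nm x \<in> A"
  by (simp add: A_iff nm_def \<sigma>_mult \<sigma>_closed \<sigma>_\<sigma> B_closed)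

lemma tr_A: "x \<in> B \<Longrightarrow> x + \<sigma> x \<in> A"
  by (simp add: A_iff \<sigma>_add \<sigma>_closed \<sigma>_\<sigma> B_closed)

lemma nm_mult: "x \<in> B \<Longrightarrow> y \<in> B \<Longrightarrow> nm (x * y) = nm x * nm y"
  by (simp add: nm_def \<sigma>_mult)

lemma nm_of_A: "x \<in> A \<Longrightarrow> nm x = x ^ 2"
  by (simp add: nm_def \<sigma>_A power2_eq_square)

lemma nm_eq_0: "x \<in> B \<Longrightarrow> nm x = 0 \<Longrightarrow> x = 0"
  using \<sigma>_eq_0 by (auto simp: nm_def)

lemma nm_unit: "u \<in> units_of_ring B \<Longrightarrow> nm u \<in> units_of_ring A"
proof -
  assume u: "u \<in> units_of_ring B"
  then have "nm (1 / u) = 1 / nm u" by (simp add: nm_def \<sigma>_unit)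
  with u nm_A[of "1 / u"] nm_A[of u] nm_eq_0[of u] show ?thesis by (auto simp: units_iff)
qed

lemma unit_of_nm: "x \<in> B \<Longrightarrow> nm x \<in> units_of_ring A \<Longrightarrow> x \<in> units_of_ring B"
  using units_mult_cancel[OF subring_B, of x "\<sigma> x"] units_AB[of "nm x"]
  by (simp add: nm_def \<sigma>_closed)

text \<open>\<open>x - \<sigma> x\<close> and \<open>2 * \<theta>\<close> both change sign under
  \<open>\<sigma>\<close>, so the quotient is fixed, and it stays in \<open>B\<close> because
  \<open>2\<close> and \<open>\<theta>\<close> are units. With \<open>half_sum\<close> this gives
  the coordinates of \<open>x\<close> with respect to 1 and \<open>\<theta>\<close>.\<close>

lemma half_diff: "x \<in> B \<Longrightarrow> (x - \<sigma> x) / (2 * \<theta>) \<in> A"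
proof -
  assume x: "x \<in> B"
  have d: "x - \<sigma> x \<in> B" "\<sigma> (x - \<sigma> x) = - (x - \<sigma> x)"
    using x by (auto simp: \<sigma>_closed B_closed \<sigma>_add[of x "- \<sigma> x", simplified] \<sigma>_minus \<sigma>_\<sigma>)
  have c: "1 / 2 * (1 / \<theta>) \<in> B" "\<sigma> (1 / 2 * (1 / \<theta>)) = - (1 / 2 * (1 / \<theta>))"
    using half AB theta_inv by (auto simp: \<sigma>_mult \<sigma>_unit(2)[OF theta_unit] \<sigma>_A[OF half] \<sigma>_theta B_closed simp del: times_divide_eq_left times_divide_eq_right mult_1)
  have "\<sigma> ((x - \<sigma> x) * (1 / 2 * (1 / \<theta>))) = - (x - \<sigma> x) * - (1 / 2 * (1 / \<theta>))"
    using d c by (simp only: \<sigma>_mult)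
  then have "(x - \<sigma> x) * (1 / 2 * (1 / \<theta>)) \<in> A"
    using B_closed(5)[OF d(1) c(1)] unfolding A_iff by linarith
  then show ?thesis by (simp add: field_simps)
qed

lemma half_sum: "x \<in> B \<Longrightarrow> (x + \<sigma> x) / 2 \<in> A"
  using A_closed(5)[OF half tr_A[of x]] by simp

section \<open>Extension and contraction of ideals\<close>

lemma ext_ideal:
  assumes "is_ideal A I" shows "is_ideal B (iprod I B)"
proof -
  have "a * x \<in> iprod I B" if "x \<in> iprod I B" "a \<in> B" for a x
    using that
  proof (induction rule: iprod.induct)
    case (mult x y)
    then have "x * (a * y) \<in> iprod I B" by (intro iprod.mult B_closed)
    then show ?case by (simp add: mult_ac)
  qed (auto simp: distrib_left intro: iprod.add)
  moreover have "0 \<in> iprod I B" using iprod.mult[of 0 I 0 B] idealD(2)[OF assms] B_closed(2) by simp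
  moreover have "x \<in> B" if "x \<in> iprod I B" for x
    using that by induction (auto intro!: B_closed(4,5) intro: AB dest: idealD(1)[OF assms])
  ultimately show ?thesis by (auto simp: is_ideal_def intro: iprod.add)
qed

text \<open>Half the trace is an \<open>A\<close>-linear projection of \<open>B\<close> onto
  \<open>A\<close>, so it maps the extension of \<open>I\<close> into \<open>I\<close>. It is the
  identity on \<open>A\<close>; hence contraction undoes extension.\<close>

lemma ext_half_sum:
  assumes "is_ideal A I" "x \<in> iprod I B" shows "(x + \<sigma> x) / 2 \<in> I"
  using assms(2)
proof induction
  case (mult x y)
  then have "x \<in> A" using assms(1) idealD by blast
  then have "(x * y + \<sigma> (x * y)) / 2 = x * ((y + \<sigma> y) / 2)"
    using mult by (simp add: \<sigma>_mult AB \<sigma>_A algebra_simps add_divide_distrib)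
  then show ?case using idealD(4)[OF assms(1) half_sum[OF mult(2)] mult(1)] by (simp only: mult.commute)
next
  case (add x y)
  then have "x \<in> B" "y \<in> B" using ext_ideal[OF assms(1)] idealD by blast+
  then have "(x + y + \<sigma> (x + y)) / 2 = (x + \<sigma> x) / 2 + (y + \<sigma> y) / 2"
    by (simp add: \<sigma>_add field_simps)
  then show ?case using add idealD(3)[OF assms(1)] by presburger
qed

lemma contract_ext: "is_ideal A I \<Longrightarrow> iprod I B \<inter> A = I"
proof (intro equalityI subsetI)
  fix x assume "is_ideal A I" "x \<in> iprod I B \<inter> A"
  then show "x \<in> I" using ext_half_sum[of I x] by (simp add: \<sigma>_A)
next
  fix x assume "is_ideal A I" "x \<in> I"
  then show "x \<in> iprod I B \<inter> A" using iprod.mult[of x I 1 B] B_closed(1) idealD by fastforce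
qed

lemma ext_inj: "is_ideal A I \<Longrightarrow> is_ideal A J \<Longrightarrow> iprod I B = iprod J B \<Longrightarrow> I = J"
  by (metis contract_ext)

lemma ext_principal: "iprod (scl a A) B = scl a B"
proof -
  have "iprod A B = B"
    using iprod_subset[OF ideal_ring[OF subring_B], of A] AB iprod.mult[of 1 A _ B] A_closed(1)
    by (auto simp: iprod_commute[of A])
  then show ?thesis by (simp add: iprod_scl_left)
qed

lemma ext_iprod: "iprod (iprod I B) (iprod J B) = iprod (iprod I J) B"
proof -
  have "iprod B B = B" by (simp add: iprod_ring ideal_ring subring_B)
  then show ?thesis by (metis iprod_assoc iprod_commute)
qed

lemma \<sigma>_ideal: "is_ideal B I \<Longrightarrow> is_ideal B (\<sigma> ` I)"
  unfolding is_ideal_def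
proof (safe)
  assume *: "I \<subseteq> B" "0 \<in> I" "\<forall>x\<in>I. \<forall>y\<in>I. x + y \<in> I" "\<forall>a\<in>B. \<forall>x\<in>I. a * x \<in> I"
  show "0 \<in> \<sigma> ` I" using * \<sigma>_0 by force
  show "\<sigma> x + \<sigma> y \<in> \<sigma> ` I" if "x \<in> I" "y \<in> I" for x y
    using * that \<sigma>_add[of x y] by (metis image_eqI subsetD)
  show "a * \<sigma> x \<in> \<sigma> ` I" if "a \<in> B" "x \<in> I" for a x
  proof -
    have "a * \<sigma> x = \<sigma> (\<sigma> a * x)" using that *
      by (simp add: subsetD \<sigma>_mult \<sigma>_closed \<sigma>_\<sigma>)
    then show ?thesis using that * \<sigma>_closed by blast
  qed
qed (auto intro: \<sigma>_closed)

lemma \<sigma>_nonzero_ideal: "I \<in> nonzero_ideals B \<Longrightarrow> \<sigma> ` I \<in> nonzero_ideals B"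
proof -
  assume I: "I \<in> nonzero_ideals B"
  then obtain x where x: "x \<in> I" "x \<noteq> 0" using nonzero_idealsD(2) by blast
  then have "\<sigma> x \<noteq> 0" using \<sigma>_eq_0 idealD(1)[OF nonzero_idealsD(1)[OF I]] by blast
  then show ?thesis using x nonzero_idealsI[OF \<sigma>_ideal imageI] nonzero_idealsD(1)[OF I] by blast
qed

lemma \<sigma>_iprod: "I \<subseteq> B \<Longrightarrow> J \<subseteq> B \<Longrightarrow> \<sigma> ` iprod I J = iprod (\<sigma> ` I) (\<sigma> ` J)"
proof -
  have sub: "\<sigma> ` iprod I J \<subseteq> iprod (\<sigma> ` I) (\<sigma> ` J)"
    if "I \<subseteq> B" "J \<subseteq> B" for I J
  proof
    have "x \<in> B \<and> \<sigma> x \<in> iprod (\<sigma> ` I) (\<sigma> ` J)"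
      if "x \<in> iprod I J" for x
      using that
    proof induction
      case (mult x y)
      then have "\<sigma> (x * y) = \<sigma> x * \<sigma> y" "x * y \<in> B"
        using \<open>I \<subseteq> B\<close> \<open>J \<subseteq> B\<close>
        by (auto simp: \<sigma>_mult B_closed subsetD)
      then show ?case using mult by (auto intro: iprod.mult)
    qed (auto simp: \<sigma>_add B_closed intro: iprod.add)
    then show "y \<in> \<sigma> ` iprod I J \<Longrightarrow> y \<in> iprod (\<sigma> ` I) (\<sigma> ` J)" for y by blast
  qed
  assume *: "I \<subseteq> B" "J \<subseteq> B"
  then have I: "\<sigma> ` \<sigma> ` I = I" "\<sigma> ` \<sigma> ` J = J" "\<sigma> ` I \<subseteq> B" "\<sigma> ` J \<subseteq> B"
    by (force simp: image_image \<sigma>_\<sigma> \<sigma>_closed)+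
  have "x \<in> B" if "x \<in> iprod (\<sigma> ` I) (\<sigma> ` J)" for x
    using that by induction (use I in \<open>auto intro: B_closed simp: subset_iff\<close>)
  then have "iprod (\<sigma> ` I) (\<sigma> ` J) = \<sigma> ` \<sigma> ` iprod (\<sigma> ` I) (\<sigma> ` J)"
    by (force simp: image_image \<sigma>_\<sigma>)
  also have "\<dots> \<subseteq> \<sigma> ` iprod I J" using sub[of "\<sigma> ` I" "\<sigma> ` J"] I
    by (intro image_mono) auto
  finally show ?thesis using sub[OF *] by blast
qed

lemma \<sigma>_scl: "I \<subseteq> B \<Longrightarrow> a \<in> B \<Longrightarrow> \<sigma> ` scl a I = scl (\<sigma> a) (\<sigma> ` I)"
  by (force simp: image_image \<sigma>_mult subsetD)

lemma \<sigma>_B: "\<sigma> ` B = B"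
  using \<sigma>_\<sigma> \<sigma>_closed by force

text \<open>Both 2 and \<open>\<theta>\<close> are units of \<open>B\<close>, so nothing ramifies.\<close>

lemma invariant_ideal:
  assumes I: "I \<in> nonzero_ideals B" and inv: "\<sigma> ` I = I"
  shows "I \<inter> A \<in> nonzero_ideals A" "I = iprod (I \<inter> A) B"
proof -
  have id: "is_ideal B I" using I by (simp add: nonzero_ideals_def)
  have \<sigma>I: "\<sigma> x \<in> I" if "x \<in> I" for x using inv that by blast
  obtain x where x: "x \<in> I" "x \<in> B" "x \<noteq> 0" using I by (auto elim: nonzero_idealsE)
  \<comment> \<open>The norm of a nonzero element of \<open>I\<close> witnesses that the contraction
    is nonzero.\<close>
  have "nm x \<in> I \<inter> A" "nm x \<noteq> 0"
    using x nm_A[of x] nm_eq_0[of x] idealD(5)[OF id, of "\<sigma> x" x] \<sigma>_closed[of x]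
    by (auto simp: nm_def)
  moreover have idA: "is_ideal A (I \<inter> A)"
    using idealD[OF id] A_closed AB by (auto simp: is_ideal_def)
  ultimately show "I \<inter> A \<in> nonzero_ideals A" by (auto intro: nonzero_idealsI)
  show "I = iprod (I \<inter> A) B"
  proof (intro equalityI subsetI)
    fix x assume x: "x \<in> I"
    then have xB: "x \<in> B" using id idealD by blast
    have h: "1 / 2 \<in> B" using half AB by blast
    have "(x + \<sigma> x) / 2 \<in> I" using idealD(4)[OF id h idealD(3)[OF id x \<sigma>I[OF x]]] by simp
    moreover have "(x - \<sigma> x) / (2 * \<theta>) \<in> I"
      using idealD(4)[OF id B_closed(5)[OF h theta_inv] ideal_diff[OF subring_B id x \<sigma>I[OF x]]]
      by simp
    \<comment> \<open>Both coordinates of \<open>x\<close> with respect to 1 and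
      \<open>\<theta>\<close> lie in the contraction, as \<open>I\<close> contains \<open>x\<close>
      and \<open>\<sigma> x\<close>.\<close>
    ultimately have "(x + \<sigma> x) / 2 * 1 + (x - \<sigma> x) / (2 * \<theta>) * \<theta> \<in> iprod (I \<inter> A) B"
      using xB half_sum half_diff theta_B B_closed(1) by (intro iprod.intros) auto
    then show "x \<in> iprod (I \<inter> A) B" using theta_0 by (simp add: field_simps)
  next
    fix x assume "x \<in> iprod (I \<inter> A) B"
    then show "x \<in> I" by induction (auto intro: idealD(2-5)[OF id])
  qed
qed

text \<open>The product of \<open>I\<close> with its conjugate is invariant, hence extended from
  \<open>A\<close>. The ideal below is the relative norm of \<open>I\<close>.\<close>

lemma nm_ideal:
  assumes I: "I \<in> nonzero_ideals B"
  obtains I' where "I' \<in> nonzero_ideals A" "iprod I (\<sigma> ` I) = iprod I' B"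
proof (rule that)
  let ?N = "iprod I (\<sigma> ` I)"
  have sub: "I \<subseteq> B" using I by (auto simp: nonzero_ideals_def is_ideal_def)
  have N: "?N \<in> nonzero_ideals B" using I by (intro iprod_nonzero_ideals \<sigma>_nonzero_ideal)
  have "\<sigma> ` \<sigma> ` I = I" using sub by (force simp: image_image \<sigma>_\<sigma>)
  then have "\<sigma> ` ?N = ?N"
    using sub \<sigma>_closed by (subst \<sigma>_iprod) (auto simp: iprod_commute)
  from invariant_ideal[OF N this] show "?N \<inter> A \<in> nonzero_ideals A" "?N = iprod (?N \<inter> A) B" .
qed

text \<open>Injectivity of extension turns the equation into one between ideals of \<open>A\<close>,
  where the hypothesis on 2-torsion applies.\<close>

lemma ext_sq_principal:
  assumes tor: "no_two_torsion A" and I: "I \<in> nonzero_ideals A"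
    and sq: "iprod (iprod I B) (iprod I B) = scl a B" and a: "a \<in> A"
  obtains b where "b \<in> A" "b \<noteq> 0" "I = scl b A"
proof -
  have idI: "is_ideal A I" using I by (simp add: nonzero_ideals_def)
  have "iprod (iprod I I) B = iprod (scl a A) B" using sq by (simp add: ext_iprod ext_principal)
  then have "iprod I I = scl a A"
    by (rule ext_inj[OF iprod_ideal[OF idI idI] ideal_scl'[OF subring_A ideal_ring[OF subring_A] a]])
  then obtain b where b: "I = scl b A" using tor I unfolding no_two_torsion_def by blast
  have "b * 1 \<in> I" unfolding b using A_closed(1) by (rule imageI)
  then have "b \<in> A" using idealD(1)[OF idI] by simp
  moreover have "b \<noteq> 0"
  proof
    assume "b = 0"
    then have "I \<subseteq> {0}" using b by auto
    then show False using I by (auto elim: nonzero_idealsE)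
  qed
  ultimately show ?thesis using that b by metis
qed

text \<open>The norm ideal below has an inverse class; the extension of that inverse, times the
  conjugate of \<open>I\<close>, is inverse to \<open>I\<close>.\<close>

lemma ideals_invertible_step:
  assumes "ideals_invertible A" shows "ideals_invertible B"
  unfolding ideals_invertible_def
proof
  fix I assume I: "I \<in> nonzero_ideals B"
  obtain I' where I': "I' \<in> nonzero_ideals A" "iprod I (\<sigma> ` I) = iprod I' B"
    using nm_ideal[OF I] .
  then obtain J a where J: "J \<in> nonzero_ideals A" "a \<noteq> 0" "iprod I' J = scl a A"
    using assms by (auto simp: ideals_invertible_def)
  have "iprod I (iprod (\<sigma> ` I) (iprod J B)) = iprod (iprod I' B) (iprod J B)"
    by (simp add: I'(2)[symmetric] iprod_assoc)
  also have "\<dots> = scl a B" by (simp add: ext_iprod J(3) ext_principal)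
  finally have *: "iprod I (iprod (\<sigma> ` I) (iprod J B)) = scl a B" .
  have "iprod J B \<in> nonzero_ideals B"
  proof -
    obtain y where "y \<in> J" "y \<noteq> 0" "is_ideal A J" using nonzero_idealsD[OF J(1)] by blast
    then show ?thesis using nonzero_idealsI[OF ext_ideal iprod.mult, of J y 1] B_closed(1) by simp
  qed
  then have "iprod (\<sigma> ` I) (iprod J B) \<in> nonzero_ideals B"
    by (rule iprod_nonzero_ideals[OF \<sigma>_nonzero_ideal[OF I]])
  moreover have "\<exists>a. a \<noteq> 0 \<and> iprod I (iprod (\<sigma> ` I) (iprod J B)) = scl a B"
    using J(2) * by (intro exI[of _ a]) (rule conjI)
  ultimately show "\<exists>J\<in>nonzero_ideals B. \<exists>a. a \<noteq> 0 \<and> iprod I J = scl a B"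
    by (rule bexI[rotated])
qed

text \<open>The classical theorem applied to \<open>z / a\<close>, with denominators cleared because
  \<open>a\<close> need not be a unit.\<close>

lemma hilbert90:
  assumes z: "z \<in> B" and a: "a \<in> A" "a \<noteq> 0" and "nm z = a ^ 2"
  obtains b where "b \<in> B" "b \<noteq> 0" "\<sigma> b * a = z * b"
proof (cases "a + \<sigma> z = 0")
  case True
  \<comment> \<open>The resolvent \<open>a + \<sigma> z\<close> vanishes exactly when
    \<open>z = - a\<close>; then any anti-invariant element solves the equation, and
    \<open>\<theta>\<close> is one.\<close>
  then have "z = - a" using \<sigma>_\<sigma>[OF z] \<sigma>_minus[of a] a \<sigma>_A AB
    by (metis add_eq_0_iff)
  then show ?thesis using that[of \<theta>] theta_B theta_0 \<sigma>_theta by simp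
next
  case False
  have "\<sigma> (a + \<sigma> z) * a = (a + z) * a" using z a
    by (simp add: \<sigma>_add \<sigma>_closed AB \<sigma>_A \<sigma>_\<sigma>)
  also have "\<dots> = z * (a + \<sigma> z)" using assms(4)
    by (simp add: nm_def algebra_simps power2_eq_square)
  finally show ?thesis using that[of "a + \<sigma> z"] False z a by (simp add: B_closed AB \<sigma>_closed)
qed

lemma unit_nm_1:
  assumes tor: "no_two_torsion A" and u: "u \<in> units_of_ring B" "nm u = 1"
  obtains w v where "w \<in> units_of_ring B" "v \<in> units_of_ring B" "u = nm w * v ^ 2"
proof -
  obtain b where b: "b \<in> B" "b \<noteq> 0" "\<sigma> b * 1 = u * b"
    using hilbert90[of u 1] u A_closed(1) by (auto simp: units_iff)
  let ?I = "scl b B"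
  have I: "?I \<in> nonzero_ideals B" using b by (intro nonzero_ideals_scl subring_B nonzero_ideals_ring)
  have "\<sigma> b = b * u" using b(3) by (simp add: mult.commute)
  then have "\<sigma> ` ?I = scl b (scl u B)"
    using \<sigma>_scl[OF order_refl b(1)] by (simp only: scl_scl \<sigma>_B)
  also have "\<dots> = ?I" by (simp only: scl_unit[OF subring_B ideal_ring[OF subring_B] u(1)])
  finally have inv: "\<sigma> ` ?I = ?I" .
  note I' = invariant_ideal[OF I inv]
  have "iprod ?I ?I = iprod ?I (\<sigma> ` ?I)" using inv by simp
  also have "\<dots> = scl (nm b) B"
    using b by (simp add: \<sigma>_scl \<sigma>_B iprod_scl_left iprod_scl_right scl_scl iprod_ring ideal_ring subring_B nm_def mult.commute[of _ b])
  finally have "iprod (iprod (?I \<inter> A) B) (iprod (?I \<inter> A) B) = scl (nm b) B" using I'(2)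
    by simp
  from ext_sq_principal[OF tor I'(1) this nm_A[OF b(1)]]
  obtain a where a: "a \<in> A" "a \<noteq> 0" "?I \<inter> A = scl a A" .
  have "scl b B = scl a B" using I'(2) a(3) ext_principal by metis
  then obtain w where w: "w \<in> units_of_ring B" "b = a * w" using scl_ring_eqE[OF subring_B] a(2)
    by metis
  have "\<sigma> b = a * \<sigma> w" using w a by (simp add: \<sigma>_mult AB units_iff \<sigma>_A)
  then have "\<sigma> w = u * w" using b w a by auto
  then have "u = nm w * (1 / w) ^ 2" using w by (auto simp: nm_def units_iff power2_eq_square)
  then show ?thesis using that w units_inverse by blast
qed

lemma no_two_torsion_step:
  assumes tor: "no_two_torsion A"
    and surj: "\<And>u. u \<in> units_of_ring A \<Longrightarrow> \<exists>w\<in>units_of_ring B. nm w = u"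
  shows "no_two_torsion B"
  unfolding no_two_torsion_def
proof (intro ballI allI impI)
  fix I x assume I: "I \<in> nonzero_ideals B" and sq: "iprod I I = scl x B"
  have idI: "is_ideal B I" and sub: "I \<subseteq> B" using I
    by (auto simp: nonzero_ideals_def is_ideal_def)
  have sqI: "scl x B \<in> nonzero_ideals B" using iprod_nonzero_ideals[OF I I] by (simp only: sq)
  have "x * 1 \<in> scl x B" using B_closed(1) by (rule imageI)
  then have x: "x \<in> B" using sqI by (auto elim!: nonzero_idealsE dest: idealD(1))
  have x: "x \<in> B" "x \<noteq> 0" using x sqI by (auto elim!: nonzero_idealsE)
  obtain J where J: "J \<in> nonzero_ideals A" "iprod I (\<sigma> ` I) = iprod J B" using nm_ideal[OF I] .
  have \<sigma>sq: "iprod (\<sigma> ` I) (\<sigma> ` I) = scl (\<sigma> x) B"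
    using \<sigma>_iprod[OF sub sub] \<sigma>_scl[of B x] x by (simp add: sq \<sigma>_B)
  have "iprod (iprod J B) (iprod J B) = iprod (iprod I I) (iprod (\<sigma> ` I) (\<sigma> ` I))"
    unfolding J(2)[symmetric] by (simp only: iprod_ac)
  also have "\<dots> = scl (nm x) B"
    by (simp add: mult.commute[of "\<sigma> x" x] sq \<sigma>sq iprod_scl_left iprod_scl_right scl_scl iprod_ring ideal_ring subring_B nm_def)
  finally have JJ: "iprod (iprod J B) (iprod J B) = scl (nm x) B" .
  obtain a where a: "a \<in> A" "a \<noteq> 0" "J = scl a A"
    using ext_sq_principal[OF tor J(1) JJ nm_A[OF x(1)]] .
  have Na: "iprod I (\<sigma> ` I) = scl a B" using J(2) a(3) by (simp add: ext_principal)
  have "scl (a ^ 2) B = scl (nm x) B"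
    using JJ unfolding J(2)[symmetric] Na
    by (simp add: iprod_scl_left iprod_scl_right scl_scl iprod_ring ideal_ring subring_B power2_eq_square)
  then have "iprod (scl (a ^ 2) A) B = iprod (scl (nm x) A) B" by (simp add: ext_principal)
  then have "scl (a ^ 2) A = scl (nm x) A"
    by (rule ext_inj[OF ideal_scl'[OF subring_A ideal_ring[OF subring_A] A_closed(7)[OF a(1)]]
          ideal_scl'[OF subring_A ideal_ring[OF subring_A] nm_A[OF x(1)]]])
  then obtain e where e: "e \<in> units_of_ring A" "a ^ 2 = nm x * e"
    using scl_ring_eqE[OF subring_A] nm_eq_0 x by metis
  obtain w where w: "w \<in> units_of_ring B" "nm w = e" using surj[OF e(1)] by blast
  have wB: "w \<in> B" using w by (simp add: units_iff)
  define z where "z = x * w"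
  have z: "z \<in> B" "nm z = a ^ 2" using x wB e w by (auto simp: z_def B_closed nm_mult)
  obtain b where b: "b \<in> B" "b \<noteq> 0" "\<sigma> b * a = z * b"
    using hilbert90[OF z(1) a(1,2) z(2)] .
  \<comment> \<open>Both sides are the product of \<open>I\<close>, \<open>I\<close> and the
    conjugate of \<open>I\<close>, bracketed in two ways.\<close>
  have "scl x (\<sigma> ` I) = scl a I"
  proof -
    have "scl x (\<sigma> ` I) = iprod (iprod I I) (\<sigma> ` I)"
      unfolding sq iprod_scl_left using \<sigma>_ideal[OF idI]
      by (simp add: iprod_commute[of B] iprod_ring subring_B)
    also have "\<dots> = iprod I (iprod I (\<sigma> ` I))" by (simp add: iprod_assoc)
    also have "\<dots> = scl a I" unfolding Na iprod_scl_right by (simp add: iprod_ring subring_B idI)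
    finally show ?thesis .
  qed
  then have "scl w (scl x (\<sigma> ` I)) = scl w (scl a I)" by (rule arg_cong)
  then have "scl z (\<sigma> ` I) = scl a (scl w I)"
    by (simp only: scl_scl z_def mult.commute[of w x] mult.commute[of w a])
  then have zI: "scl z (\<sigma> ` I) = scl a I" by (simp only: scl_unit[OF subring_B idI w(1)])
  let ?K = "scl b I"
  have K: "?K \<in> nonzero_ideals B" using I b by (intro nonzero_ideals_scl subring_B)
  have "scl a (\<sigma> ` ?K) = scl b (scl z (\<sigma> ` I))"
    using b sub by (simp only: \<sigma>_scl scl_scl mult.commute[of a "\<sigma> b"] mult.commute[of b z])
  also have "\<dots> = scl a ?K" unfolding zI by (simp only: scl_scl mult.commute[of a b])
  finally have inv: "\<sigma> ` ?K = ?K" using a(2) scl_cancel by blast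
  note K' = invariant_ideal[OF K inv]
  \<comment> \<open>The square of \<open>b I\<close> is \<open>(y)\<close>, but \<open>y\<close>
    need not lie in \<open>A\<close>. As \<open>(y)\<close> is invariant, squaring once more gives
    \<open>(nm y)\<close> with \<open>nm y\<close> in \<open>A\<close>. The absence of 2-torsion is
    then applied twice, to \<open>?M\<close> and to \<open>?K \<inter> A\<close>.\<close>
  define y where "y = b * b * x"
  have y: "y \<in> B" "y \<noteq> 0" "iprod ?K ?K = scl y B"
    using b x by (auto simp: y_def B_closed iprod_scl_left iprod_scl_right scl_scl sq mult.assoc)
  let ?M = "iprod (?K \<inter> A) (?K \<inter> A)"
  have M: "?M \<in> nonzero_ideals A" using K'(1) by (intro iprod_nonzero_ideals)
  have extM: "iprod ?M B = scl y B" using K'(2) y(3) by (metis ext_iprod)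
  have "?K \<subseteq> B" using nonzero_idealsD(1)[OF K] by (simp add: is_ideal_def)
  then have "\<sigma> ` iprod ?K ?K = iprod ?K ?K" using \<sigma>_iprod[of ?K ?K] by (simp only: inv)
  then have "\<sigma> ` scl y B = scl y B" by (simp only: y(3))
  then have "iprod (iprod ?M B) (iprod ?M B) = iprod (scl y B) (\<sigma> ` scl y B)" by (simp add: extM)
  also have "\<dots> = scl (nm y) B"
    using y by (simp add: \<sigma>_scl \<sigma>_B iprod_scl_left iprod_scl_right scl_scl iprod_ring ideal_ring subring_B nm_def mult.commute[of _ y])
  finally obtain c where c: "c \<in> A" "?M = scl c A"
    using ext_sq_principal[OF tor M _ nm_A[OF y(1)]] by metis
  have "iprod (iprod (?K \<inter> A) B) (iprod (?K \<inter> A) B) = scl c B"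
    by (simp add: ext_iprod c(2) ext_principal)
  then obtain d where d: "d \<in> A" "?K \<inter> A = scl d A" using ext_sq_principal[OF tor K'(1) _ c(1)]
    by metis
  have "scl b I = scl d B" using K'(2) d(2) ext_principal by metis
  moreover have "b * (d / b) = d" using b(2) by simp
  ultimately have "scl b I = scl b (scl (d / b) B)" by (simp only: scl_scl)
  then have "I = scl (d / b) B" by (rule scl_cancel[OF b(2)])
  then show "\<exists>b. I = scl b B" by blast
qed

end

section \<open>Conjugations of the real cyclotomic rings\<close>

abbreviation ev :: "int poly \<Rightarrow> real \<Rightarrow> real" where
  "ev p x \<equiv> poly (map_poly of_int p) x"

lemma ev_0: "ev 0 x = 0" and ev_pCons: "ev (pCons a p) x = of_int a + x * ev p x"
  by (auto simp: map_poly_pCons)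

lemma ev_1: "ev 1 x = 1"
  by simp

lemma ev_add: "ev (p + q) x = ev p x + ev q x"
proof -
  have "map_poly of_int (p + q) = (map_poly of_int p + map_poly of_int q :: real poly)"
    by (rule poly_eqI) (simp add: coeff_map_poly)
  then show ?thesis by simp
qed

lemma ev_minus: "ev (- p) x = - ev p x"
  using ev_add[of p "- p" x] by simp

lemma ev_diff: "ev (p - q) x = ev p x - ev q x"
  using ev_add[of p "- q" x] by (simp add: ev_minus)

lemma ev_smult: "ev (smult a p) x = of_int a * ev p x"
  by (simp add: map_poly_smult)

lemma ev_mult: "ev (p * q) x = ev p x * ev q x"
  by (induction p) (simp_all add: ev_add ev_smult ev_pCons algebra_simps)

lemma ev_power: "ev (p ^ k) x = ev p x ^ k"
  by (induction k) (simp_all add: ev_mult)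

lemma ev_pcompose: "ev (pcompose p q) x = ev p (ev q x)"
  by (induction p) (simp_all add: pcompose_pCons ev_add ev_mult ev_pCons)

lemmas ev_simps = ev_0 ev_1 ev_pCons ev_add ev_minus ev_diff ev_smult ev_mult ev_power ev_pcompose

lemma subring_ev: "subring A \<Longrightarrow> x \<in> A \<Longrightarrow> ev p x \<in> A"
  by (induction p) (simp_all add: ev_pCons subringD)

text \<open>Even and odd parts, written in \<open>x ^ 2 - 2\<close> because this maps
  \<open>theta (2 * n)\<close> to \<open>theta n\<close>: the result is the pair of coordinates over
  the lower level.\<close>

lemma ev_split:
  obtains a b where "\<And>x. ev p x = ev a (x ^ 2 - 2) + x * ev b (x ^ 2 - 2)"
proof -
  have "\<exists>a b. \<forall>x. ev p x = ev a (x ^ 2 - 2) + x * ev b (x ^ 2 - 2)"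
  proof (induction p)
    case 0 show ?case by (intro exI[of _ 0]) simp
  next
    case (pCons c p)
    then obtain a b where ab: "\<And>x. ev p x = ev a (x ^ 2 - 2) + x * ev b (x ^ 2 - 2)" by blast
    have "ev (pCons c p) x = ev ([:c:] + [:2, 1:] * b) (x ^ 2 - 2) + x * ev a (x ^ 2 - 2)" for x
      by (simp add: ev_simps ab algebra_simps power2_eq_square)
    then show ?case by blast
  qed
  then show ?thesis using that by blast
qed

section \<open>The rings with and without 1/2\<close>

lemma Ocyc_iff: "x \<in> Ocyc n \<longleftrightarrow> (\<exists>p. x = ev p (theta n))"
  by (simp add: Ocyc_def)

lemma Rcyc_iff: "x \<in> Rcyc n \<longleftrightarrow> (\<exists>p m. x = ev p (theta n) / 2 ^ m)"
  by (auto simp: Rcyc_def Ocyc_iff)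

lemma subring_Ocyc: "subring (Ocyc n)"
  unfolding subring_def
proof (intro conjI ballI)
  show "1 \<in> Ocyc n" by (auto simp: Ocyc_iff intro: exI[of _ 1])
  fix x y assume "x \<in> Ocyc n" "y \<in> Ocyc n"
  then show "x + y \<in> Ocyc n" "x * y \<in> Ocyc n" unfolding Ocyc_iff by (metis ev_add, metis ev_mult)
next
  show "x \<in> Ocyc n \<Longrightarrow> - x \<in> Ocyc n" for x unfolding Ocyc_iff by (metis ev_minus)
qed

text \<open>Used for rings and for ideals alike.\<close>

definition loc2 :: "real set \<Rightarrow> real set" where
  "loc2 I = {x / 2 ^ m | x m. x \<in> I}"

lemma Rcyc_eq: "Rcyc n = loc2 (Ocyc n)"
  by (simp add: Rcyc_def loc2_def)

lemma loc2I: "x \<in> I \<Longrightarrow> x / 2 ^ m \<in> loc2 I"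
  by (auto simp: loc2_def)

lemma loc2_sub: "x \<in> I \<Longrightarrow> x \<in> loc2 I"
  using loc2I[of x I 0] by simp

lemma subring_loc2:
  assumes A: "subring A" shows "subring (loc2 A)"
  unfolding subring_def
proof (intro conjI ballI)
  show "1 \<in> loc2 A" by (intro loc2_sub subringD A)
  fix x y assume "x \<in> loc2 A" "y \<in> loc2 A"
  then obtain a b k l where *: "x = a / 2 ^ k" "y = b / 2 ^ l" "a \<in> A" "b \<in> A"
    by (auto simp: loc2_def)
  have "x + y = (a * 2 ^ l + b * 2 ^ k) / 2 ^ (k + l)" "x * y = (a * b) / 2 ^ (k + l)"
    by (auto simp: * field_simps power_add)
  moreover have "a * 2 ^ l + b * 2 ^ k \<in> A" "a * b \<in> A" using * subringD[OF A] by simp_all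
  ultimately show "x + y \<in> loc2 A" "x * y \<in> loc2 A" using loc2I by metis+
next
  fix x assume "x \<in> loc2 A"
  then obtain a k where "x = a / 2 ^ k" "a \<in> A" by (auto simp: loc2_def)
  then show "- x \<in> loc2 A" using loc2I[of "- a" A k] subringD(3)[OF A] by simp
qed

lemma subring_Rcyc: "subring (Rcyc n)"
  by (simp add: Rcyc_eq subring_loc2 subring_Ocyc)

lemma Ocyc_Rcyc: "x \<in> Ocyc n \<Longrightarrow> x \<in> Rcyc n"
  by (simp add: Rcyc_eq loc2_sub)

lemma half_Rcyc: "1 / 2 \<in> Rcyc n"
  using loc2I[OF subringD(1)[OF subring_Ocyc[of n]], of 1] by (simp add: Rcyc_eq)

lemma theta_Ocyc: "theta n \<in> Ocyc n"
  unfolding Ocyc_iff by (rule exI[of _ "[:0, 1:]"]) (simp add: ev_pCons)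

section \<open>Conjugates of theta and multiple angles\<close>

lemma theta_conj_1 [simp]: "theta_conj n (Suc 0) = theta n" "theta_conj n 1 = theta n"
  by (simp_all add: theta_conj_def theta_def)

text \<open>The recursion for Chebyshev polynomials, rescaled to \<open>2 * cos\<close> so that the
  coefficients are integers and the conjugates of \<open>theta n\<close> stay in
  \<open>Ocyc n\<close>.\<close>

lemma cheb:
  obtains p where "\<And>\<phi>. ev p (2 * cos \<phi>) = 2 * cos (real k * \<phi>)"
proof -
  have "\<exists>p. \<forall>\<phi>. ev p (2 * cos \<phi>) = 2 * cos (real k * \<phi>)"
  proof (induction k rule: induct_nat_012)
    case 0 show ?case by (rule exI[of _ "[:2:]"]) (simp add: ev_pCons)
  next
    case 1 show ?case by (rule exI[of _ "[:0, 1:]"]) (simp add: ev_pCons)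
  next
    case (ge2 k)
    then obtain p q where p: "\<And>\<phi>. ev p (2 * cos \<phi>) = 2 * cos (real k * \<phi>)"
      and q: "\<And>\<phi>. ev q (2 * cos \<phi>) = 2 * cos (real (Suc k) * \<phi>)" by blast
    have "2 * cos (real (Suc (Suc k)) * \<phi>) = 2 * cos \<phi> * (2 * cos (real (Suc k) * \<phi>)) - 2 * cos (real k * \<phi>)" for \<phi>
      using cos_add[of "real (Suc k) * \<phi>" \<phi>] cos_diff[of "real (Suc k) * \<phi>" \<phi>]
      by (simp add: algebra_simps)
    then have "ev ([:0, 1:] * q - p) (2 * cos \<phi>) = 2 * cos (real (Suc (Suc k)) * \<phi>)" for \<phi>
      by (simp add: ev_simps p q)
    then show ?case by blast
  qed
  then show ?thesis using that by blast
qed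

lemma cheb_theta:
  obtains p where "\<And>n j. ev p (theta_conj n j) = theta_conj n (k * j)"
proof -
  obtain p where p: "\<And>\<phi>. ev p (2 * cos \<phi>) = 2 * cos (real k * \<phi>)" using cheb by blast
  have "ev p (theta_conj n j) = theta_conj n (k * j)" for n j
    unfolding theta_conj_def p by (simp add: mult_ac)
  then show ?thesis using that by blast
qed

lemma theta_conj_Ocyc: "theta_conj n k \<in> Ocyc n"
proof -
  obtain p where "\<And>n j. ev p (theta_conj n j) = theta_conj n (k * j)" using cheb_theta by blast
  from this[of n 1] show ?thesis unfolding Ocyc_iff by (intro exI[of _ p]) simp
qed

lemma theta_conj_double: "theta_conj (2 * n) k ^ 2 = 2 + theta_conj n k"
proof -
  have "cos (2 * (pi * real k / real n)) = 2 * cos (pi * real k / real n) ^ 2 - 1" by (rule cos_double_cos)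
  then show ?thesis by (simp add: theta_conj_def power_mult_distrib field_simps)
qed

lemma theta_double: "theta (2 * n) ^ 2 = 2 + theta n"
  using theta_conj_double[of n 1] by simp

text \<open>Adding \<open>n\<close> to the index adds \<open>pi\<close> to the angle. This is the
  automorphism of the step from \<open>n\<close> to \<open>2 * n\<close>; by
  \<open>theta_conj_period\<close> it leaves level \<open>n\<close> alone.\<close>

lemma theta_conj_shift: "n > 0 \<Longrightarrow> theta_conj (2 * n) (k + n) = - theta_conj (2 * n) k"
proof -
  assume "n > 0"
  then have "2 * pi * real (k + n) / real (2 * n) = 2 * pi * real k / real (2 * n) + pi"
    by (simp add: field_simps)
  then show ?thesis unfolding theta_conj_def by (simp only: cos_periodic_pi)
qed

lemma theta_conj_period: "n > 0 \<Longrightarrow> theta_conj n (k + n) = theta_conj n k"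
proof -
  assume "n > 0"
  then have "2 * pi * real (k + n) / real n = 2 * pi * real k / real n + 2 * pi"
    by (simp add: field_simps)
  then show ?thesis unfolding theta_conj_def by (simp only: cos_periodic)
qed

lemma theta_conj_less_2:
  assumes "coprime k n" "n > 1" shows "\<bar>theta_conj n k\<bar> \<le> 2" "theta_conj n k < 2"
proof -
  show "\<bar>theta_conj n k\<bar> \<le> 2" using abs_cos_le_one[of "2 * pi * real k / real n"]
    by (simp add: theta_conj_def abs_mult)
  have "cos (2 * pi * real k / real n) \<noteq> 1"
  proof
    assume "cos (2 * pi * real k / real n) = 1"
    then obtain j :: int where "2 * pi * real k / real n = of_int j * 2 * pi"
      by (auto simp: cos_one_2pi_int)
    then have "real k = of_int j * real n" using assms(2) by (simp add: field_simps)
    then have "int k = j * int n" by (metis of_int_eq_iff of_int_mult of_int_of_nat_eq)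
    then have "n dvd k" by (metis dvd_triv_right int_dvd_int_iff)
    then show False using assms by (metis coprime_absorb_right nat_neq_iff nat_dvd_1_iff_1)
  qed
  then have "cos (2 * pi * real k / real n) < 1" by (rule le_neq_trans[OF cos_le_one])
  then show "theta_conj n k < 2" by (simp add: theta_conj_def)
qed

lemma coprime_double: "even (n::nat) \<Longrightarrow> coprime k (2 * n) \<longleftrightarrow> coprime k n"
  by (auto elim!: evenE)

lemma coprime_shift: "even (n::nat) \<Longrightarrow> coprime k n \<Longrightarrow> coprime (k + n) (2 * n)"
  by (simp only: coprime_double) (simp add: coprime_iff_gcd_eq_1)

text \<open>Equivalently, \<open>theta n \<mapsto> theta_conj n k\<close> extends to a well-defined injective ring homomorphism.\<close>

definition conj_wd :: "nat \<Rightarrow> bool" where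
  "conj_wd n \<longleftrightarrow> (\<forall>k p. coprime k n \<longrightarrow> (ev p (theta n) = 0 \<longleftrightarrow> ev p (theta_conj n k) = 0))"

text \<open>Recall that \<open>theta (2 * n)\<close> is a square root of \<open>2 + theta n\<close>.\<close>

definition nonsquare_step :: "nat \<Rightarrow> bool" where
  "nonsquare_step n \<longleftrightarrow> (\<forall>x\<in>Ocyc n. \<forall>y\<in>Ocyc n. x ^ 2 = (2 + theta n) * y ^ 2 \<longrightarrow> y = 0)"

text \<open>Write the value of \<open>p\<close> as \<open>a + theta (2 * n) * b\<close> over level
  \<open>n\<close>. If \<open>p\<close> vanishes at one conjugate, its relative norm vanishes at the
  conjugate below, hence at \<open>theta n\<close>. There \<open>nonsquare_step n\<close> forbids
  nontrivial zeros of the norm form, so \<open>a\<close> and \<open>b\<close> vanish at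
  \<open>theta n\<close> and then at all conjugates.\<close>

lemma conj_wd_double:
  assumes "even n" "conj_wd n" "nonsquare_step n"
  shows "conj_wd (2 * n)"
  unfolding conj_wd_def
proof (intro allI impI)
  fix k p assume k: "coprime k (2 * n)"
  then have kn: "coprime k n" using assms(1) by (simp add: coprime_double)
  obtain a b where ab: "\<And>x. ev p x = ev a (x ^ 2 - 2) + x * ev b (x ^ 2 - 2)" using ev_split[of p]
    by blast
  let ?x = "ev a (theta n)" and ?y = "ev b (theta n)"
  have O: "?x \<in> Ocyc n" "?y \<in> Ocyc n" by (auto simp: Ocyc_iff)
  \<comment> \<open>The relative norm of \<open>p\<close>, as a polynomial at level
    \<open>n\<close>.\<close>
  let ?p = "a * a - [:2, 1:] * b * b"
  have p: "ev ?p t = ev a t ^ 2 - (2 + t) * ev b t ^ 2" for t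
    by (simp add: ev_simps power2_eq_square algebra_simps)
  have zero: "?x = 0 \<and> ?y = 0" if "ev ?p (theta n) = 0"
  proof -
    have "?x ^ 2 = (2 + theta n) * ?y ^ 2" using that unfolding p by simp
    then have "?y = 0" using assms(3) O unfolding nonsquare_step_def by blast
    with \<open>?x ^ 2 = _\<close> show ?thesis by simp
  qed
  have e: "ev p (theta_conj (2 * n) j) = ev a (theta_conj n j) + theta_conj (2 * n) j * ev b (theta_conj n j)" for j
    using ab[of "theta_conj (2 * n) j"] by (simp add: theta_conj_double)
  have P: "ev ?p (theta_conj n j) = 0" if "ev p (theta_conj (2 * n) j) = 0" for j
  proof -
    have "ev a (theta_conj n j) = - theta_conj (2 * n) j * ev b (theta_conj n j)" using e[of j] that by simp
    then have "ev a (theta_conj n j) ^ 2 = theta_conj (2 * n) j ^ 2 * ev b (theta_conj n j) ^ 2"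
      by (simp add: power_mult_distrib)
    then show ?thesis unfolding p by (simp add: theta_conj_double)
  qed
  show "ev p (theta (2 * n)) = 0 \<longleftrightarrow> ev p (theta_conj (2 * n) k) = 0"
  proof
    assume "ev p (theta (2 * n)) = 0"
    then have "?x = 0 \<and> ?y = 0" using zero P[of 1] by simp
    then show "ev p (theta_conj (2 * n) k) = 0" using assms(2) kn by (simp add: e conj_wd_def)
  next
    assume "ev p (theta_conj (2 * n) k) = 0"
    from P[OF this] have "ev ?p (theta n) = 0" using assms(2) kn unfolding conj_wd_def by blast
    then show "ev p (theta (2 * n)) = 0" using zero e[of 1] by simp
  qed
qed

text \<open>Meaningful only on \<open>Rcyc n\<close>, and only once \<open>conj_wd n\<close> makes the choice irrelevant.\<close>

definition emb :: "nat \<Rightarrow> nat \<Rightarrow> real \<Rightarrow> real" where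
  "emb n k x = (SOME y. \<exists>p m. x = ev p (theta n) / 2 ^ m \<and> y = ev p (theta_conj n k) / 2 ^ m)"

lemma emb_eq:
  assumes wd: "conj_wd n" and k: "coprime k n"
  shows "emb n k (ev p (theta n) / 2 ^ m) = ev p (theta_conj n k) / 2 ^ m"
proof -
  let ?P = "\<lambda>y. \<exists>q l. ev p (theta n) / 2 ^ m = ev q (theta n) / 2 ^ l \<and> y = ev q (theta_conj n k) / 2 ^ l"
  have "?P (emb n k (ev p (theta n) / 2 ^ m))" unfolding emb_def by (rule someI_ex) blast
  then obtain q l where q: "ev p (theta n) / 2 ^ m = ev q (theta n) / 2 ^ l"
    "emb n k (ev p (theta n) / 2 ^ m) = ev q (theta_conj n k) / 2 ^ l" by blast
  have "ev (smult (2 ^ l) p - smult (2 ^ m) q) (theta n) = 0"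
    using q(1) by (simp add: ev_simps field_simps)
  then have "ev (smult (2 ^ l) p - smult (2 ^ m) q) (theta_conj n k) = 0"
    using wd k unfolding conj_wd_def by blast
  then have "2 ^ l * ev p (theta_conj n k) = 2 ^ m * ev q (theta_conj n k)" by (simp add: ev_simps)
  then have "ev p (theta_conj n k) / 2 ^ m = ev q (theta_conj n k) / 2 ^ l" by (simp add: field_simps)
  then show ?thesis by (simp only: q(2))
qed

text \<open>\<open>tpos\<close> quantifies over all representations of \<open>x\<close> and holds
  vacuously for a real without one. On \<open>Rcyc n\<close> there is one, and
  \<open>conj_wd\<close> makes all of them give the same conjugates.\<close>

lemma tpos_iff:
  assumes wd: "conj_wd n" and x: "x \<in> Rcyc n"
  shows "tpos n x \<longleftrightarrow> (\<forall>k. coprime k n \<longrightarrow> emb n k x > 0)"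
proof -
  obtain p m where pm: "x = ev p (theta n) / 2 ^ m" using x by (auto simp: Rcyc_iff)
  have "emb n k x > 0 \<longleftrightarrow> ev q (theta_conj n k) > 0"
    if "coprime k n" "ev q (theta n) = x * 2 ^ l" for k q l
  proof -
    have "x = ev q (theta n) / 2 ^ l" using that(2) by simp
    then have "emb n k x = ev q (theta_conj n k) / 2 ^ l" using emb_eq[OF wd that(1)] by simp
    then show ?thesis by (simp add: zero_less_divide_iff)
  qed
  moreover have "ev p (theta n) = x * 2 ^ m" by (simp add: pm)
  ultimately show ?thesis unfolding tpos_def by blast
qed

section \<open>The conjugations as ring homomorphisms\<close>

context
  fixes n k :: nat
  assumes wd: "conj_wd n" and k: "coprime k n"
begin

lemma emb_ev': "emb n k (ev p (theta n)) = ev p (theta_conj n k)"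
  using emb_eq[OF wd k, of p 0] by simp

lemma emb_add: "x \<in> Rcyc n \<Longrightarrow> y \<in> Rcyc n \<Longrightarrow> emb n k (x + y) = emb n k x + emb n k y"
proof -
  assume "x \<in> Rcyc n" "y \<in> Rcyc n"
  then obtain p q l m where *: "x = ev p (theta n) / 2 ^ l" "y = ev q (theta n) / 2 ^ m"
    by (auto simp: Rcyc_iff)
  have "x + y = ev (smult (2 ^ m) p + smult (2 ^ l) q) (theta n) / 2 ^ (l + m)"
    unfolding * by (simp add: ev_simps add_divide_distrib power_add)
  then show ?thesis by (simp only: * emb_eq[OF wd k]) (simp add: ev_simps field_simps power_add)
qed

lemma emb_mult: "x \<in> Rcyc n \<Longrightarrow> y \<in> Rcyc n \<Longrightarrow> emb n k (x * y) = emb n k x * emb n k y"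
proof -
  assume "x \<in> Rcyc n" "y \<in> Rcyc n"
  then obtain p q l m where *: "x = ev p (theta n) / 2 ^ l" "y = ev q (theta n) / 2 ^ m"
    by (auto simp: Rcyc_iff)
  have "x * y = ev (p * q) (theta n) / 2 ^ (l + m)"
    unfolding * by (simp add: ev_simps power_add)
  then show ?thesis by (simp only: * emb_eq[OF wd k]) (simp add: ev_simps field_simps power_add)
qed

lemma emb_of_int [simp]: "emb n k (of_int c) = of_int c"
  using emb_ev'[of "[:c:]"] by (simp add: ev_pCons)

lemma emb_0 [simp]: "emb n k 0 = 0" and emb_1 [simp]: "emb n k 1 = 1" and emb_numeral [simp]: "emb n k (numeral w) = numeral w"
  using emb_of_int[of 0] emb_of_int[of 1] emb_of_int[of "numeral w"] by simp_all

lemma emb_minus: "x \<in> Rcyc n \<Longrightarrow> emb n k (- x) = - emb n k x"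
  using emb_add[of x "- x"] subringD(3)[OF subring_Rcyc] by fastforce

lemma emb_diff: "x \<in> Rcyc n \<Longrightarrow> y \<in> Rcyc n \<Longrightarrow> emb n k (x - y) = emb n k x - emb n k y"
  using emb_add[of x "- y"] subringD(3)[OF subring_Rcyc] by (simp add: emb_minus)

lemma emb_power: "x \<in> Rcyc n \<Longrightarrow> emb n k (x ^ j) = emb n k x ^ j"
  by (induction j) (simp_all add: emb_mult subringD[OF subring_Rcyc])

lemma emb_eq_0: "x \<in> Rcyc n \<Longrightarrow> emb n k x = 0 \<longleftrightarrow> x = 0"
proof -
  assume "x \<in> Rcyc n"
  then obtain p m where "x = ev p (theta n) / 2 ^ m" by (auto simp: Rcyc_iff)
  then show ?thesis using wd k emb_eq[OF wd k, of p m] by (simp add: conj_wd_def)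
qed

lemma emb_Ocyc: "x \<in> Ocyc n \<Longrightarrow> emb n k x \<in> Ocyc n"
  by (auto simp: Ocyc_iff[of x] emb_ev' intro!: subring_ev subring_Ocyc theta_conj_Ocyc)

lemma emb_Rcyc: "x \<in> Rcyc n \<Longrightarrow> emb n k x \<in> Rcyc n"
proof -
  assume "x \<in> Rcyc n"
  then obtain p m where "x = ev p (theta n) / 2 ^ m" by (auto simp: Rcyc_iff)
  then show ?thesis
    using loc2I[OF subring_ev[OF subring_Ocyc theta_conj_Ocyc]] by (simp add: Rcyc_eq emb_eq[OF wd k])
qed

lemma emb_ev: "y \<in> Rcyc n \<Longrightarrow> emb n k (ev q y) = ev q (emb n k y)"
  by (induction q) (simp_all add: ev_pCons emb_add emb_mult subringD subring_Rcyc subring_ev)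

lemma emb_theta: "emb n k (theta n) = theta_conj n k"
  using emb_ev'[of "[:0, 1:]"] by (simp add: ev_pCons)

lemma emb_theta_conj: "emb n k (theta_conj n j) = theta_conj n (j * k)"
proof -
  obtain p where p: "\<And>n i. ev p (theta_conj n i) = theta_conj n (j * i)" using cheb_theta by blast
  from p[of n 1] show ?thesis using emb_ev'[of p] by (simp add: p)
qed

end

lemma emb_Suc_0: "conj_wd n \<Longrightarrow> x \<in> Rcyc n \<Longrightarrow> emb n 1 x = x"
  using emb_eq[of n 1] by (auto simp: Rcyc_iff)

section \<open>Coordinates and conjugations over the lower level\<close>

lemma Rcyc_double:
  assumes n: "n > 0" "even n" and wd: "conj_wd (2 * n)" and x: "x \<in> Rcyc (2 * n)"
  obtains a b where "a \<in> Rcyc n" "b \<in> Rcyc n" "x = a + theta (2 * n) * b"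
    "emb (2 * n) (n + 1) x = a - theta (2 * n) * b" "x \<in> Ocyc (2 * n) \<Longrightarrow> a \<in> Ocyc n \<and> b \<in> Ocyc n"
proof -
  have co: "coprime (n + 1) (2 * n)" using n(2) by (simp add: coprime_double)
  have th: "theta_conj (2 * n) (n + 1) = - theta (2 * n)"
    using theta_conj_shift[OF n(1), of 1] by simp
  \<comment> \<open>For integral \<open>x\<close> the denominator is taken to be 1, so that the same
    coordinates serve both rings.\<close>
  obtain p m where pm: "x = ev p (theta (2 * n)) / 2 ^ m" "x \<in> Ocyc (2 * n) \<Longrightarrow> m = 0"
  proof (cases "x \<in> Ocyc (2 * n)")
    case True then show ?thesis using that[of _ 0] by (auto simp: Ocyc_iff)
  next
    case False then show ?thesis using that x by (auto simp: Rcyc_iff)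
  qed
  obtain a b where ab: "\<And>x. ev p x = ev a (x ^ 2 - 2) + x * ev b (x ^ 2 - 2)" using ev_split[of p]
    by blast
  have "x = ev a (theta n) / 2 ^ m + theta (2 * n) * (ev b (theta n) / 2 ^ m)"
    by (simp add: pm(1) ab theta_double add_divide_distrib)
  moreover have "emb (2 * n) (n + 1) x = ev p (- theta (2 * n)) / 2 ^ m"
    by (simp only: pm(1) emb_eq[OF wd co] th)
  then have "emb (2 * n) (n + 1) x = ev a (theta n) / 2 ^ m - theta (2 * n) * (ev b (theta n) / 2 ^ m)"
    by (simp add: ab theta_double diff_divide_distrib)
  moreover have "ev q (theta n) / 2 ^ m \<in> Rcyc n" "x \<in> Ocyc (2 * n) \<Longrightarrow> ev q (theta n) / 2 ^ m \<in> Ocyc n" for q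
    using pm(2) by (auto simp: Rcyc_iff Ocyc_iff)
  ultimately show ?thesis using that by metis
qed

lemma Ocyc_double_sub: "x \<in> Ocyc n \<Longrightarrow> x \<in> Ocyc (2 * n)"
proof -
  assume "x \<in> Ocyc n"
  then obtain p where "x = ev p (theta (2 * n) ^ 2 - 2)" by (auto simp: Ocyc_iff theta_double)
  then show ?thesis using subring_ev[OF subring_Ocyc] theta_Ocyc subringD[OF subring_Ocyc] by metis
qed

lemma Rcyc_double_sub: "x \<in> Rcyc n \<Longrightarrow> x \<in> Rcyc (2 * n)"
  by (auto simp: Rcyc_eq loc2_def intro: Ocyc_double_sub)

text \<open>Substituting \<open>t ^ 2 - 2\<close> rewrites a polynomial in \<open>theta n\<close> as
  one in \<open>theta (2 * n)\<close>, compatibly with all conjugations.\<close>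

lemma emb_double_restrict:
  assumes "even n" "conj_wd n" "conj_wd (2 * n)" "coprime k n" "x \<in> Rcyc n"
  shows "emb (2 * n) k x = emb n k x"
proof -
  obtain p m where x: "x = ev p (theta n) / 2 ^ m" using assms(5) by (auto simp: Rcyc_iff)
  let ?q = "pcompose p [:- 2, 0, 1:]"
  have q: "ev ?q t = ev p (t ^ 2 - 2)" for t by (simp add: ev_simps power2_eq_square)
  have "x = ev ?q (theta (2 * n)) / 2 ^ m" by (simp only: q theta_double x) simp
  then have "emb (2 * n) k x = ev ?q (theta_conj (2 * n) k) / 2 ^ m"
    using emb_eq[OF assms(3) coprime_double[OF assms(1), THEN iffD2, OF assms(4)]] by (simp only:)
  also have "\<dots> = ev p (theta_conj n k) / 2 ^ m" by (simp only: q theta_conj_double) simp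
  finally show ?thesis using emb_eq[OF assms(2,4)] by (simp add: x)
qed

text \<open>Negating the variable of the polynomial represents the shift by \<open>n\<close> at
  \<open>theta (2 * n)\<close> and at its \<open>k\<close>-th conjugate alike.\<close>

lemma emb_compose_shift:
  assumes "n > 0" "even n" "conj_wd (2 * n)" "coprime k n" "x \<in> Rcyc (2 * n)"
  shows "emb (2 * n) k (emb (2 * n) (n + 1) x) = emb (2 * n) (k + n) x"
proof -
  obtain p m where x: "x = ev p (theta (2 * n)) / 2 ^ m" using assms(5) by (auto simp: Rcyc_iff)
  let ?q = "pcompose p [:0, - 1:]"
  have q: "ev ?q t = ev p (- t)" for t by (simp add: ev_simps)
  have co: "coprime k (2 * n)" "coprime (k + n) (2 * n)" "coprime (n + 1) (2 * n)"
    using assms(2,4) coprime_shift by (auto simp: coprime_double)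
  have "emb (2 * n) (n + 1) x = ev ?q (theta (2 * n)) / 2 ^ m"
    using theta_conj_shift[OF assms(1), of 1]
    by (simp only: x emb_eq[OF assms(3) co(3)] q) (simp add: add.commute)
  then have "emb (2 * n) k (emb (2 * n) (n + 1) x) = ev ?q (theta_conj (2 * n) k) / 2 ^ m"
    by (simp only: emb_eq[OF assms(3) co(1)])
  also have "\<dots> = emb (2 * n) (k + n) x"
    by (simp only: x emb_eq[OF assms(3) co(2)] q theta_conj_shift[OF assms(1)])
  finally show ?thesis .
qed

lemma Ocyc_relative_norm:
  assumes n: "n > 0" "even n" and wd: "conj_wd (2 * n)" and x: "x \<in> Ocyc (2 * n)"
  shows "x * emb (2 * n) (n + 1) x \<in> Ocyc n"
proof -
  let ?t = "theta (2 * n)"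
  obtain a b where ab: "x = a + ?t * b" "emb (2 * n) (n + 1) x = a - ?t * b" "a \<in> Ocyc n" "b \<in> Ocyc n"
    using Rcyc_double[OF n wd Ocyc_Rcyc[OF x]] x by metis
  have "x * emb (2 * n) (n + 1) x = (a + ?t * b) * (a - ?t * b)" by (simp only: ab(2)) (simp only: ab(1))
  also have "\<dots> = a * a - (?t ^ 2) * b * b" by (simp add: algebra_simps power2_eq_square)
  also have "\<dots> \<in> Ocyc n" unfolding theta_double using ab(3,4) theta_Ocyc subringD[OF subring_Ocyc]
    by simp
  finally show ?thesis .
qed

text \<open>Taking relative norms of \<open>x ^ 2 = (2 + theta (2 * n)) * y ^ 2\<close> turns the
  factor into \<open>4 - theta (2 * n) ^ 2 = 2 - theta n\<close>, which is conjugate to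
  \<open>2 + theta n\<close>. So a solution at the upper level yields one at level
  \<open>n\<close>.\<close>

lemma nonsquare_step_double:
  assumes "n > 0" "4 dvd n" "conj_wd n" "conj_wd (2 * n)" "nonsquare_step n"
  shows "nonsquare_step (2 * n)"
  unfolding nonsquare_step_def
proof (intro ballI impI)
  have even: "even n" using assms(2) by auto
  fix x y assume xy: "x \<in> Ocyc (2 * n)" "y \<in> Ocyc (2 * n)" "x ^ 2 = (2 + theta (2 * n)) * y ^ 2"
  let ?t = "theta (2 * n)" and ?s = "emb (2 * n) (n + 1)"
  have co: "coprime (n + 1) (2 * n)" using even by (simp add: coprime_double)
  have th: "?s ?t = - ?t"
    unfolding emb_theta[OF assms(4) co] using theta_conj_shift[OF assms(1), of 1] by simp
  note R = subringD[OF subring_Rcyc]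
  have xR: "x \<in> Rcyc (2 * n)" "y \<in> Rcyc (2 * n)" "?t \<in> Rcyc (2 * n)"
    using xy Ocyc_Rcyc theta_Ocyc by auto
  obtain X Y where XY: "x * ?s x = X" "y * ?s y = Y" "X \<in> Ocyc n" "Y \<in> Ocyc n"
    using Ocyc_relative_norm[OF assms(1) even assms(4)] xy(1,2) by blast
  have "?s x ^ 2 = ?s ((2 + ?t) * y ^ 2)" using xy(3) xR(1) emb_power[OF assms(4) co] by metis
  also have "\<dots> = (2 - ?t) * ?s y ^ 2"
    using xR by (simp add: emb_mult[OF assms(4) co] emb_add[OF assms(4) co] emb_power[OF assms(4) co] emb_numeral[OF assms(4) co] th R del: One_nat_def)
  finally have "(x * ?s x) ^ 2 = ((2 + ?t) * y ^ 2) * ((2 - ?t) * ?s y ^ 2)"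
    by (simp only: power_mult_distrib xy(3))
  also have "\<dots> = (4 - ?t ^ 2) * (y * ?s y) ^ 2"
    by (simp add: power_mult_distrib algebra_simps power2_eq_square)
  finally have "(x * ?s x) ^ 2 = (4 - ?t ^ 2) * (y * ?s y) ^ 2" .
  then have eq: "X ^ 2 = (2 - theta n) * Y ^ 2" unfolding XY(1,2) theta_double by simp
  \<comment> \<open>Since 4 divides \<open>n\<close>, \<open>m\<close> is even and
    \<open>m + 1\<close> is coprime to \<open>n\<close>; the conjugation with this index negates
    \<open>theta n\<close>.\<close>
  obtain m where m: "n = 2 * m" "even m" "m > 0" using assms(1,2) by (auto elim!: dvdE)
  have co': "coprime (m + 1) n" using m by (simp add: coprime_double)
  have th': "emb n (m + 1) (theta n) = - theta n"
    unfolding emb_theta[OF assms(3) co'] using theta_conj_shift[OF m(3), of 1] by (simp add: m(1))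
  have XR: "X \<in> Rcyc n" "Y \<in> Rcyc n" "theta n \<in> Rcyc n" using XY Ocyc_Rcyc theta_Ocyc by auto
  have "emb n (m + 1) X ^ 2 = emb n (m + 1) ((2 - theta n) * Y ^ 2)"
    using eq XR(1) emb_power[OF assms(3) co'] by metis
  also have "\<dots> = (2 + theta n) * emb n (m + 1) Y ^ 2"
    using XR by (simp add: emb_mult[OF assms(3) co'] emb_diff[OF assms(3) co'] emb_power[OF assms(3) co'] emb_numeral[OF assms(3) co'] th' R del: One_nat_def)
  finally have "emb n (m + 1) Y = 0" using assms(5) XY emb_Ocyc[OF assms(3) co']
    unfolding nonsquare_step_def by blast
  then have "Y = 0" using emb_eq_0[OF assms(3) co'] XR by blast
  then show "y = 0" using XY(2) emb_eq_0[OF assms(4) co xR(2)] by auto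
qed

section \<open>From one level to the next\<close>

lemma theta_conj_period_mult: "n > 0 \<Longrightarrow> theta_conj n (k + j * n) = theta_conj n k"
  by (induction j) (simp_all add: theta_conj_period add.assoc[symmetric] add.commute[of n])

lemma emb_double_theta_conj:
  assumes "n > 0" "even n" "conj_wd (2 * n)" "coprime k n"
  shows "emb (2 * n) (n + 1) (theta_conj (2 * n) k) = - theta_conj (2 * n) k"
proof -
  have "odd k" using assms(2,4) by (metis coprime_common_divisor odd_one)
  then obtain j where j: "k = 2 * j + 1" by (elim oddE)
  have "coprime (n + 1) (2 * n)" using assms(2) by (simp add: coprime_double)
  then have "emb (2 * n) (n + 1) (theta_conj (2 * n) k) = theta_conj (2 * n) (k * (n + 1))"
    by (rule emb_theta_conj[OF assms(3)])
  also have "k * (n + 1) = (k + n) + j * (2 * n)" by (simp add: j algebra_simps)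
  also have "theta_conj (2 * n) \<dots> = theta_conj (2 * n) (k + n)" using assms(1)
    by (intro theta_conj_period_mult) simp
  also have "\<dots> = - theta_conj (2 * n) k" by (rule theta_conj_shift[OF assms(1)])
  finally show ?thesis .
qed

lemma emb_period: "n > 0 \<Longrightarrow> conj_wd n \<Longrightarrow> x \<in> Rcyc n \<Longrightarrow> emb n (n + 1) x = x"
  using emb_eq[of n "n + 1"] theta_conj_period[of n 1] by (auto simp: Rcyc_iff add.commute)

lemma quadratic_ext_Rcyc:
  assumes n: "n > 0" "even n" and wd: "conj_wd n" "conj_wd (2 * n)"
    and unit: "theta (2 * n) \<in> units_of_ring (Rcyc (2 * n))"
  shows "quadratic_ext (Rcyc n) (Rcyc (2 * n)) (emb (2 * n) (n + 1)) (theta (2 * n))"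
proof
  have co: "coprime (n + 1) (2 * n)" "coprime (n + 1) n" using n(2) by (simp_all add: coprime_double)
  note emb = wd(2) co(1)
  show "subring (Rcyc n)" "subring (Rcyc (2 * n))" by (rule subring_Rcyc)+
  show "1 / 2 \<in> Rcyc n" by (rule half_Rcyc)
  show "theta (2 * n) \<in> units_of_ring (Rcyc (2 * n))" by (rule unit)
  show "emb (2 * n) (n + 1) (theta (2 * n)) = - theta (2 * n)"
    using emb_double_theta_conj[OF n wd(2), of 1] by simp
  show "emb (2 * n) (n + 1) x \<in> Rcyc (2 * n)" if "x \<in> Rcyc (2 * n)" for x
    using emb_Rcyc[OF emb that] .
  show "emb (2 * n) (n + 1) (x + y) = emb (2 * n) (n + 1) x + emb (2 * n) (n + 1) y"
    "emb (2 * n) (n + 1) (x * y) = emb (2 * n) (n + 1) x * emb (2 * n) (n + 1) y"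
    if "x \<in> Rcyc (2 * n)" "y \<in> Rcyc (2 * n)" for x y
    using emb_add[OF emb that] emb_mult[OF emb that] .
  show "emb (2 * n) (n + 1) (emb (2 * n) (n + 1) x) = x" if "x \<in> Rcyc (2 * n)" for x
  proof -
    have "emb (2 * n) (n + 1) (emb (2 * n) (n + 1) x) = emb (2 * n) (2 * n + 1) x"
      using emb_compose_shift[OF n wd(2) co(2) that] by (simp add: mult_2)
    also have "\<dots> = x" using n(1) by (intro emb_period wd that) simp
    finally show ?thesis .
  qed
  show "x \<in> Rcyc n \<longleftrightarrow> x \<in> Rcyc (2 * n) \<and> emb (2 * n) (n + 1) x = x" for x
  proof
    assume "x \<in> Rcyc n"
    then show "x \<in> Rcyc (2 * n) \<and> emb (2 * n) (n + 1) x = x"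
      using emb_double_restrict[OF n(2) wd co(2)] emb_period[OF n(1) wd(1)] Rcyc_double_sub by simp
  next
    assume x: "x \<in> Rcyc (2 * n) \<and> emb (2 * n) (n + 1) x = x"
    then obtain a b where "a \<in> Rcyc n" "x = a + theta (2 * n) * b" "emb (2 * n) (n + 1) x = a - theta (2 * n) * b"
      using Rcyc_double[OF n wd(2)] by metis
    with x have "theta (2 * n) * b = 0" by linarith
    then show "x \<in> Rcyc n" using \<open>a \<in> Rcyc n\<close> \<open>x = a + theta (2 * n) * b\<close>
      by (simp only: add_0_right)
  qed
qed

text \<open>Only products are formed: modulo squares every element is its own inverse.\<close>

inductive_set cyc_mon :: "int poly set \<Rightarrow> nat \<Rightarrow> real set" for Q n where
  one: "1 \<in> cyc_mon Q n"
| mult: "q \<in> Q \<Longrightarrow> coprime k n \<Longrightarrow> c \<in> cyc_mon Q n \<Longrightarrow> ev q (theta_conj n k) * c \<in> cyc_mon Q n"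

lemma cyc_mon_mult: "c \<in> cyc_mon Q n \<Longrightarrow> d \<in> cyc_mon Q n \<Longrightarrow> c * d \<in> cyc_mon Q n"
  by (induction rule: cyc_mon.induct) (auto simp: mult.assoc intro: cyc_mon.mult)

lemma cyc_mon_gen: "q \<in> Q \<Longrightarrow> coprime k n \<Longrightarrow> ev q (theta_conj n k) \<in> cyc_mon Q n"
  using cyc_mon.mult[OF _ _ cyc_mon.one, of q Q k n] by simp

text \<open>Evaluated at the \<open>theta (2 ^ i * n)\<close>, such polynomials give norm-coherent sequences.\<close>

definition norm_coherent :: "int poly set \<Rightarrow> bool" where
  "norm_coherent Q \<longleftrightarrow> (\<forall>q\<in>Q. \<forall>x. ev q x * ev q (- x) = ev q (x ^ 2 - 2))"

text \<open>A package that is stable under doubling: the lifts of the generators make the norm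
  surjective on units, which the 2-torsion step consumes, and the two clauses on total positivity
  are carried up by the same norms. By the last clause the units have every signature that occurs,
  so that over \<open>Rcyc n\<close> narrow classes are classes.\<close>

definition level_good :: "int poly set \<Rightarrow> nat \<Rightarrow> bool" where
  "level_good Q n \<longleftrightarrow>
     ideals_invertible (Rcyc n) \<and> no_two_torsion (Rcyc n) \<and>
     (\<forall>q\<in>Q. \<forall>k. coprime k n \<longrightarrow> ev q (theta_conj n k) \<in> units_of_ring (Rcyc n)) \<and>
     (\<forall>u\<in>units_of_ring (Rcyc n). \<exists>c\<in>cyc_mon Q n. \<exists>v\<in>units_of_ring (Rcyc n). u = c * v ^ 2) \<and>
     (\<forall>u\<in>units_of_ring (Rcyc n). tpos n u \<longrightarrow>
        (\<exists>v\<in>units_of_ring (Rcyc n). u = v ^ 2 \<or> u = (2 - theta n) * v ^ 2)) \<and>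
     (\<forall>x\<in>Rcyc n. x \<noteq> 0 \<longrightarrow> (\<exists>u\<in>units_of_ring (Rcyc n). tpos n (u * x)))"

section \<open>Total positivity and the inductive step\<close>

lemma tpos_mult: "conj_wd n \<Longrightarrow> x \<in> Rcyc n \<Longrightarrow> y \<in> Rcyc n \<Longrightarrow> tpos n x \<Longrightarrow> tpos n y \<Longrightarrow> tpos n (x * y)"
  by (auto simp: tpos_iff emb_mult subringD[OF subring_Rcyc])

lemma tpos_cancel: "conj_wd n \<Longrightarrow> x \<in> Rcyc n \<Longrightarrow> y \<in> Rcyc n \<Longrightarrow> tpos n (x * y) \<Longrightarrow> tpos n y \<Longrightarrow> tpos n x"
  by (auto simp: tpos_iff emb_mult subringD[OF subring_Rcyc] zero_less_mult_iff)
    (meson not_less_iff_gr_or_eq)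

lemma tpos_square: "conj_wd n \<Longrightarrow> x \<in> Rcyc n \<Longrightarrow> x \<noteq> 0 \<Longrightarrow> tpos n (x ^ 2)"
  by (auto simp: tpos_iff emb_power subringD[OF subring_Rcyc] emb_eq_0)

lemma tpos_2_minus_theta: "conj_wd n \<Longrightarrow> n > 1 \<Longrightarrow> tpos n (2 - theta n)"
  using theta_conj_less_2[of _ n]
  by (auto simp: tpos_iff emb_diff emb_theta Ocyc_Rcyc theta_Ocyc subringD[OF subring_Rcyc])

lemma tpos_double:
  "even n \<Longrightarrow> conj_wd n \<Longrightarrow> conj_wd (2 * n) \<Longrightarrow> x \<in> Rcyc n \<Longrightarrow> tpos (2 * n) x \<longleftrightarrow> tpos n x"
  by (simp add: tpos_iff Rcyc_double_sub coprime_double emb_double_restrict del: coprime_mult_right_iff)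

lemma level_good_double:
  assumes n: "n > 0" "4 dvd n" and wd: "conj_wd n" "conj_wd (2 * n)"
    and Q: "norm_coherent Q" "[:2, - 1:] \<in> Q" and good: "level_good Q n"
  shows "level_good Q (2 * n)"
proof -
  have even: "even n" and n1: "n > 1" using n by (auto elim!: dvdE)
  obtain m where m: "n = 2 * m" "even m" "m > 1" using n by (auto elim!: dvdE)
  let ?A = "Rcyc n" and ?B = "Rcyc (2 * n)" and ?\<theta> = "theta (2 * n)"
  let ?UA = "units_of_ring ?A" and ?UB = "units_of_ring ?B"
  note RA = subringD[OF subring_Rcyc[of n]] and RB = subringD[OF subring_Rcyc[of "2 * n"]]
  have gen: "ev q (theta_conj n k) \<in> ?UA" if "q \<in> Q" "coprime k n" for q k
    using good that unfolding level_good_def by blast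
  have ev2: "ev [:2, - 1:] x = 2 - x" for x by (simp add: ev_pCons)
  have pi: "2 - theta_conj n k \<in> ?UA" if "coprime k n" for k
    using gen[OF Q(2) that] by (simp only: ev2)
  have UAB: "u \<in> ?UB" if "u \<in> ?UA" for u using that by (auto simp: units_iff Rcyc_double_sub)
  have sq_unit: "x \<in> ?UB" if "x \<in> Ocyc (2 * n)" "x ^ 2 \<in> ?UA" for x
    using units_mult_cancel[OF subring_Rcyc, of x x] UAB[OF that(2)] Ocyc_Rcyc[OF that(1)]
    by (simp add: power2_eq_square)
  \<comment> \<open>The conjugation of index \<open>m + 1\<close> negates \<open>theta n\<close>, so
    the square \<open>2 + theta n\<close> of \<open>?\<theta>\<close> is a value of a generator;
    this makes \<open>?\<theta>\<close> a unit.\<close>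
  have "2 - theta_conj n (m + 1) \<in> ?UA" using m by (intro pi) (simp add: coprime_double)
  also have "theta_conj n (m + 1) = - theta n" using theta_conj_shift[of m 1] m by simp
  finally have unit: "?\<theta> \<in> ?UB" by (intro sq_unit theta_Ocyc) (simp add: theta_double)
  define \<sigma> where "\<sigma> = emb (2 * n) (n + 1)"
  interpret quadratic_ext ?A ?B \<sigma> ?\<theta>
    unfolding \<sigma>_def by (rule quadratic_ext_Rcyc[OF n(1) even wd unit])
  have emb_\<sigma>: "emb (2 * n) k (\<sigma> x) = emb (2 * n) (k + n) x"
    if "x \<in> ?B" "coprime k n" for x k
    unfolding \<sigma>_def by (rule emb_compose_shift[OF n(1) even wd(2) that(2,1)])
  \<comment> \<open>\<open>\<sigma>\<close> negates every \<open>theta_conj (2 * n) k\<close> with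
    \<open>k\<close> coprime to \<open>n\<close>, so norm coherence identifies the norm of a
    generator with the generator below, for the same index.\<close>
  have norm_gen: "nm (ev q (theta_conj (2 * n) k)) = ev q (theta_conj n k)"
    if "q \<in> Q" "coprime k n" for q k
  proof -
    have co: "coprime (n + 1) (2 * n)" using even by (simp add: coprime_double)
    have "\<sigma> (ev q (theta_conj (2 * n) k)) = ev q (- theta_conj (2 * n) k)"
      by (simp only: \<sigma>_def emb_ev[OF wd(2) co Ocyc_Rcyc[OF theta_conj_Ocyc]] emb_double_theta_conj[OF n(1) even wd(2) that(2)])
    then have "nm (ev q (theta_conj (2 * n) k)) = ev q (theta_conj (2 * n) k ^ 2 - 2)"
      using Q(1) that(1) by (simp add: nm_def norm_coherent_def)
    then show ?thesis by (simp add: theta_conj_double)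
  qed
  have gen2: "ev q (theta_conj (2 * n) k) \<in> ?UB" if "q \<in> Q" "coprime k n" for q k
    using norm_gen[OF that] gen[OF that]
    by (intro unit_of_nm Ocyc_Rcyc subring_ev subring_Ocyc theta_conj_Ocyc) simp
  have co2: "coprime k (2 * n) \<longleftrightarrow> coprime k n" for k by (rule coprime_double[OF even])
  have cyc_UB: "c \<in> ?UB" if "c \<in> cyc_mon Q (2 * n)" for c
    using that by induction (auto intro!: units_1 units_mult subring_Rcyc gen2 simp: co2)
  have lift: "\<exists>c'\<in>cyc_mon Q (2 * n). nm c' = c" if "c \<in> cyc_mon Q n" for c
    using that
  proof induction
    case one show ?case using cyc_mon.one by (intro bexI[of _ 1]) (auto simp: nm_def)
  next
    case (mult q k c)
    then obtain c' where c': "c' \<in> cyc_mon Q (2 * n)" "nm c' = c" by blast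
    have "nm (ev q (theta_conj (2 * n) k) * c') = ev q (theta_conj n k) * c"
      using nm_mult gen2[OF mult(1,2)] cyc_UB[OF c'(1)] norm_gen[OF mult(1,2)] c'(2)
      by (simp add: units_iff)
    then show ?case using cyc_mon.mult[OF mult(1) _ c'(1)] mult(2) co2 by blast
  qed
  \<comment> \<open>Norm coherence read backwards: a generator at level \<open>n\<close> is the
    product of two generators at level \<open>2 * n\<close>, with indices \<open>k\<close> and
    \<open>k + n\<close>.\<close>
  have sub: "c \<in> cyc_mon Q (2 * n)" if "c \<in> cyc_mon Q n" for c
    using that
  proof induction
    case one show ?case by (rule cyc_mon.one)
  next
    case (mult q k c)
    have "theta_conj (2 * n) k ^ 2 - 2 = theta_conj n k" by (simp add: theta_conj_double)
    then have "ev q (theta_conj n k) = ev q (theta_conj (2 * n) k) * ev q (- theta_conj (2 * n) k)"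
      using Q(1) mult(1) by (metis norm_coherent_def)
    also have "\<dots> = ev q (theta_conj (2 * n) k) * ev q (theta_conj (2 * n) (k + n))"
      by (simp only: theta_conj_shift[OF n(1)])
    finally have eq: "ev q (theta_conj n k) * c = ev q (theta_conj (2 * n) k) * (ev q (theta_conj (2 * n) (k + n)) * c)"
      by (simp only: mult.assoc)
    have "coprime (k + n) (2 * n)" "coprime k (2 * n)" using mult(2) coprime_shift[OF even] co2 by blast+
    then show ?case unfolding eq using mult by (intro cyc_mon.mult) auto
  qed
  have dec: "\<exists>c\<in>cyc_mon Q n. \<exists>v\<in>?UA. u = c * v ^ 2" if "u \<in> ?UA" for u
    using good that unfolding level_good_def by blast
  \<comment> \<open>Generators lift, and a square \<open>v ^ 2\<close> of the lower ring is the norm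
    of \<open>v\<close> itself.\<close>
  have surj: "\<exists>w\<in>?UB. nm w = u" if uA: "u \<in> ?UA" for u
  proof -
    obtain c v where cv: "c \<in> cyc_mon Q n" "v \<in> ?UA" "u = c * v ^ 2" using dec[OF uA] by blast
    obtain c' where c': "c' \<in> cyc_mon Q (2 * n)" "nm c' = c" using lift[OF cv(1)] by blast
    have "c' \<in> ?UB" "v \<in> ?UB" using cyc_UB[OF c'(1)] UAB[OF cv(2)] .
    then have "nm (c' * v) = u" "c' * v \<in> ?UB"
      using cv c' by (simp_all add: nm_mult units_iff[of _ ?B] nm_of_A units_iff[of v ?A])
        (metis units_iff units_mult subring_Rcyc)
    then show ?thesis by blast
  qed
  have tor: "no_two_torsion ?A" using good by (simp add: level_good_def)
  have U_B: "u \<in> ?B" "u \<noteq> 0" if "u \<in> ?UB" for u using that by (auto simp: units_iff)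
  have [simp]: "0 \<notin> ?UB" by (simp add: units_iff)
  \<comment> \<open>\<open>g\<close> lifts the norm of \<open>u\<close>, so \<open>u / g\<close> has
    norm 1 and is \<open>nm h\<close> up to a square. This \<open>nm h\<close> lives at level
    \<open>n\<close> and decomposes there.\<close>
  have dec2: "\<exists>c\<in>cyc_mon Q (2 * n). \<exists>v\<in>?UB. u = c * v ^ 2" if u: "u \<in> ?UB" for u
  proof -
    obtain c v where cv: "c \<in> cyc_mon Q n" "v \<in> ?UA" "nm u = c * v ^ 2" using dec[OF nm_unit[OF u]]
      by blast
    obtain c' where c': "c' \<in> cyc_mon Q (2 * n)" "nm c' = c" using lift[OF cv(1)] by blast
    obtain w where w: "w \<in> ?UB" "nm w = v" using surj[OF cv(2)] by blast
    define g where "g = c' * w ^ 2"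
    have g: "g \<in> ?UB" using cyc_UB[OF c'(1)] w
      by (auto simp: g_def intro!: units_mult units_power subring_Rcyc)
    have "nm g = nm u" using cyc_UB[OF c'(1)] w c' cv
      by (simp add: g_def nm_mult U_B RB power2_eq_square)
    moreover have "nm u = nm (u / g) * nm g"
      using U_B[OF g] U_B[OF units_divide[OF subring_Rcyc u g]] nm_mult[of "u / g" g] by simp
    moreover have "nm g \<noteq> 0" using nm_eq_0 U_B[OF g] by blast
    ultimately have "nm (u / g) = 1" by simp
    then obtain h z where h: "h \<in> ?UB" "z \<in> ?UB" "u / g = nm h * z ^ 2"
      using unit_nm_1[OF tor units_divide[OF subring_Rcyc u g]] by blast
    obtain d y where d: "d \<in> cyc_mon Q n" "y \<in> ?UA" "nm h = d * y ^ 2"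
      using dec[OF nm_unit[OF h(1)]] by blast
    have "u = g * (nm h * z ^ 2)" using h(3) U_B[OF g] by (simp add: field_simps)
    also have "\<dots> = (c' * d) * (w * z * y) ^ 2" by (simp add: d(3) g_def power_mult_distrib mult_ac)
    finally show ?thesis using c'(1) d w h UAB sub by (metis cyc_mon_mult units_mult subring_Rcyc)
  qed
  \<comment> \<open>\<open>2 - theta n\<close>, the nontrivial totally positive class below, becomes
    a square: \<open>\<rho>\<close> is a conjugate of \<open>theta (2 * n)\<close> whose index
    \<open>m - 1\<close> turns the angle \<open>2 * pi / n\<close> into its supplement.\<close>
  define \<rho> where "\<rho> = theta_conj (2 * n) (m - 1)"
  have \<rho>2: "\<rho> ^ 2 = 2 - theta n"
  proof -
    have "2 * pi * real (m - 1) / real n = pi - 2 * pi / real n"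
      using m by (simp add: of_nat_diff field_simps)
    then have "theta_conj n (m - 1) = - theta n" by (simp add: theta_conj_def theta_def)
    then show ?thesis by (simp add: \<rho>_def theta_conj_double)
  qed
  have \<rho>: "\<rho> \<in> ?UB" using \<rho>2 pi[of 1]
    by (intro sq_unit) (simp_all add: \<rho>_def theta_conj_Ocyc)
  have tpA: "\<exists>v\<in>?UA. u = v ^ 2 \<or> u = (2 - theta n) * v ^ 2"
    if "u \<in> ?UA" "tpos n u" for u
    using good that unfolding level_good_def by blast
  define \<pi> where "\<pi> = 2 - ?\<theta>"
  have \<pi>: "\<pi> \<in> ?UB" "nm \<pi> = 2 - theta n" "tpos (2 * n) \<pi>"
    using gen2[OF Q(2), of 1] norm_gen[OF Q(2), of 1] tpos_2_minus_theta[OF wd(2)] n1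
    unfolding ev2 by (simp_all add: \<pi>_def)
  have emb_nm: "emb n k (nm x) = emb (2 * n) k x * emb (2 * n) (k + n) x"
    if "x \<in> ?B" "coprime k n" for x k
  proof -
    have "emb n k (nm x) = emb (2 * n) k (nm x)"
      using emb_double_restrict[OF even wd that(2) nm_A[OF that(1)]] by simp
    then show ?thesis using that(1) \<sigma>_closed emb_\<sigma>[OF that]
      by (simp add: nm_def emb_mult[OF wd(2) co2[THEN iffD2, OF that(2)]])
  qed
  have tp_nm: "tpos n (nm x)" if "x \<in> ?B" "tpos (2 * n) x" for x
    unfolding tpos_iff[OF wd(1) nm_A[OF that(1)]]
  proof (intro allI impI)
    fix k assume k: "coprime k n"
    then show "emb n k (nm x) > 0"
      unfolding emb_nm[OF that(1) k] using that co2 coprime_shift[OF even k]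
      by (intro mult_pos_pos) (auto simp: tpos_iff[OF wd(2)])
  qed
  \<comment> \<open>As for \<open>dec2\<close>, but with a totally positive lift \<open>g\<close>:
    the class of 1 lifts to 1 and that of \<open>2 - theta n\<close> to \<open>\<pi>\<close>. Then
    \<open>nm h\<close> is totally positive too; being 1 or \<open>2 - theta n\<close> up to
    squares, it is a square at the upper level.\<close>
  have tp2: "\<exists>v\<in>?UB. u = v ^ 2 \<or> u = (2 - ?\<theta>) * v ^ 2"
    if u: "u \<in> ?UB" "tpos (2 * n) u" for u
  proof -
    obtain v where v: "v \<in> ?UA" "nm u = v ^ 2 \<or> nm u = (2 - theta n) * v ^ 2"
      using tpA[OF nm_unit[OF u(1)] tp_nm[OF U_B(1)[OF u(1)] u(2)]] by blast
    obtain w where w: "w \<in> ?UB" "nm w = v" using surj[OF v(1)] by blast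
    have "nm 1 = 1" by (simp add: nm_def)
    then have "nm u = nm 1 * v ^ 2 \<or> nm u = nm \<pi> * v ^ 2" using v(2) by (simp add: \<pi>(2))
    then obtain p where p: "p = 1 \<or> p = \<pi>" "nm u = nm p * v ^ 2" by blast
    have pU: "p \<in> ?UB" "tpos (2 * n) p"
      using p \<pi> units_1[OF subring_Rcyc] tpos_square[OF wd(2) RB(1)] by auto
    define g where "g = p * w ^ 2"
    have g: "g \<in> ?UB" "tpos (2 * n) g" using pU w
      by (auto simp: g_def U_B RB wd(2) intro!: units_mult units_power subring_Rcyc tpos_mult tpos_square)
    have ug: "u / g \<in> ?UB" by (rule units_divide[OF subring_Rcyc u(1) g(1)])
    have "nm g = nm u" using pU w p by (simp add: g_def nm_mult U_B RB power2_eq_square)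
    moreover have "nm u = nm (u / g) * nm g" using U_B[OF g(1)] U_B[OF ug] nm_mult[of "u / g" g] by simp
    moreover have "nm g \<noteq> 0" using nm_eq_0 U_B[OF g(1)] by blast
    ultimately have "nm (u / g) = 1" by simp
    then obtain h z where h: "h \<in> ?UB" "z \<in> ?UB" "u / g = nm h * z ^ 2"
      using unit_nm_1[OF tor ug] by blast
    have eq: "u = nm h * (g * z ^ 2)" using h(3) U_B[OF g(1)] by (simp add: field_simps)
    have hA: "nm h \<in> ?UA" by (rule nm_unit[OF h(1)])
    then have hB: "nm h \<in> ?B" using UAB U_B by blast
    have "tpos (2 * n) (nm h)"
      using u(2) unfolding eq
      by (rule tpos_cancel[OF wd(2) hB, rotated])
        (use g h in \<open>auto simp: U_B RB wd(2) intro!: tpos_mult tpos_square\<close>)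
    then have "tpos n (nm h)" using tpos_double[OF even wd] hA by (simp add: units_iff)
    then obtain y where y: "y \<in> ?UA" "nm h = y ^ 2 \<or> nm h = (2 - theta n) * y ^ 2" using tpA[OF hA]
      by blast
    obtain r where r: "r \<in> ?UB" "nm h = r ^ 2"
    proof (cases "nm h = y ^ 2")
      case True then show ?thesis using that UAB y by blast
    next
      case False
      then have "nm h = (\<rho> * y) ^ 2" using y(2) \<rho>2 by (simp add: power_mult_distrib)
      then show ?thesis using that \<rho> UAB y units_mult subring_Rcyc by blast
    qed
    have "u = p * (r * w * z) ^ 2" unfolding eq r(2) g_def by (simp add: power_mult_distrib mult_ac)
    moreover have "r * w * z \<in> ?UB" using r w h units_mult subring_Rcyc by blast
    ultimately show ?thesis using p(1) unfolding \<pi>_def by auto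
  qed
  \<comment> \<open>\<open>w\<close> makes the norm totally positive; from then on the trace
    \<open>s\<close> has the signs of \<open>y\<close>, and a unit of the lower ring corrects
    them.\<close>
  have sg: "\<exists>u\<in>?UB. tpos (2 * n) (u * x)" if x: "x \<in> ?B" "x \<noteq> 0" for x
  proof -
    have sA: "\<exists>u\<in>?UA. tpos n (u * y)" if "y \<in> ?A" "y \<noteq> 0" for y
      using good that unfolding level_good_def by blast
    obtain u where u: "u \<in> ?UA" "tpos n (u * nm x)" using sA[OF nm_A[OF x(1)]] nm_eq_0 x by blast
    obtain w where w: "w \<in> ?UB" "nm w = u" using surj[OF u(1)] by blast
    define y where "y = w * x"
    have y: "y \<in> ?B" "tpos n (nm y)" using u w x by (simp_all add: y_def nm_mult U_B RB)
    define s where "s = y + \<sigma> y"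
    have s: "s \<in> ?A" unfolding s_def by (rule tr_A[OF y(1)])
    have emb_s: "emb (2 * n) k s = emb (2 * n) k y + emb (2 * n) (k + n) y" if "coprime k n" for k
      unfolding s_def using y \<sigma>_closed emb_\<sigma>[OF y(1) that]
      by (simp add: emb_add[OF wd(2) co2[THEN iffD2, OF that]])
    have pos: "emb (2 * n) k y * emb (2 * n) k s > 0" if k: "coprime k n" for k
    proof -
      have "emb (2 * n) k y * emb (2 * n) (k + n) y > 0"
        using y(2) k tpos_iff[OF wd(1) nm_A[OF y(1)]] emb_nm[OF y(1) k] by metis
      then show ?thesis unfolding emb_s[OF k] by (auto simp: zero_less_mult_iff)
    qed
    have "s \<noteq> 0" using pos[of 1] wd(2) by auto
    then obtain u' where u': "u' \<in> ?UA" "tpos n (u' * s)" using sA[OF s] by blast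
    have u's: "u' \<in> ?B" "s \<in> ?B" "u' * s \<in> ?A"
      using U_B(1)[OF UAB[OF u'(1)]] AB[OF s] RA(5)[OF _ s, of u'] u'(1) by (simp_all add: units_iff)
    have "tpos (2 * n) (u' * s)" using tpos_double[OF even wd u's(3)] u'(2) by simp
    have "tpos (2 * n) (u' * y)"
      unfolding tpos_iff[OF wd(2) RB(5)[OF u's(1) y(1)]]
    proof (intro allI impI)
      fix k assume k2: "coprime k (2 * n)"
      then have "emb (2 * n) k u' * emb (2 * n) k s > 0" "emb (2 * n) k y * emb (2 * n) k s > 0"
        using \<open>tpos (2 * n) (u' * s)\<close> u's pos co2
        by (auto simp: tpos_iff[OF wd(2)] RB emb_mult[OF wd(2)])
      then have "emb (2 * n) k u' * emb (2 * n) k y > 0" by (auto simp: zero_less_mult_iff)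
      then show "emb (2 * n) k (u' * y) > 0" using u's y by (simp only: emb_mult[OF wd(2) k2])
    qed
    moreover have "u' * y = (u' * w) * x" by (simp add: y_def)
    moreover have "u' * w \<in> ?UB" using u' w UAB units_mult subring_Rcyc by blast
    ultimately show ?thesis by metis
  qed
  show ?thesis
    unfolding level_good_def
    using ideals_invertible_step no_two_torsion_step[OF tor surj] good gen2 dec2 tp2 sg
    by (simp only: level_good_def co2) blast
qed

section \<open>The rings at the bottom of the two towers\<close>

text \<open>For nonzero \<open>y\<close> the exponents of \<open>p\<close> on the two sides would
  have different parity.\<close>

lemma square_multiple_int:
  fixes x y d p :: int
  assumes "prime p" "odd (multiplicity p d)" "x ^ 2 = d * y ^ 2"
  shows "y = 0"
proof (rule ccontr)
  assume y: "y \<noteq> 0"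
  have d: "d \<noteq> 0" using assms(2) by (intro notI) simp
  then have x: "x \<noteq> 0" using assms(3) y by auto
  have "multiplicity p (x ^ 2) = 2 * multiplicity p x" "multiplicity p (y ^ 2) = 2 * multiplicity p y"
    using x y assms(1) prime_elem_multiplicity_power_distrib[of p _ 2] by auto
  moreover have "multiplicity p (d * y ^ 2) = multiplicity p d + multiplicity p (y ^ 2)"
    using d y assms(1) prime_elem_multiplicity_mult_distrib[of p d "y ^ 2"] by auto
  ultimately have "2 * multiplicity p x = multiplicity p d + 2 * multiplicity p y" by (simp add: assms(3))
  then show False using assms(2) by presburger
qed

lemma nonsquare_int:
  fixes x y :: int
  shows "x ^ 2 = 2 * y ^ 2 \<Longrightarrow> y = 0" "x ^ 2 = 3 * y ^ 2 \<Longrightarrow> y = 0" "x ^ 2 = 6 * y ^ 2 \<Longrightarrow> y = 0"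
proof -
  show "x ^ 2 = 2 * y ^ 2 \<Longrightarrow> y = 0"
    using square_multiple_int[of 2 2 x y] by (simp add: multiplicity_same_power[of 2 1, simplified])
  show "x ^ 2 = 3 * y ^ 2 \<Longrightarrow> y = 0"
    using square_multiple_int[of 3 3 x y] by (simp add: multiplicity_same_power[of 3 1, simplified])
  have "multiplicity 2 (2 * 3 :: int) = multiplicity 2 (2 :: int) + multiplicity 2 (3 :: int)"
    by (rule prime_elem_multiplicity_mult_distrib) simp_all
  also have "\<dots> = 1" using multiplicity_same_power[of "2::int" 1]
    by (simp add: not_dvd_imp_multiplicity_0)
  finally show "x ^ 2 = 6 * y ^ 2 \<Longrightarrow> y = 0" using square_multiple_int[of 2 6 x y] by simp
qed

section \<open>Levels 4 and 6, where the ring is that of the integers\<close>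

lemma ev_of_int: "ev p (of_int a) = of_int (poly p a)"
  by (induction p) (simp_all add: ev_pCons)

lemma Ocyc_eq_Ints: "theta n = of_int a \<Longrightarrow> Ocyc n = \<int>"
proof (intro equalityI subsetI)
  fix x :: real assume "x \<in> \<int>"
  then show "x \<in> Ocyc n" using subringD(8)[OF subring_Ocyc] by (elim Ints_cases) simp
qed (auto simp: Ocyc_iff ev_of_int)

lemma conj_wd_trivial: "(\<And>k. coprime k n \<Longrightarrow> theta_conj n k = theta n) \<Longrightarrow> conj_wd n"
  by (simp add: conj_wd_def)

lemma theta_conj_4: "coprime k 4 \<Longrightarrow> theta_conj 4 k = 0"
proof -
  assume "coprime k 4"
  then have "odd k" by (metis coprime_common_divisor dvd_trans even_numeral odd_one)
  moreover have "theta_conj 2 k = 2 * cos (real k * pi)" by (simp add: theta_conj_def mult.commute)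
  ultimately have "theta_conj 2 k = - 2" by (simp add: cos_npi)
  then show ?thesis using theta_conj_double[of 2 k] by simp
qed

lemma theta_4: "theta 4 = 0"
  using theta_conj_4[of 1] by simp

lemma Ocyc_4: "Ocyc 4 = \<int>"
  using Ocyc_eq_Ints[of 4 0] theta_4 by simp

lemma conj_wd_4: "conj_wd 4"
  by (rule conj_wd_trivial) (simp add: theta_conj_4 theta_4)

lemma nonsquare_step_4: "nonsquare_step 4"
  unfolding nonsquare_step_def Ocyc_4 theta_4
proof (intro ballI impI)
  fix x y :: real assume "x \<in> \<int>" "y \<in> \<int>" "x ^ 2 = (2 + 0) * y ^ 2"
  then obtain a b where "x = of_int a" "y = of_int b" "real_of_int (a ^ 2) = real_of_int (2 * b ^ 2)"
    by (auto elim!: Ints_cases)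
  then show "y = 0" using nonsquare_int(1)[of a b] by (simp only: of_int_eq_iff) simp
qed

lemma theta_6: "theta 6 = 1"
  using cos_60 by (simp add: theta_def)

lemma theta_conj_6: "coprime k 6 \<Longrightarrow> theta_conj 6 k = 1"
proof -
  assume k: "coprime k 6"
  have "theta_conj 6 k = theta_conj 6 (k mod 6 + k div 6 * 6)" by simp
  also have "\<dots> = theta_conj 6 (k mod 6)" by (rule theta_conj_period_mult) simp
  finally have eq: "theta_conj 6 k = theta_conj 6 (k mod 6)" .
  have "coprime (k mod 6) 6" using k by simp
  moreover have "k mod 6 \<in> {0, 1, 2, 3, 4, 5}" using mod_less_divisor[of 6 k] by auto
  moreover have "\<not> coprime 0 (6::nat)" "\<not> coprime 2 (6::nat)" "\<not> coprime 3 (6::nat)" "\<not> coprime 4 (6::nat)" by code_simp+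
  ultimately have "k mod 6 = 1 \<or> k mod 6 = 5" by (metis insertE singletonD)
  moreover have "theta_conj 6 5 = 1"
  proof -
    have "2 * pi * real 5 / real 6 = 2 * pi - 2 * pi / real 6" by simp
    then have "theta_conj 6 5 = theta 6" unfolding theta_conj_def theta_def by (simp only: cos_2pi_minus)
    then show ?thesis by (simp add: theta_6)
  qed
  ultimately show ?thesis using eq theta_6 by auto
qed

lemma Ocyc_6: "Ocyc 6 = \<int>"
  using Ocyc_eq_Ints[of 6 1] theta_6 by simp

lemma conj_wd_6: "conj_wd 6"
  by (rule conj_wd_trivial) (simp add: theta_conj_6 theta_6)

lemma nonsquare_step_6: "nonsquare_step 6"
  unfolding nonsquare_step_def Ocyc_6 theta_6
proof (intro ballI impI)
  fix x y :: real assume "x \<in> \<int>" "y \<in> \<int>" "x ^ 2 = (2 + 1) * y ^ 2"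
  then obtain a b where "x = of_int a" "y = of_int b" "real_of_int (a ^ 2) = real_of_int (3 * b ^ 2)"
    by (auto elim!: Ints_cases)
  then show "y = 0" using nonsquare_int(2)[of a b] by (simp only: of_int_eq_iff) simp
qed

lemma conj_wd_12: "conj_wd 12"
  using conj_wd_double[OF _ conj_wd_6 nonsquare_step_6] by simp

section \<open>Level 12: the integers with a square root of 3\<close>

abbreviation r3 :: real where "r3 \<equiv> theta 12"

lemma r3_sq: "r3 * r3 = 3"
  using theta_double[of 6] by (simp add: theta_6 power2_eq_square)

lemma theta_conj_12_sq: "coprime k 12 \<Longrightarrow> theta_conj 12 k * theta_conj 12 k = 3"
  using theta_conj_double[of 6 k] theta_conj_6[of k] coprime_double[of 6 k] by (simp add: power2_eq_square)

lemma theta_conj_12_7: "theta_conj 12 7 = - r3"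
  using theta_conj_shift[of 6 1] by simp

lemma Ocyc_12: "x \<in> Ocyc 12 \<longleftrightarrow> (\<exists>a b. x = of_int a + of_int b * r3)"
proof
  assume x: "x \<in> Ocyc 12"
  obtain a b where "a \<in> Ocyc 6" "b \<in> Ocyc 6" "x = a + r3 * b"
    by (rule Rcyc_double[of 6 x]) (use conj_wd_12 Ocyc_Rcyc[OF x] x in auto)
  then show "\<exists>a b. x = of_int a + of_int b * r3"
    by (auto simp: Ocyc_6 mult.commute elim!: Ints_cases)
next
  show "\<exists>a b. x = of_int a + of_int b * r3 \<Longrightarrow> x \<in> Ocyc 12"
    using theta_Ocyc[of 12] subringD[OF subring_Ocyc] by auto
qed

lemma r3_indep: "of_int a + of_int b * r3 = 0 \<longleftrightarrow> a = 0 \<and> b = 0"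
proof
  assume *: "of_int a + of_int b * r3 = 0"
  then have "of_int a = - (of_int b * r3)" by linarith
  then have "real_of_int a * of_int a = of_int b * of_int b * (r3 * r3)" by (simp add: mult_ac)
  then have "real_of_int (a ^ 2) = real_of_int (3 * b ^ 2)" by (simp add: r3_sq power2_eq_square)
  then have "b = 0" using nonsquare_int(2) of_int_eq_iff by blast
  with * show "a = 0 \<and> b = 0" by simp
qed simp

abbreviation s12 :: "real \<Rightarrow> real" where "s12 \<equiv> emb 12 7"

lemma coprime_7_12: "coprime 7 (12::nat)"
  by code_simp

lemma s12_eq: "s12 (of_int a + of_int b * r3) = of_int a - of_int b * r3"
  using emb_ev'[OF conj_wd_12 coprime_7_12, of "[:a, b:]"] theta_conj_12_7
  by (simp add: ev_pCons mult.commute)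

lemma norm12_eq: "(of_int a + of_int b * r3) * (of_int a - of_int b * r3) = of_int (a ^ 2 - 3 * b ^ 2)"
proof -
  have "(of_int a + of_int b * r3) * (of_int a - of_int b * r3) = of_int a * of_int a - of_int b * of_int b * (r3 * r3)"
    by (simp add: algebra_simps)
  then show ?thesis by (simp add: r3_sq power2_eq_square)
qed

lemma norm12_eq_0: "a ^ 2 - 3 * b ^ 2 = 0 \<Longrightarrow> a = 0 \<and> (b :: int) = 0"
  using nonsquare_int(2)[of a b] by auto

text \<open>With \<open>(1 + r3) ^ 2 = 2 * (2 + r3)\<close> and the conjugate of \<open>x\<close>,
  the equation makes \<open>2 * m ^ 2\<close> a square \<open>(e + f * r3) ^ 2\<close>, where
  \<open>m\<close> is the norm of \<open>x\<close>. Irrationality of \<open>r3\<close> forces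
  \<open>e * f = 0\<close>, which leaves the nonsquares 2 and 6.\<close>

lemma nonsquare_step_12: "nonsquare_step 12"
  unfolding nonsquare_step_def
proof (intro ballI impI)
  fix x y assume xy: "x \<in> Ocyc 12" "y \<in> Ocyc 12" "x ^ 2 = (2 + r3) * y ^ 2"
  obtain a b c d where x: "x = of_int a + of_int b * r3" and y: "y = of_int c + of_int d * r3"
    using xy by (auto simp: Ocyc_12)
  let ?x' = "of_int a - of_int b * r3"
  have "(1 + r3) * y * ?x' \<in> Ocyc 12"
    using xy theta_Ocyc[of 12] subringD[OF subring_Ocyc] by simp
  then obtain e f where ef: "(1 + r3) * y * ?x' = of_int e + of_int f * r3" by (auto simp: Ocyc_12)
  have l: "(1 + r3) ^ 2 = 2 * (2 + r3)" using r3_sq by (simp add: power2_eq_square algebra_simps)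
  define m where "m = a ^ 2 - 3 * b ^ 2"
  have m: "x * ?x' = of_int m" unfolding x m_def by (rule norm12_eq)
  have "2 * of_int m ^ 2 = 2 * (x ^ 2 * ?x' ^ 2)" unfolding m[symmetric] by (simp add: power_mult_distrib)
  also have "\<dots> = ((1 + r3) * y * ?x') ^ 2" by (simp only: power_mult_distrib l xy(3) mult.assoc)
  also have "\<dots> = of_int e ^ 2 + of_int f ^ 2 * (r3 * r3) + 2 * of_int e * of_int f * r3"
    unfolding ef by (simp add: power2_eq_square algebra_simps)
  finally have "of_int (e ^ 2 + 3 * f ^ 2 - 2 * m ^ 2) + of_int (2 * e * f) * r3 = 0"
    by (simp add: r3_sq)
  then have "e ^ 2 + 3 * f ^ 2 = 2 * m ^ 2" "e = 0 \<or> f = 0" unfolding r3_indep by auto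
  then have "e ^ 2 = 2 * m ^ 2 \<or> (3 * f) ^ 2 = 6 * m ^ 2" by (auto simp: power_mult_distrib)
  then have "m = 0" using nonsquare_int by blast
  then have "a = 0 \<and> b = 0" using norm12_eq_0[of a b] by (simp only: m_def)
  then have "x = 0" by (simp add: x)
  moreover have "2 + r3 \<noteq> 0"
  proof
    assume "2 + r3 = 0"
    then have "r3 = - 2" by linarith
    then show False using r3_sq by simp
  qed
  ultimately show "y = 0" using xy(3) by auto
qed

section \<open>Euclidean division at the bottom levels\<close>

lemma euclidean_pid:
  fixes f :: "real \<Rightarrow> nat"
  assumes A: "subring A"
    and div: "\<And>x b. x \<in> A \<Longrightarrow> b \<in> A \<Longrightarrow> b \<noteq> 0 \<Longrightarrow> \<exists>q\<in>A. x - q * b = 0 \<or> f (x - q * b) < f b"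
    and I: "I \<in> nonzero_ideals A"
  shows "\<exists>b. I = scl b A"
proof -
  note id = nonzero_idealsD(1)[OF I]
  obtain b0 where "b0 \<in> I \<and> b0 \<noteq> 0" using nonzero_idealsD(2)[OF I] by blast
  then obtain b where b: "b \<in> I" "b \<noteq> 0" and min: "\<And>x. x \<in> I \<Longrightarrow> x \<noteq> 0 \<Longrightarrow> f b \<le> f x"
    using ex_has_least_nat[of "\<lambda>b. b \<in> I \<and> b \<noteq> 0" b0 f] by blast
  have "x \<in> scl b A" if x: "x \<in> I" for x
  proof -
    obtain q where q: "q \<in> A" "x - q * b = 0 \<or> f (x - q * b) < f b"
      using div idealD(1)[OF id] x b by metis
    have "x - q * b \<in> I" using ideal_diff[OF A id x idealD(4)[OF id q(1) b(1)]] .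
    then have "x - q * b = 0" using q(2) min by fastforce
    then have "x = b * q" by simp
    then show ?thesis using q(1) by blast
  qed
  moreover have "scl b A \<subseteq> I" using idealD(5)[OF id _ b(1)] by auto
  ultimately show ?thesis by blast
qed

lemma pid_loc2:
  assumes A: "subring A" and pid: "\<And>I. I \<in> nonzero_ideals A \<Longrightarrow> \<exists>b. I = scl b A"
    and I: "I \<in> nonzero_ideals (loc2 A)"
  shows "\<exists>b. I = scl b (loc2 A)"
proof -
  note id = nonzero_idealsD(1)[OF I]
  have A2: "2 ^ m \<in> loc2 A" for m :: nat using subringD[OF A] by (intro loc2_sub) simp
  have num: "x * 2 ^ m \<in> I" if "x \<in> I" for x m using idealD(5)[OF id A2 that] .
  have "\<exists>x\<in>I \<inter> A. x \<noteq> 0"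
  proof -
    obtain x where x: "x \<in> I" "x \<noteq> 0" using nonzero_idealsD(2)[OF I] by blast
    obtain a m where "x = a / 2 ^ m" "a \<in> A" using idealD(1)[OF id x(1)] by (auto simp: loc2_def)
    then have "a = x * 2 ^ m" by simp
    then have "a \<in> I" "a \<noteq> 0" using num[OF x(1)] x(2) by auto
    then show ?thesis using \<open>a \<in> A\<close> by blast
  qed
  moreover have "is_ideal A (I \<inter> A)"
    using idealD(2,3)[OF id] idealD(4)[OF id loc2_sub] subringD[OF A] by (auto simp: is_ideal_def)
  ultimately obtain b where b: "I \<inter> A = scl b A" using pid nonzero_idealsI by blast
  have "b * 1 \<in> scl b A" using subringD(1)[OF A] by (rule imageI)
  then have bI: "b \<in> I" using b by auto
  have "x \<in> scl b (loc2 A)" if x: "x \<in> I" for x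
  proof -
    obtain a m where a: "x = a / 2 ^ m" "a \<in> A" using idealD(1)[OF id x] by (auto simp: loc2_def)
    then have "a \<in> I \<inter> A" using num[OF x, of m] by simp
    then obtain c where "c \<in> A" "a = b * c" unfolding b by blast
    then have "x = b * (c / 2 ^ m)" "c / 2 ^ m \<in> loc2 A" using a by (auto intro: loc2I)
    then show ?thesis by blast
  qed
  moreover have "scl b (loc2 A) \<subseteq> I" using idealD(5)[OF id _ bI] by auto
  ultimately show ?thesis by blast
qed

lemma pid_Rcyc_4: "ideals_invertible (Rcyc 4)" "no_two_torsion (Rcyc 4)"
proof -
  have Z: "\<exists>b. I = scl b \<int>" if "I \<in> nonzero_ideals \<int>" for I
  proof (rule euclidean_pid[where f = "\<lambda>x. nat \<lfloor>\<bar>x\<bar>\<rfloor>"])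
    show "subring \<int>" using subring_Ocyc[of 4] by (simp add: Ocyc_4)
    show "\<exists>q\<in>\<int>. x - q * b = 0 \<or> nat \<lfloor>\<bar>x - q * b\<bar>\<rfloor> < nat \<lfloor>\<bar>b\<bar>\<rfloor>"
      if xb: "x \<in> \<int>" "b \<in> \<int>" "b \<noteq> 0" for x b :: real
    proof -
      obtain i j where ij: "x = of_int i" "b = of_int j" using xb by (auto elim!: Ints_cases)
      then have "j \<noteq> 0" using xb by simp
      have "x - of_int (i div j) * b = of_int (i mod j)"
        unfolding ij by (simp flip: of_int_mult of_int_diff add: minus_div_mult_eq_mod)
      moreover have "\<bar>i mod j\<bar> < \<bar>j\<bar>" using \<open>j \<noteq> 0\<close>
        by (rule abs_mod_less)
      ultimately show ?thesis unfolding ij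
        by (intro bexI[of _ "of_int (i div j)"]) (use \<open>j \<noteq> 0\<close> in \<open>simp_all flip: of_int_abs\<close>)
    qed
  qed (rule that)
  have pid: "\<exists>b. I = scl b (Rcyc 4)" if "I \<in> nonzero_ideals (Rcyc 4)" for I
    using pid_loc2[OF subring_Ocyc[of 4], unfolded Ocyc_4, OF Z] that by (simp add: Rcyc_eq Ocyc_4)
  show "ideals_invertible (Rcyc 4)" by (rule pid_imp(1)[OF subring_Rcyc pid])
  show "no_two_torsion (Rcyc 4)" by (rule pid_imp(2)[OF subring_Rcyc pid])
qed

text \<open>Rounding the two coordinates of \<open>x / b\<close> to nearest integers leaves an error
  whose coordinates are at most 1/2 in absolute value and whose norm lies between -3/4 and 1/4. To
  stay in the ring, \<open>x / b\<close> is handled as \<open>x * s12 b\<close> over the norm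
  \<open>M\<close> of \<open>b\<close>.\<close>

lemma pid_Rcyc_12: "ideals_invertible (Rcyc 12)" "no_two_torsion (Rcyc 12)"
proof -
  have Z: "\<exists>b. I = scl b (Ocyc 12)" if "I \<in> nonzero_ideals (Ocyc 12)" for I
  proof (rule euclidean_pid[where f = "\<lambda>x. nat \<lfloor>\<bar>x * s12 x\<bar>\<rfloor>"])
    show "subring (Ocyc 12)" by (rule subring_Ocyc)
    show "\<exists>q\<in>Ocyc 12. x - q * b = 0 \<or> nat \<lfloor>\<bar>(x - q * b) * s12 (x - q * b)\<bar>\<rfloor> < nat \<lfloor>\<bar>b * s12 b\<bar>\<rfloor>"
      if xb: "x \<in> Ocyc 12" "b \<in> Ocyc 12" "b \<noteq> 0" for x b :: real
    proof -
      obtain i j where b: "b = of_int i + of_int j * r3" using xb by (auto simp: Ocyc_12)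
      define M where "M = i ^ 2 - 3 * j ^ 2"
      have sb: "s12 b = of_int i - of_int j * r3" unfolding b by (rule s12_eq)
      have M: "b * s12 b = of_int M" unfolding sb unfolding b M_def by (rule norm12_eq)
      have M0: "M \<noteq> 0" using norm12_eq_0[of i j] xb(3) by (auto simp: M_def b)
      have sbO: "s12 b \<in> Ocyc 12" by (rule emb_Ocyc[OF conj_wd_12 coprime_7_12 xb(2)])
      obtain c d where cd: "x * s12 b = of_int c + of_int d * r3"
        using subringD(5)[OF subring_Ocyc xb(1) sbO] by (auto simp: Ocyc_12)
      \<comment> \<open>\<open>M\<close> may be negative, so the rounding is done modulo
        \<open>\<bar>M\<bar>\<close> and the sign is put back into the quotient.\<close>
      have rnd: "\<exists>u. 2 * \<bar>c - u * M\<bar> \<le> \<bar>M\<bar>" for c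
      proof -
        define k where "k = c mod \<bar>M\<bar>"
        have k: "0 \<le> k" "k < \<bar>M\<bar>" "c = (c div \<bar>M\<bar>) * \<bar>M\<bar> + k" using M0
          by (simp_all add: k_def)
        have s: "\<bar>M\<bar> = sgn M * M" by (simp add: abs_sgn mult.commute)
        show ?thesis
        proof (cases "2 * k \<le> \<bar>M\<bar>")
          case True
          have "c - (c div \<bar>M\<bar> * sgn M) * M = k" using k(3) s by (simp add: mult.assoc)
          then show ?thesis using True k by (intro exI[of _ "c div \<bar>M\<bar> * sgn M"]) simp
        next
          case False
          have "c - ((c div \<bar>M\<bar> + 1) * sgn M) * M = k - \<bar>M\<bar>" using k(3) s
            by (simp add: algebra_simps)
          then show ?thesis using False k by (intro exI[of _ "(c div \<bar>M\<bar> + 1) * sgn M"]) simp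
        qed
      qed
      obtain u v where u: "2 * \<bar>c - u * M\<bar> \<le> \<bar>M\<bar>" and v: "2 * \<bar>d - v * M\<bar> \<le> \<bar>M\<bar>" using rnd by metis
      define q where "q = of_int u + of_int v * r3"
      have q: "q \<in> Ocyc 12" by (auto simp: q_def Ocyc_12)
      define z where "z = x - q * b"
      have zO: "z \<in> Ocyc 12" unfolding z_def using q xb subringD[OF subring_Ocyc] by simp
      obtain g h where z: "z = of_int g + of_int h * r3" using zO by (auto simp: Ocyc_12)
      define K where "K = g ^ 2 - 3 * h ^ 2"
      have sz: "s12 z = of_int g - of_int h * r3" unfolding z by (rule s12_eq)
      have K: "z * s12 z = of_int K" unfolding sz unfolding z K_def by (rule norm12_eq)
      define e f where "e = c - u * M" and "f = d - v * M"
      have zb: "z * s12 b = of_int e + of_int f * r3"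
      proof -
        have "z * s12 b = x * s12 b - q * (b * s12 b)" by (simp add: z_def algebra_simps)
        also have "\<dots> = of_int e + of_int f * r3"
          unfolding cd M by (simp add: q_def e_def f_def algebra_simps)
        finally show ?thesis .
      qed
      have "s12 (z * s12 b) = s12 z * b"
      proof -
        have "s12 (s12 b) = b" using s12_eq[of i "- j"] unfolding sb by (simp add: b)
        then show ?thesis using emb_mult[OF conj_wd_12 coprime_7_12 Ocyc_Rcyc[OF zO] Ocyc_Rcyc[OF sbO]]
          by simp
      qed
      \<comment> \<open>By multiplicativity, the norm \<open>K\<close> of the remainder times
        \<open>M\<close> is the norm of the rounding error \<open>e + f * r3\<close>.\<close>
      then have "of_int (e ^ 2 - 3 * f ^ 2) = (z * s12 z) * (b * s12 b)"
        unfolding zb s12_eq norm12_eq[symmetric] by (simp add: zb[symmetric] mult_ac)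
      then have KM: "e ^ 2 - 3 * f ^ 2 = K * M" unfolding K M
        by (simp only: of_int_mult[symmetric] of_int_eq_iff)
      have "4 * e ^ 2 \<le> M ^ 2" "4 * f ^ 2 \<le> M ^ 2"
        using power_mono[OF u, of 2] power_mono[OF v, of 2]
        by (simp_all add: e_def f_def power_mult_distrib)
      moreover have "0 \<le> e ^ 2" "0 \<le> f ^ 2" "M ^ 2 > 0" using M0 by simp_all
      ultimately have "\<bar>e ^ 2 - 3 * f ^ 2\<bar> < M ^ 2" by linarith
      then have "\<bar>K\<bar> * \<bar>M\<bar> < \<bar>M\<bar> * \<bar>M\<bar>" unfolding KM
        by (simp add: abs_mult power2_eq_square abs_mult_self_eq)
      then have "\<bar>K\<bar> < \<bar>M\<bar>" by (rule mult_right_less_imp_less) simp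
      then have "nat \<lfloor>\<bar>z * s12 z\<bar>\<rfloor> < nat \<lfloor>\<bar>b * s12 b\<bar>\<rfloor>"
        unfolding K M by (simp flip: of_int_abs)
      then show ?thesis using q unfolding z_def by blast
    qed
  qed (rule that)
  have pid: "\<exists>b. I = scl b (Rcyc 12)" if "I \<in> nonzero_ideals (Rcyc 12)" for I
    using pid_loc2[OF subring_Ocyc[of 12] Z] that by (simp add: Rcyc_eq)
  show "ideals_invertible (Rcyc 12)" by (rule pid_imp(1)[OF subring_Rcyc pid])
  show "no_two_torsion (Rcyc 12)" by (rule pid_imp(2)[OF subring_Rcyc pid])
qed

text \<open>
  With \<open>x = 2 cos (2 \<phi>)\<close>, the polynomials below of degree 2, 4 and 6 are \<open>sin (k \<phi>) / sin \<phi>\<close> for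
  \<open>k = 5, 9, 13\<close>, the cyclotomic units; \<open>k \<equiv> 1 (mod 4)\<close> makes them norm-coherent without a sign.
\<close>

definition Q4 :: "int poly set" where
  "Q4 = {[:- 1, 1, 1:], [:2, - 1:]}"

lemma norm_coherent_Q4: "norm_coherent Q4"
  unfolding norm_coherent_def Q4_def
  by (simp add: ev_pCons algebra_simps power2_eq_square)

section \<open>The inductive invariant at level 4\<close>

lemma Rcyc_4: "x \<in> Rcyc 4 \<longleftrightarrow> (\<exists>a m. x = of_int a / 2 ^ m)"
  by (auto simp: Rcyc_eq loc2_def Ocyc_4 elim!: Ints_cases)

lemma emb_4: "coprime k 4 \<Longrightarrow> x \<in> Rcyc 4 \<Longrightarrow> emb 4 k x = x"
  using emb_eq[OF conj_wd_4, of k] by (auto simp: Rcyc_iff theta_conj_4 theta_4)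

lemma units_Rcyc_4:
  assumes "u \<in> units_of_ring (Rcyc 4)"
  obtains v where "v \<in> units_of_ring (Rcyc 4)" "u \<in> {v ^ 2, - (v ^ 2), 2 * v ^ 2, - 2 * v ^ 2}"
proof -
  obtain a m b l where "u = of_int a / 2 ^ m" "1 / u = of_int b / 2 ^ l" "u \<noteq> 0"
    using assms by (auto simp: units_iff Rcyc_4)
  note u = this
  then have "real_of_int a * of_int b = 2 ^ (m + l)" by (auto simp: field_simps power_add)
  then have "a * b = 2 ^ (m + l)" by (metis of_int_eq_iff of_int_mult of_int_numeral of_int_power)
  then have "nat \<bar>a\<bar> * nat \<bar>b\<bar> = 2 ^ (m + l)"
    by (simp flip: nat_mult_distrib abs_mult add: nat_power_eq)
  then have "nat \<bar>a\<bar> dvd 2 ^ (m + l)" by (metis dvd_triv_left)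
  then obtain k where "nat \<bar>a\<bar> = 2 ^ k" using divides_primepow_nat[OF two_is_prime_nat] by blast
  then have "int (nat \<bar>a\<bar>) = 2 ^ k" by simp
  then have "\<bar>a\<bar> = 2 ^ k" by simp
  then have a: "a = 2 ^ k \<or> a = - (2 ^ k)" by linarith
  \<comment> \<open>As \<open>2 ^ k / 2 ^ m\<close> is \<open>2 ^ (k + m)\<close> over a square, the
    parity of \<open>k + m\<close> decides between \<open>v ^ 2\<close> and
    \<open>2 * v ^ 2\<close>.\<close>
  define v :: real where "v = 2 ^ ((k + m) div 2) / 2 ^ m"
  have "2 ^ j / 2 ^ i \<in> Rcyc 4" for i j
    unfolding Rcyc_4 by (intro exI[of _ "2 ^ j"] exI[of _ i]) simp
  then have v: "v \<in> units_of_ring (Rcyc 4)" by (simp add: units_iff v_def)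
  have "2 ^ k / 2 ^ m = (if even (k + m) then v ^ 2 else 2 * v ^ 2)"
  proof -
    have "(2::real) ^ k / 2 ^ m = 2 ^ (k + m) / (2 ^ m * 2 ^ m)" by (simp add: power_add)
    also have "k + m = 2 * ((k + m) div 2) + (if even (k + m) then 0 else 1)" by simp
    also have "(2::real) ^ \<dots> = (2 ^ ((k + m) div 2)) ^ 2 * (if even (k + m) then 1 else 2)"
      by (simp add: power_add power_mult power2_eq_square flip: power_mult_distrib)
    finally show ?thesis by (simp add: v_def power_divide power2_eq_square)
  qed
  then have "u \<in> {v ^ 2, - (v ^ 2), 2 * v ^ 2, - 2 * v ^ 2}" using a u(1) by (auto split: if_splits)
  then show ?thesis using that v by blast
qed

lemma level_good_4: "level_good Q4 4"
proof -
  let ?U = "units_of_ring (Rcyc 4)"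
  note R = subringD[OF subring_Rcyc[of 4]]
  \<comment> \<open>At \<open>theta 4 = 0\<close> the angle \<open>\<phi>\<close> is
    \<open>pi / 4\<close>, where \<open>sin (5 * \<phi>) / sin \<phi>\<close> is -1. The two values
    generate the units modulo squares.\<close>
  have ev0: "ev [:- 1, 1, 1:] 0 = - 1" "ev [:2, - 1:] 0 = 2" by (simp_all add: ev_pCons)
  have U: "- 1 \<in> ?U" "2 \<in> ?U" using half_Rcyc[of 4] R by (simp_all add: units_iff)
  have gen: "\<forall>q\<in>Q4. \<forall>k. coprime k 4 \<longrightarrow> ev q (theta_conj 4 k) \<in> ?U"
    using U ev0 by (simp add: Q4_def theta_conj_4)
  have co: "coprime (1::nat) 4" by simp
  have c1: "- 1 \<in> cyc_mon Q4 4" using cyc_mon_gen[of "[:- 1, 1, 1:]" Q4 1 4] ev0 theta_4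
    by (simp add: Q4_def)
  have c2: "2 \<in> cyc_mon Q4 4" using cyc_mon_gen[of "[:2, - 1:]" Q4 1 4] ev0 theta_4
    by (simp add: Q4_def)
  have dec: "\<exists>c\<in>cyc_mon Q4 4. \<exists>v\<in>?U. u = c * v ^ 2" if u: "u \<in> ?U" for u
  proof -
    obtain v where v: "v \<in> ?U" "u \<in> {v ^ 2, - (v ^ 2), 2 * v ^ 2, - 2 * v ^ 2}"
      using units_Rcyc_4[OF u] .
    then consider "u = 1 * v ^ 2" | "u = (- 1) * v ^ 2" | "u = 2 * v ^ 2" | "u = (- 1 * 2) * v ^ 2" by auto
    then show ?thesis using v(1) c1 c2 cyc_mon.one[of Q4 4] cyc_mon_mult[OF c1 c2] by cases blast+
  qed
  have tp: "tpos 4 x \<longleftrightarrow> x > 0" if "x \<in> Rcyc 4" for x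
    unfolding tpos_iff[OF conj_wd_4 that] using emb_4[OF _ that] co by metis
  have tp_units: "\<exists>v\<in>?U. u = v ^ 2 \<or> u = (2 - theta 4) * v ^ 2"
    if u: "u \<in> ?U" "tpos 4 u" for u
  proof -
    have "u > 0" using u tp by (simp add: units_iff)
    obtain v where v: "v \<in> ?U" "u \<in> {v ^ 2, - (v ^ 2), 2 * v ^ 2, - 2 * v ^ 2}"
      using units_Rcyc_4[OF u(1)] .
    have "v ^ 2 \<ge> 0" by simp
    then have "u = v ^ 2 \<or> u = 2 * v ^ 2" using v(2) \<open>u > 0\<close> by auto
    then show ?thesis using v(1) by (auto simp: theta_4)
  qed
  have sg: "\<exists>u\<in>?U. tpos 4 (u * x)" if x: "x \<in> Rcyc 4" "x \<noteq> 0" for x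
  proof (cases "x > 0")
    case True
    then show ?thesis using units_1[OF subring_Rcyc] tp x by (intro bexI[of _ 1]) auto
  next
    case False
    then show ?thesis using U(1) tp[of "- x"] R x by (intro bexI[of _ "- 1"]) auto
  qed
  show ?thesis unfolding level_good_def using pid_Rcyc_4 gen dec tp_units sg by blast
qed

text \<open>At level 12 the angle is \<open>pi / 12\<close>, and \<open>k = 9\<close> and
  \<open>k = 13\<close> give \<open>1 + r3\<close> and -1. The case \<open>k = 5\<close> would give
  \<open>2 + r3\<close>, the inverse of the value \<open>2 - r3\<close> of the linear
  polynomial.\<close>

definition Q12 :: "int poly set" where
  "Q12 = {[:2, - 1:], [:1, - 2, - 3, 1, 1:], [:- 1, 3, 6, - 4, - 5, 1, 1:]}"

lemma norm_coherent_Q12: "norm_coherent Q12"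
  unfolding norm_coherent_def Q12_def
  by (simp add: ev_pCons) algebra

lemma ev_Q12:
  assumes "t * t = 3"
  shows "ev [:2, - 1:] t = 2 - t" "ev [:1, - 2, - 3, 1, 1:] t = 1 + t" "ev [:- 1, 3, 6, - 4, - 5, 1, 1:] t = - 1"
proof -
  have t: "t * (t * x) = 3 * x" for x using assms by (simp flip: mult.assoc)
  show "ev [:2, - 1:] t = 2 - t" "ev [:1, - 2, - 3, 1, 1:] t = 1 + t" "ev [:- 1, 3, 6, - 4, - 5, 1, 1:] t = - 1"
    by (simp_all add: ev_pCons algebra_simps t assms)
qed

text \<open>The expected generators modulo squares are -1, the fundamental unit
  \<open>2 + r3\<close> and the prime \<open>1 + r3\<close> above 2, each with exponent 0 or 1;
  \<open>2 - r3\<close> stands for its inverse \<open>2 + r3\<close>.\<close>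

definition sqclass12 :: "real \<Rightarrow> bool" where
  "sqclass12 u \<longleftrightarrow> (\<exists>s\<in>{1, - 1}. \<exists>p\<in>{1, 1 + r3}. \<exists>q\<in>{1, 2 - r3}.
     \<exists>v\<in>units_of_ring (Rcyc 12). u = s * p * q * v ^ 2)"

section \<open>Square classes of units at level 12\<close>

lemma r3_Rcyc: "r3 \<in> Rcyc 12"
  by (rule Ocyc_Rcyc[OF theta_Ocyc])

lemma units_12: "1 + r3 \<in> units_of_ring (Rcyc 12)" "2 - r3 \<in> units_of_ring (Rcyc 12)"
  "- 1 \<in> units_of_ring (Rcyc 12)" "2 \<in> units_of_ring (Rcyc 12)"
  "1 / (2 - r3) = 2 + r3" "1 - r3 \<in> units_of_ring (Rcyc 12)" "2 + r3 \<in> units_of_ring (Rcyc 12)"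
proof -
  note R = subringD[OF subring_Rcyc[of 12]]
  show m1: "- 1 \<in> units_of_ring (Rcyc 12)" and two: "2 \<in> units_of_ring (Rcyc 12)"
    using half_Rcyc[of 12] R by (simp_all add: units_iff)
  have "(2 - r3) * (2 + r3) = 1" using r3_sq by (simp add: algebra_simps)
  then show pi: "2 - r3 \<in> units_of_ring (Rcyc 12)" and pi': "2 + r3 \<in> units_of_ring (Rcyc 12)"
    using units_mult_cancel[OF subring_Rcyc, of "2 - r3" "2 + r3"] units_mult_cancel[OF subring_Rcyc, of "2 + r3" "2 - r3"]
    units_1[OF subring_Rcyc] r3_Rcyc R
    by (simp_all add: mult.commute)
  then show "1 / (2 - r3) = 2 + r3" using \<open>(2 - r3) * (2 + r3) = 1\<close>
    by (auto simp: units_iff field_simps)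
  have "(1 + r3) * (1 - r3) = - 2" using r3_sq by (simp add: algebra_simps)
  then show "1 + r3 \<in> units_of_ring (Rcyc 12)" "1 - r3 \<in> units_of_ring (Rcyc 12)"
    using units_mult_cancel[OF subring_Rcyc, of "1 + r3" "1 - r3"] units_mult_cancel[OF subring_Rcyc, of "1 - r3" "1 + r3"]
    units_mult[OF subring_Rcyc m1 two] r3_Rcyc R
    by (simp_all add: mult.commute)
qed

lemma sqclass12_square:
  assumes "sqclass12 u" "w \<in> units_of_ring (Rcyc 12)" shows "sqclass12 (u * w ^ 2)"
proof -
  obtain s p q v where "s \<in> {1, - 1}" "p \<in> {1, 1 + r3}" "q \<in> {1, 2 - r3}"
    "v \<in> units_of_ring (Rcyc 12)" "u = s * p * q * v ^ 2"
    using assms(1) unfolding sqclass12_def by blast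
  moreover from this have "u * w ^ 2 = s * p * q * (v * w) ^ 2" by (simp add: power_mult_distrib)
  ultimately show ?thesis using units_mult[OF subring_Rcyc _ assms(2)] unfolding sqclass12_def by blast
qed

lemma sqclass12_mult:
  assumes "sqclass12 u" "g \<in> {- 1, 1 + r3, 2 - r3}" shows "sqclass12 (g * u)"
proof -
  obtain s p q v where *: "s \<in> {1, - 1}" "p \<in> {1, 1 + r3}" "q \<in> {1, 2 - r3}"
    "v \<in> units_of_ring (Rcyc 12)" "u = s * p * q * v ^ 2"
    using assms(1) unfolding sqclass12_def by blast
  consider "g = - 1" | "g = 1 + r3" | "g = 2 - r3" using assms(2) by blast
  then show ?thesis
  proof cases
    case 1
    then have "g * u = (- s) * p * q * v ^ 2" "- s \<in> {1, - 1}" using * by auto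
    then show ?thesis unfolding sqclass12_def using * by blast
  next
    case 2
    show ?thesis
    proof (cases "p = 1")
      case True
      then have "g * u = s * g * q * v ^ 2" using * by simp
      then show ?thesis unfolding sqclass12_def using * 2 by blast
    next
      case False
      then have "g * u = s * 1 * q * (v * g) ^ 2" using * 2
        by (simp add: power_mult_distrib power2_eq_square)
      then show ?thesis unfolding sqclass12_def using * units_mult[OF subring_Rcyc *(4) units_12(1)] 2
        by blast
    qed
  next
    case 3
    show ?thesis
    proof (cases "q = 1")
      case True
      then have "g * u = s * p * g * v ^ 2" using * by simp
      then show ?thesis unfolding sqclass12_def using * 3 by blast
    next
      case False
      then have "g * u = s * p * 1 * (v * g) ^ 2" using * 3
        by (simp add: power_mult_distrib power2_eq_square)
      then show ?thesis unfolding sqclass12_def using * units_mult[OF subring_Rcyc *(4) units_12(2)] 3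
        by blast
    qed
  qed
qed

lemma sqclass12_1: "sqclass12 1"
  unfolding sqclass12_def using units_1[OF subring_Rcyc, of 12] by (intro bexI[of _ 1]) auto

lemma sqclass12_2_plus: "sqclass12 u \<Longrightarrow> sqclass12 ((2 + r3) * u)"
proof -
  assume "sqclass12 u"
  then have "sqclass12 ((2 - r3) * u * (2 + r3) ^ 2)"
    using units_12(7) by (intro sqclass12_square sqclass12_mult) auto
  moreover have "(2 - r3) * u * (2 + r3) ^ 2 = (2 + r3) * u * ((2 - r3) * (2 + r3))"
    by (simp add: power2_eq_square mult_ac)
  moreover have "(2 - r3) * (2 + r3) = 1" using r3_sq by (simp add: algebra_simps)
  ultimately show ?thesis by simp
qed

text \<open>Since \<open>(1 + r3) ^ 2 = 2 * (2 + r3)\<close>, dividing by 2 amounts to multiplying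
  by \<open>2 + r3\<close> up to a square.\<close>

lemma sqclass12_half: "sqclass12 u \<Longrightarrow> sqclass12 (u / 2)"
proof -
  assume "sqclass12 u"
  then have s: "sqclass12 ((2 + r3) * u * (1 / (1 + r3)) ^ 2)"
    using sqclass12_square[OF sqclass12_2_plus units_inverse[OF units_12(1)]] by simp
  have l: "(1 + r3) ^ 2 = 2 * (2 + r3)" using r3_sq by (simp add: power2_eq_square algebra_simps)
  have "(2 + r3) * u * (1 / (1 + r3)) ^ 2 = (2 + r3) * u / (1 + r3) ^ 2" by (simp add: power_divide)
  also have "\<dots> = u / 2" unfolding l mult.commute[of 2 "2 + r3"]
    using units_12(7) by (intro nonzero_mult_divide_mult_cancel_left) (simp add: units_iff)
  finally show ?thesis using s by (simp only:)
qed

text \<open>Descent by the fundamental unit: dividing by \<open>2 + r3\<close> replaces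
  \<open>(a, b)\<close> by \<open>(2 * a - 3 * b, 2 * b - a)\<close>, and for positive
  \<open>b\<close> the Pell equation gives \<open>0 \<le> 2 * b - a < b\<close>.\<close>

lemma sqclass12_unit_pos:
  "a ^ 2 - 3 * b ^ 2 = 1 \<Longrightarrow> a > 0 \<Longrightarrow> b \<ge> 0 \<Longrightarrow> sqclass12 (of_int a + of_int b * r3)"
proof (induction "nat b" arbitrary: a b rule: less_induct)
  case less
  show ?case
  proof (cases "b = 0")
    case True
    then have "a = 1" using less.prems by (simp add: power2_eq_1_iff)
    then show ?thesis using True sqclass12_1 by simp
  next
    case False
    then have b: "b > 0" using less.prems by simp
    have eq: "a ^ 2 = 1 + 3 * b ^ 2" using less.prems(1) by simp
    have b2: "b ^ 2 \<ge> 1" using b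
      by (simp add: power2_eq_square) (metis mult_pos_pos zless_imp_add1_zle add_0)
    have "b ^ 2 < a ^ 2" "a ^ 2 \<le> (2 * b) ^ 2" "(3 * b) ^ 2 < (2 * a) ^ 2"
      using eq b2 by (simp_all add: power_mult_distrib)
    then have ineq: "b < a" "a \<le> 2 * b" "3 * b < 2 * a"
      using b less.prems(2) power2_less_imp_less[of b a] power2_le_imp_le[of a "2 * b"] power2_less_imp_less[of "3 * b" "2 * a"]
      by linarith+
    have "(2 * a - 3 * b) ^ 2 - 3 * (2 * b - a) ^ 2 = 1"
      using less.prems(1) by (simp add: power2_eq_square algebra_simps)
    from less.hyps[OF _ this] ineq b
    have "sqclass12 (of_int (2 * a - 3 * b) + of_int (2 * b - a) * r3)" by simp
    from sqclass12_2_plus[OF this]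
    have s: "sqclass12 ((2 + r3) * (of_int (2 * a - 3 * b) + of_int (2 * b - a) * r3))" .
    have "(2 + r3) * (of_int (2 * a - 3 * b) + of_int (2 * b - a) * r3)
      = of_int (4 * a - 6 * b) + of_int b * r3 + (r3 * r3) * of_int (2 * b - a)"
      by (simp add: algebra_simps)
    also have "\<dots> = of_int a + of_int b * r3" by (simp add: r3_sq)
    finally show ?thesis using s by simp
  qed
qed

text \<open>Modulo 3 the left side is a square and -1 is not. Hence no unit of
  \<open>Ocyc 12\<close> has norm -1; carried up the tower, this separates the narrow class number
  from the class number.\<close>

lemma norm12_sign: "a ^ 2 - 3 * b ^ 2 \<noteq> (- 1 :: int)"
proof
  assume "a ^ 2 - 3 * b ^ 2 = - 1"
  then have "a ^ 2 = 3 * (b ^ 2 - 1) + 2" by simp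
  then have "a ^ 2 mod 3 = 2" by (simp only: mod_mult_self4) simp
  then have "(a mod 3) ^ 2 mod 3 = 2" by (simp add: power_mod)
  moreover have "a mod 3 \<in> {0, 1, 2}" using pos_mod_bound[of 3 a] pos_mod_sign[of 3 a]
    by (simp del: pos_mod_bound pos_mod_sign) linarith
  ultimately show False by auto
qed

lemma sqclass12_unit:
  assumes "a ^ 2 - 3 * b ^ 2 = (1 :: int)"
  shows "sqclass12 (of_int a + of_int b * r3)"
proof -
  have a0: "a \<noteq> 0"
  proof
    assume "a = 0"
    then show False using assms zero_le_power2[of b] by simp
  qed
  have pos: "sqclass12 (of_int a + of_int b * r3)" if a: "a ^ 2 - 3 * b ^ 2 = (1 :: int)" "a > 0" for a b
  proof (cases "b \<ge> 0")
    case True then show ?thesis using sqclass12_unit_pos that by blast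
  next
    case False
    have "sqclass12 (of_int a + of_int (- b) * r3)" using False a by (intro sqclass12_unit_pos) auto
    let ?x = "of_int a + of_int b * r3" and ?y = "of_int a - of_int b * r3"
    have 1: "?x * ?y = 1" unfolding norm12_eq a(1) by simp
    have "?x \<in> Rcyc 12" "?y \<in> Rcyc 12" using r3_Rcyc subringD[OF subring_Rcyc] by auto
    then have "?x \<in> units_of_ring (Rcyc 12)"
      using 1 units_mult_cancel[OF subring_Rcyc, of ?x ?y] units_1[OF subring_Rcyc] by simp
    then have "sqclass12 (?y * ?x ^ 2)"
      using sqclass12_square \<open>sqclass12 (of_int a + of_int (- b) * r3)\<close> by simp
    moreover have "?y * ?x ^ 2 = ?x" using 1 by (simp add: power2_eq_square mult.commute[of ?y] mult.assoc)
    ultimately show ?thesis by simp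
  qed
  show ?thesis
  proof (cases "a > 0")
    case True then show ?thesis using pos assms by blast
  next
    case False
    then have "sqclass12 (of_int (- a) + of_int (- b) * r3)" using a0 assms by (intro pos) auto
    then have "sqclass12 (- 1 * (of_int (- a) + of_int (- b) * r3))" by (intro sqclass12_mult) auto
    moreover have "- 1 * (of_int (- a) + of_int (- b) * r3) = of_int a + of_int b * r3" by simp
    ultimately show ?thesis by (simp only:)
  qed
qed

text \<open>An element of even norm is divisible by \<open>1 + r3\<close>, whose norm is -2. So the
  induction strips off one prime factor at a time and ends at a unit of norm 1.\<close>

lemma sqclass12_norm:
  "\<bar>a ^ 2 - 3 * b ^ 2\<bar> = 2 ^ j \<Longrightarrow> sqclass12 (of_int a + of_int b * r3)"
proof (induction j arbitrary: a b)
  case 0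
  then have "a ^ 2 - 3 * b ^ 2 = 1" using norm12_sign[of a b] by (auto simp: abs_if split: if_splits)
  then show ?case by (rule sqclass12_unit)
next
  case (Suc j)
  have "even \<bar>a ^ 2 - 3 * b ^ 2\<bar>" unfolding Suc.prems by simp
  then have "even (a - b)" by simp
  then obtain c where "a - b = 2 * c" by (elim evenE)
  then have c: "a = b + 2 * c" by simp
  have "a ^ 2 - 3 * b ^ 2 = - 2 * ((b - c) ^ 2 - 3 * c ^ 2)"
    unfolding c by (simp add: power2_eq_square algebra_simps)
  then have "\<bar>(b - c) ^ 2 - 3 * c ^ 2\<bar> = 2 ^ j" using Suc.prems by (simp add: abs_mult)
  from Suc.IH[OF this] have "sqclass12 (of_int (b - c) + of_int c * r3)" .
  then have s: "sqclass12 ((1 + r3) * (of_int (b - c) + of_int c * r3))" by (intro sqclass12_mult) auto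
  have "(1 + r3) * (of_int (b - c) + of_int c * r3) = of_int (b - c) + of_int b * r3 + (r3 * r3) * of_int c"
    by (simp add: algebra_simps)
  also have "\<dots> = of_int a + of_int b * r3" by (simp add: r3_sq c)
  finally show ?case using s by simp
qed

text \<open>Clearing denominators turns invertibility into \<open>y * z = 2 ^ (m + l)\<close> in
  \<open>Ocyc 12\<close>; taking norms shows that the norm of \<open>y\<close> is a power of 2 up to
  sign.\<close>

lemma units_Rcyc_12:
  assumes u: "u \<in> units_of_ring (Rcyc 12)" shows "sqclass12 u"
proof -
  obtain y m z l where u: "u = y / 2 ^ m" "1 / u = z / 2 ^ l" "u \<noteq> 0" "y \<in> Ocyc 12" "z \<in> Ocyc 12"
    using u by (auto simp: units_iff Rcyc_eq loc2_def)
  then have yz: "y * z = 2 ^ (m + l)" by (auto simp: field_simps power_add)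
  obtain a b c d where ab: "y = of_int a + of_int b * r3" and cd: "z = of_int c + of_int d * r3"
    using u by (auto simp: Ocyc_12)
  have s: "s12 y * s12 z = 2 ^ (m + l)"
    using emb_mult[OF conj_wd_12 coprime_7_12 Ocyc_Rcyc[OF u(4)] Ocyc_Rcyc[OF u(5)]] yz
      emb_of_int[OF conj_wd_12 coprime_7_12, of "2 ^ (m + l)"] by simp
  have "of_int ((a ^ 2 - 3 * b ^ 2) * (c ^ 2 - 3 * d ^ 2)) = (y * s12 y) * (z * s12 z)"
    unfolding ab cd s12_eq norm12_eq by simp
  also have "\<dots> = (y * z) * (s12 y * s12 z)" by (simp add: mult_ac)
  also have "\<dots> = real_of_int (2 ^ (m + l) * 2 ^ (m + l))" unfolding yz s by simp
  finally have "(a ^ 2 - 3 * b ^ 2) * (c ^ 2 - 3 * d ^ 2) = 2 ^ (m + l + (m + l))"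
    unfolding of_int_eq_iff by (simp add: power_add)
  then have "nat \<bar>a ^ 2 - 3 * b ^ 2\<bar> * nat \<bar>c ^ 2 - 3 * d ^ 2\<bar> = 2 ^ (m + l + (m + l))"
    by (simp flip: nat_mult_distrib abs_mult add: nat_power_eq)
  then have "nat \<bar>a ^ 2 - 3 * b ^ 2\<bar> dvd 2 ^ (m + l + (m + l))" by (metis dvd_triv_left)
  then obtain j where "nat \<bar>a ^ 2 - 3 * b ^ 2\<bar> = 2 ^ j"
    using divides_primepow_nat[OF two_is_prime_nat] by blast
  then have "int (nat \<bar>a ^ 2 - 3 * b ^ 2\<bar>) = 2 ^ j" by simp
  then have "\<bar>a ^ 2 - 3 * b ^ 2\<bar> = 2 ^ j" by simp
  then have "sqclass12 y" unfolding ab by (rule sqclass12_norm)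
  then have "sqclass12 (y / 2 ^ m)" for m
  proof (induction m)
    case (Suc m) then show ?case using sqclass12_half[of "y / 2 ^ m"] by (simp add: mult.commute)
  qed simp
  then show ?thesis by (simp add: u)
qed

section \<open>Signs at level 12\<close>

lemma emb_12_cases:
  assumes "coprime k 12" "x \<in> Rcyc 12" shows "emb 12 k x = x \<or> emb 12 k x = s12 x"
proof -
  have "(theta_conj 12 k - r3) * (theta_conj 12 k + r3) = 0"
    using theta_conj_12_sq[OF assms(1)] r3_sq by (simp add: algebra_simps)
  then have "theta_conj 12 k = theta 12 \<or> theta_conj 12 k = theta_conj 12 7" using theta_conj_12_7
    by auto
  then show ?thesis
    using assms(2) emb_eq[OF conj_wd_12 assms(1)] emb_eq[OF conj_wd_12 coprime_7_12]
    by (auto simp: Rcyc_iff)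
qed

lemma tpos_12: "x \<in> Rcyc 12 \<Longrightarrow> tpos 12 x \<longleftrightarrow> x > 0 \<and> s12 x > 0"
  unfolding tpos_iff[OF conj_wd_12]
  using emb_12_cases[of _ x] coprime_7_12 emb_Suc_0[OF conj_wd_12, of x] coprime_1_left[of 12] by metis

lemma s12_1_plus: "s12 (1 + r3) = 1 - r3" "s12 (2 - r3) = 2 + r3"
  using s12_eq[of 1 1] s12_eq[of 2 "- 1"] by simp_all

lemma level_good_12: "level_good Q12 12"
proof -
  let ?U = "units_of_ring (Rcyc 12)"
  note R = subringD[OF subring_Rcyc[of 12]]
  note hom = emb_mult[OF conj_wd_12 coprime_7_12] emb_power[OF conj_wd_12 coprime_7_12]
    emb_of_int[OF conj_wd_12 coprime_7_12]
  have gen: "ev q (theta_conj 12 k) \<in> ?U" if "q \<in> Q12" "coprime k 12" for q k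
  proof -
    have "theta_conj 12 k = r3 \<or> theta_conj 12 k = - r3"
      using theta_conj_12_sq[OF that(2)] r3_sq by (metis square_eq_iff)
    then show ?thesis using that(1) units_12 r3_sq by (auto simp: Q12_def ev_Q12)
  qed
  have c: "- 1 \<in> cyc_mon Q12 12" "1 + r3 \<in> cyc_mon Q12 12" "2 - r3 \<in> cyc_mon Q12 12"
    using cyc_mon_gen[of "[:- 1, 3, 6, - 4, - 5, 1, 1:]" Q12 1 12]
      cyc_mon_gen[of "[:1, - 2, - 3, 1, 1:]" Q12 1 12] cyc_mon_gen[of "[:2, - 1:]" Q12 1 12]
    by (simp_all add: Q12_def ev_Q12 r3_sq)
  have dec: "\<exists>c\<in>cyc_mon Q12 12. \<exists>v\<in>?U. u = c * v ^ 2" if u: "u \<in> ?U" for u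
  proof -
    obtain s p q v where *: "s \<in> {1, - 1}" "p \<in> {1, 1 + r3}" "q \<in> {1, 2 - r3}" "v \<in> ?U" "u = s * p * q * v ^ 2"
      using units_Rcyc_12[OF u] unfolding sqclass12_def by blast
    then have "s * p * q \<in> cyc_mon Q12 12" using c cyc_mon.one[of Q12 12] by (intro cyc_mon_mult) auto
    then show ?thesis using * by blast
  qed
  have U: "x \<in> Rcyc 12" "x \<noteq> 0" if "x \<in> ?U" for x using that by (auto simp: units_iff)
  have less2: "r3 < 2" using theta_conj_less_2[of 1 12] by simp
  have tp_units: "\<exists>v\<in>?U. u = v ^ 2 \<or> u = (2 - theta 12) * v ^ 2"
    if u: "u \<in> ?U" "tpos 12 u" for u
  proof -
    have pos: "u > 0" "s12 u > 0" using u tpos_12 U by auto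
    obtain s p q v where *: "s \<in> {1, - 1}" "p \<in> {1, 1 + r3}" "q \<in> {1, 2 - r3}" "v \<in> ?U" "u = s * p * q * v ^ 2"
      using units_Rcyc_12[OF u(1)] unfolding sqclass12_def by blast
    have pR: "p \<in> Rcyc 12" "q \<in> Rcyc 12" using * units_12 U R by auto
    have ss: "s12 s = s" "s \<in> Rcyc 12" "s * s = 1"
      using *(1) hom(3)[of 1] hom(3)[of "- 1"] R units_12(3) U by auto
    have "s12 u = s * s12 p * s12 q * (s12 v) ^ 2" unfolding *(5) using pR ss U[OF *(4)] R
      by (simp add: hom)
    then have "u * s12 u = (s * s) * (p * s12 p) * (q * s12 q) * (v * s12 v) ^ 2"
      using *(5) by (simp add: power_mult_distrib mult_ac)
    moreover have "q * s12 q = 1"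
    proof -
      have "(2 - r3) * (2 + r3) = 1" using r3_sq by (simp add: algebra_simps)
      then show ?thesis using *(3) s12_1_plus hom(3)[of 1] by auto
    qed
    moreover have "u * s12 u > 0" using pos by simp
    \<comment> \<open>A totally positive unit has positive norm, which excludes
      \<open>p = 1 + r3\<close> of norm -2. The remaining factors except \<open>s\<close> are
      positive, so \<open>s = 1\<close>.\<close>
    ultimately have "p * s12 p * (v * s12 v) ^ 2 > 0" using ss(3) by simp
    then have "p * s12 p > 0" by (simp add: zero_less_mult_iff)
    moreover have "(1 + r3) * (1 - r3) = - 2" using r3_sq by (simp add: algebra_simps)
    ultimately have "p = 1" using *(2) s12_1_plus by auto
    then have "u = s * (q * v ^ 2)" using *(5) by simp
    moreover have "q * v ^ 2 > 0" using *(3) less2 U[OF *(4)] by auto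
    ultimately have "s = 1" using pos(1) *(1) by auto
    then show ?thesis using \<open>u = s * (q * v ^ 2)\<close> *(3,4) by auto
  qed
  have sg: "\<exists>u\<in>?U. tpos 12 (u * x)" if x: "x \<in> Rcyc 12" "x \<noteq> 0" for x
  proof -
    have s0: "s12 x \<noteq> 0" using emb_eq_0[OF conj_wd_12 coprime_7_12 x(1)] x(2) by simp
    have "(1 + r3) * (1 - r3) < 0" using r3_sq by (simp add: algebra_simps)
    then have sgn: "(1 + r3 > 0 \<and> 1 - r3 < 0) \<or> (1 + r3 < 0 \<and> 1 - r3 > 0)"
      by (simp only: mult_less_0_iff)
    have tp: "tpos 12 (u * x) \<longleftrightarrow> u * x > 0 \<and> s12 u * s12 x > 0"
      if "u \<in> ?U" for u
      using tpos_12[OF R(5)[OF U(1)[OF that] x(1)]] hom(1)[OF U(1)[OF that] x(1)] by simp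
    have m1: "s12 (- 1) = - 1" "s12 1 = 1" using hom(3)[of "- 1"] hom(3)[of 1] by simp_all
    have ml: "s12 (- (1 + r3)) = - (1 - r3)" using s12_eq[of "- 1" "- 1"] by simp
    have ml': "- (1 + r3) \<in> ?U" by (rule units_minus[OF subring_Rcyc units_12(1)])
    \<comment> \<open>\<open>1 + r3\<close> and its conjugate have opposite signs, so together with
      -1 all four sign patterns occur.\<close>
    have "\<exists>u\<in>{1, - 1, 1 + r3, - (1 + r3)}. u * x > 0 \<and> s12 u * s12 x > 0"
      using x(2) s0 sgn unfolding bex_simps(5) bex_simps(7) ml m1 s12_1_plus zero_less_mult_iff by auto
    then show ?thesis using tp units_1[OF subring_Rcyc, of 12] units_12(1,3) ml' by blast
  qed
  show ?thesis unfolding level_good_def using pid_Rcyc_12 gen dec tp_units sg by blast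
qed

section \<open>Class numbers\<close>

lemma card_quotient_eq:
  assumes E: "equiv S E" and F: "equiv T F"
    and f: "\<And>x. x \<in> S \<Longrightarrow> f x \<in> T"
    and iff: "\<And>x y. x \<in> S \<Longrightarrow> y \<in> S \<Longrightarrow> (x, y) \<in> E \<longleftrightarrow> (f x, f y) \<in> F"
    and surj: "\<And>t. t \<in> T \<Longrightarrow> \<exists>x\<in>S. (f x, t) \<in> F"
  shows "card (S // E) = card (T // F)"
proof (rule bij_betw_same_card)
  define g where "g X = F `` (f ` X)" for X
  have g: "g (E `` {x}) = F `` {f x}" if x: "x \<in> S" for x
  proof
    show "F `` {f x} \<subseteq> g (E `` {x})" using equiv_class_self[OF E x] by (auto simp: g_def)
    have "(f x, z) \<in> F" if "(x, y) \<in> E" "(f y, z) \<in> F" for y z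
    proof -
      have "y \<in> S" using that(1) E by (auto simp: equiv_def refl_on_def)
      then have "(f x, f y) \<in> F" using iff x that(1) by blast
      then show ?thesis using that(2) F by (meson equivE transE)
    qed
    then show "g (E `` {x}) \<subseteq> F `` {f x}" by (auto simp: g_def)
  qed
  show "bij_betw g (S // E) (T // F)"
  proof (rule bij_betw_imageI)
    show "inj_on g (S // E)"
    proof (rule inj_onI)
      fix X Y assume "X \<in> S // E" "Y \<in> S // E" "g X = g Y"
      then obtain x y where xy: "x \<in> S" "y \<in> S" "X = E `` {x}" "Y = E `` {y}"
        by (auto elim!: quotientE)
      then have "F `` {f x} = F `` {f y}" using \<open>g X = g Y\<close> g by simp
      then have "(f x, f y) \<in> F" using eq_equiv_class[OF _ F] f xy by blast
      then have "(x, y) \<in> E" using iff xy by blast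
      then show "X = Y" using equiv_class_eq[OF E] xy by blast
    qed
    show "g ` (S // E) = T // F"
    proof (intro equalityI subsetI)
      fix Y assume "Y \<in> g ` (S // E)"
      then obtain x where "x \<in> S" "Y = F `` {f x}" using g by (auto elim!: quotientE)
      then show "Y \<in> T // F" using quotientI[OF f] by simp
    next
      fix Y assume "Y \<in> T // F"
      then obtain t where t: "t \<in> T" "Y = F `` {t}" by (auto elim!: quotientE)
      then obtain x where x: "x \<in> S" "(f x, t) \<in> F" using surj by blast
      then have "Y = g (E `` {x})" using g t equiv_class_eq[OF F] by metis
      then show "Y \<in> g ` (S // E)" using x(1) by (auto intro: quotientI)
    qed
  qed
qed

lemma even_card_involution:
  assumes "finite S" "\<And>x. x \<in> S \<Longrightarrow> f x \<in> S" "\<And>x. x \<in> S \<Longrightarrow> f (f x) = x" "\<And>x. x \<in> S \<Longrightarrow> f x \<noteq> x"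
  shows "even (card S)"
  using assms
proof (induction S rule: finite_psubset_induct)
  case (psubset S)
  show ?case
  proof (cases "S = {}")
    case False
    then obtain x where x: "x \<in> S" by blast
    let ?T = "S - {x, f x}"
    have "even (card ?T)"
    proof (rule psubset.IH)
      show "f y \<in> ?T" if "y \<in> ?T" for y
      proof -
        have "f y \<noteq> x" "f y \<noteq> f x" using that psubset.prems(2)[of y] psubset.prems(2)[OF x]
          by auto
        then show ?thesis using that psubset.prems(1) by auto
      qed
    qed (use x psubset.prems in auto)
    moreover have "card ?T = card S - card {x, f x}"
      using x psubset.prems(1) psubset.hyps by (intro card_Diff_subset) auto
    moreover have "card {x, f x} = 2" using psubset.prems(3)[OF x] by simp
    moreover have "card {x, f x} \<le> card S" using x psubset.prems(1) psubset.hyps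
      by (intro card_mono) auto
    ultimately show ?thesis by simp
  qed simp
qed

lemma scl_divide: "b \<noteq> 0 \<Longrightarrow> scl a I = scl b (scl (a / b) I)"
  by (subst scl_scl) simp

lemma ideal_equivI:
  "I \<in> nonzero_ideals A \<Longrightarrow> J \<in> nonzero_ideals A \<Longrightarrow> a \<in> A \<Longrightarrow> b \<in> A \<Longrightarrow> a \<noteq> 0 \<Longrightarrow> b \<noteq> 0 \<Longrightarrow>
    P a \<Longrightarrow> P b \<Longrightarrow> scl a I = scl b J \<Longrightarrow> (I, J) \<in> ideal_equiv A P"
  unfolding ideal_equiv_def mem_Collect_eq prod.case by (intro conjI exI[of _ a] exI[of _ b])

lemma ideal_equivE:
  assumes "(I, J) \<in> ideal_equiv A P"
  obtains a b where "I \<in> nonzero_ideals A" "J \<in> nonzero_ideals A"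
    "a \<in> A" "b \<in> A" "a \<noteq> 0" "b \<noteq> 0" "P a" "P b" "scl a I = scl b J"
  using assms unfolding ideal_equiv_def mem_Collect_eq prod.case by (elim conjE exE) (rule that)

lemma ideal_equiv_equiv:
  assumes A: "subring A" and P: "P 1" "\<And>a b. a \<in> A \<Longrightarrow> b \<in> A \<Longrightarrow> P a \<Longrightarrow> P b \<Longrightarrow> P (a * b)"
  shows "equiv (nonzero_ideals A) (ideal_equiv A P)"
proof (rule equivI)
  show "refl_on (nonzero_ideals A) (ideal_equiv A P)"
    using P(1) subringD(1)[OF A] by (intro refl_onI ideal_equivI[of _ A _ 1 1]) auto
  show "sym (ideal_equiv A P)"
  proof (rule symI)
    fix I J assume "(I, J) \<in> ideal_equiv A P"
    then obtain a b where ab: "I \<in> nonzero_ideals A" "J \<in> nonzero_ideals A"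
      "a \<in> A" "b \<in> A" "a \<noteq> 0" "b \<noteq> 0" "P a" "P b" "scl a I = scl b J"
      by (rule ideal_equivE)
    show "(J, I) \<in> ideal_equiv A P" by (rule ideal_equivI[OF ab(2,1,4,3,6,5,8,7) ab(9)[symmetric]])
  qed
  show "trans (ideal_equiv A P)"
  proof (rule transI)
    fix I J K assume "(I, J) \<in> ideal_equiv A P" "(J, K) \<in> ideal_equiv A P"
    then obtain a b c d where *: "I \<in> nonzero_ideals A" "K \<in> nonzero_ideals A"
      "a \<in> A" "b \<in> A" "c \<in> A" "d \<in> A" "a \<noteq> 0" "b \<noteq> 0" "c \<noteq> 0" "d \<noteq> 0" "P a" "P b" "P c" "P d"
      "scl a I = scl b J" "scl c J = scl d K"
      by (elim ideal_equivE)
    have "scl (c * a) I = scl c (scl b J)" using *(15) by (simp only: scl_scl[symmetric])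
    also have "\<dots> = scl b (scl c J)" by (simp only: scl_scl mult.commute[of b c])
    also have "\<dots> = scl (b * d) K" unfolding *(16) by (rule scl_scl)
    finally have eq: "scl (c * a) I = scl (b * d) K" .
    have "c * a \<noteq> 0" "b * d \<noteq> 0" using *(7-10) by simp_all
    then show "(I, K) \<in> ideal_equiv A P"
      by (rule ideal_equivI[OF *(1,2) subringD(5)[OF A *(5,3)] subringD(5)[OF A *(4,6)] _ _
            P(2)[OF *(5,3,13,11)] P(2)[OF *(4,6,12,14)] eq])
  qed
qed (auto simp: ideal_equiv_def)

abbreviation class_equiv :: "real set \<Rightarrow> (real set \<times> real set) set" where
  "class_equiv A \<equiv> ideal_equiv A (\<lambda>_. True)"

lemma class_equiv_equiv: "subring A \<Longrightarrow> equiv (nonzero_ideals A) (class_equiv A)"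
  by (rule ideal_equiv_equiv) auto

text \<open>Inversion is an involution of the class group whose only fixed point is the trivial class.\<close>

lemma odd_class_number:
  assumes A: "subring A" and inv: "ideals_invertible A" and tor: "no_two_torsion A"
    and fin: "finite (nonzero_ideals A // class_equiv A)"
  shows "odd (class_number A)"
proof -
  let ?S = "nonzero_ideals A" and ?E = "class_equiv A"
  note E = class_equiv_equiv[OF A]
  \<comment> \<open>The inverse class, defined without choosing a representative; the fact
    \<open>f\<close> shows that any one representative and any one inverse of it determine
    it.\<close>
  define f where "f X = {J \<in> ?S. \<exists>I\<in>X. \<exists>a. a \<noteq> 0 \<and> iprod I J = scl a A}" for X
  have f: "f (?E `` {I}) = ?E `` {J0}"
    if I: "I \<in> ?S" "J0 \<in> ?S" "a \<noteq> 0" "iprod I J0 = scl a A" for I J0 a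
  proof -
    have idJ: "is_ideal A J0" using I(2) by (rule nonzero_idealsD)
    have "a * 1 \<in> scl a A" using subringD(1)[OF A] by (rule imageI)
    then have aA: "a \<in> A"
      using idealD(1)[OF iprod_ideal[OF nonzero_idealsD(1)[OF I(1)] nonzero_idealsD(1)[OF I(2)]]] I(4)
      by simp
    show ?thesis
    proof (intro equalityI subsetI)
      fix J assume "J \<in> f (?E `` {I})"
      then obtain I1 c where J: "J \<in> ?S" "(I, I1) \<in> ?E" "c \<noteq> 0" "iprod I1 J = scl c A"
        by (auto simp: f_def)
      obtain \<alpha> \<beta> where ab: "\<alpha> \<in> A" "\<beta> \<in> A" "\<alpha> \<noteq> 0" "\<beta> \<noteq> 0" "scl \<alpha> I = scl \<beta> I1"
        using J(2) by (rule ideal_equivE)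
      have idJ': "is_ideal A J" using J(1) by (rule nonzero_idealsD)
      have "c * 1 \<in> scl c A" using subringD(1)[OF A] by (rule imageI)
      moreover have "I1 \<in> ?S" using J(2) by (auto simp: ideal_equiv_def)
      ultimately have cA: "c \<in> A"
        using idealD(1)[OF iprod_ideal[OF nonzero_idealsD(1) idJ']] J(4) by simp
      have "scl (\<alpha> * a) J = iprod (scl \<alpha> (scl a A)) J"
        by (simp only: scl_scl iprod_scl_left iprod_commute[of A] iprod_ring[OF A idJ'])
      also have "\<dots> = iprod (iprod (scl \<alpha> I) J0) J" unfolding I(4)[symmetric]
        by (simp only: iprod_scl_left)
      also have "\<dots> = scl \<beta> (iprod (iprod I1 J) J0)" unfolding ab(5)
        by (simp only: iprod_scl_left iprod_assoc iprod_commute[of J0 J])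
      also have "\<dots> = scl (\<beta> * c) J0" unfolding J(4)
        by (simp only: scl_scl iprod_scl_left iprod_commute[of A] iprod_ring[OF A idJ])
      finally have eq: "scl (\<beta> * c) J0 = scl (\<alpha> * a) J" ..
      have "\<beta> * c \<noteq> 0" "\<alpha> * a \<noteq> 0" using J(3) I(3) ab(3,4) by simp_all
      then have "(J0, J) \<in> ?E"
        by (rule ideal_equivI[OF I(2) J(1) subringD(5)[OF A ab(2) cA] subringD(5)[OF A ab(1) aA] _ _ TrueI TrueI eq])
      then show "J \<in> ?E `` {J0}" by simp
    next
      fix J assume "J \<in> ?E `` {J0}"
      then have "(J0, J) \<in> ?E" by simp
      then obtain \<gamma> \<delta> where J: "J \<in> ?S" "\<gamma> \<in> A" "\<delta> \<in> A" "\<gamma> \<noteq> 0" "\<delta> \<noteq> 0" "scl \<gamma> J0 = scl \<delta> J"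
        by (rule ideal_equivE)
      have "scl \<delta> (iprod I J) = iprod I (scl \<gamma> J0)" by (simp only: J(6) iprod_scl_right)
      also have "\<dots> = scl (\<gamma> * a) A" by (simp only: iprod_scl_right I(4) scl_scl)
      also have "\<dots> = scl \<delta> (scl (\<gamma> * a / \<delta>) A)" using J(5) by (rule scl_divide)
      finally have "iprod I J = scl (\<gamma> * a / \<delta>) A" by (rule scl_cancel[OF J(5)])
      moreover have "\<gamma> * a / \<delta> \<noteq> 0" using J I by simp
      ultimately show "J \<in> f (?E `` {I})"
        using J(1) equiv_class_self[OF E I(1)] unfolding f_def by blast
    qed
  qed
  have rep: "\<exists>I\<in>?S. \<exists>J\<in>?S. \<exists>a. X = ?E `` {I} \<and> a \<noteq> 0 \<and> iprod I J = scl a A" if "X \<in> ?S // ?E" for X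
    using that inv unfolding ideals_invertible_def by (elim quotientE) blast
  have closed: "f X \<in> ?S // ?E" if "X \<in> ?S // ?E" for X
    using rep[OF that] f by (metis quotientI)
  have invol: "f (f X) = X" if "X \<in> ?S // ?E" for X
    using rep[OF that] f by (metis iprod_commute)
  let ?c = "?E `` {A}"
  have AA: "A \<in> ?S" "iprod A A = scl 1 A"
    using nonzero_ideals_ring[OF A] iprod_ring[OF A ideal_ring[OF A]] by simp_all
  have c: "?c \<in> ?S // ?E" "f ?c = ?c" using AA f[of A A 1] by (auto intro: quotientI)
  have uniq: "X = ?c" if X: "X \<in> ?S // ?E" "f X = X" for X
  proof -
    obtain I J a where I: "I \<in> ?S" "J \<in> ?S" "X = ?E `` {I}" "a \<noteq> 0" "iprod I J = scl a A"
      using rep[OF X(1)] by blast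
    then have "?E `` {J} = ?E `` {I}" using f[of I J a] X(2) by simp
    then have "(J, I) \<in> ?E" using eq_equiv_class[OF _ E] I by blast
    then obtain \<gamma> \<delta> where g: "\<gamma> \<noteq> 0" "\<delta> \<noteq> 0" "scl \<gamma> J = scl \<delta> I" by (rule ideal_equivE)
    \<comment> \<open>A class equal to its inverse has principal square: \<open>J\<close> may be
      replaced by \<open>I\<close> in the principal product.\<close>
    have "scl \<delta> (iprod I I) = iprod I (scl \<gamma> J)" by (simp only: g(3) iprod_scl_right)
    also have "\<dots> = scl (\<gamma> * a) A" by (simp only: iprod_scl_right I(5) scl_scl)
    also have "\<dots> = scl \<delta> (scl (\<gamma> * a / \<delta>) A)" using g(2) by (rule scl_divide)
    finally have "iprod I I = scl (\<gamma> * a / \<delta>) A" by (rule scl_cancel[OF g(2)])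
    then obtain b where b: "I = scl b A" using tor I(1) unfolding no_two_torsion_def by blast
    have "b * 1 \<in> scl b A" using subringD(1)[OF A] by (rule imageI)
    then have bA: "b \<in> A" using idealD(1)[OF nonzero_idealsD(1)[OF I(1)]] b by simp
    have b0: "b \<noteq> 0" using nonzero_idealsD(2)[OF I(1)] b by auto
    have "scl b A = scl 1 I" using b by simp
    then have "(A, I) \<in> ?E"
      by (rule ideal_equivI[OF AA(1) I(1) bA subringD(1)[OF A] b0 one_neq_zero TrueI TrueI])
    then show ?thesis using equiv_class_eq[OF E] I(3) by metis
  qed
  have "even (card (?S // ?E - {?c}))"
  proof (rule even_card_involution[where f = f])
    show "f X \<in> ?S // ?E - {?c}" if "X \<in> ?S // ?E - {?c}" for X
      using that closed invol c by (metis DiffD1 DiffD2 DiffI singletonD singletonI)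
  qed (use fin invol uniq in auto)
  moreover have "card (?S // ?E - {?c}) = card (?S // ?E) - 1" using c by (intro card_Diff_singleton)
  moreover have "card (?S // ?E) > 0" using fin c by (auto simp: card_gt_0_iff)
  ultimately show ?thesis unfolding class_number_def by simp
qed

section \<open>Inverting 2 in ideals\<close>

lemma loc2_ideal:
  assumes A: "subring A" and I: "is_ideal A I" shows "is_ideal (loc2 A) (loc2 I)"
  unfolding is_ideal_def
proof (intro conjI ballI)
  show "loc2 I \<subseteq> loc2 A" using idealD(1)[OF I] by (auto simp: loc2_def)
  show "0 \<in> loc2 I" using loc2_sub[OF idealD(2)[OF I]] .
  fix x y assume "x \<in> loc2 I" "y \<in> loc2 I"
  then obtain a b k l where *: "x = a / 2 ^ k" "y = b / 2 ^ l" "a \<in> I" "b \<in> I"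
    by (auto simp: loc2_def)
  have "x + y = (2 ^ l * a + 2 ^ k * b) / 2 ^ (k + l)" by (auto simp: * field_simps power_add)
  moreover have "2 ^ l * a + 2 ^ k * b \<in> I" using * subringD[OF A] by (intro idealD(3,4)[OF I]) simp_all
  ultimately show "x + y \<in> loc2 I" using loc2I by metis
next
  fix x y assume "x \<in> loc2 A" "y \<in> loc2 I"
  then obtain a b k l where *: "x = a / 2 ^ k" "y = b / 2 ^ l" "a \<in> A" "b \<in> I"
    by (auto simp: loc2_def)
  have "x * y = (a * b) / 2 ^ (k + l)" by (auto simp: * power_add)
  then show "x * y \<in> loc2 I" using loc2I[OF idealD(4)[OF I *(3,4)]] by metis
qed

lemma loc2_scl: "loc2 (scl a I) = scl a (loc2 I)"
proof (intro equalityI subsetI)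
  fix x assume "x \<in> loc2 (scl a I)"
  then obtain y m where "y \<in> I" "x = a * y / 2 ^ m" by (auto simp: loc2_def)
  then have "x = a * (y / 2 ^ m)" "y \<in> I" by simp_all
  then show "x \<in> scl a (loc2 I)" using loc2I by blast
next
  fix x assume "x \<in> scl a (loc2 I)"
  then obtain y m where "y \<in> I" "x = a * (y / 2 ^ m)" unfolding loc2_def by blast
  then have "x = a * y / 2 ^ m" "a * y \<in> scl a I" by auto
  then show "x \<in> loc2 (scl a I)" using loc2I by blast
qed

lemma loc2_nonzero_ideals: "subring A \<Longrightarrow> I \<in> nonzero_ideals A \<Longrightarrow> loc2 I \<in> nonzero_ideals (loc2 A)"
  using nonzero_idealsD[of I A] loc2_ideal[of A I] loc2_sub[of _ I] by (auto intro: nonzero_idealsI)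

lemma loc2_contract:
  assumes A: "subring A" and I: "I \<in> nonzero_ideals (loc2 A)"
  shows "I \<inter> A \<in> nonzero_ideals A" "loc2 (I \<inter> A) = I"
proof -
  note id = nonzero_idealsD(1)[OF I]
  have A2: "2 ^ m \<in> loc2 A" "1 / 2 ^ m \<in> loc2 A" for m :: nat
    using subringD[OF A] by (auto intro: loc2_sub loc2I)
  have ex: "\<exists>a\<in>I \<inter> A. \<exists>m. x = a / 2 ^ m" if x: "x \<in> I" for x
  proof -
    obtain a m where a: "x = a / 2 ^ m" "a \<in> A" using idealD(1)[OF id x] by (auto simp: loc2_def)
    then have "a = x * 2 ^ m" by simp
    then have "a \<in> I" using idealD(5)[OF id A2(1) x] by simp
    then show ?thesis using a by blast
  qed
  show "loc2 (I \<inter> A) = I"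
  proof (intro equalityI subsetI)
    fix x assume "x \<in> loc2 (I \<inter> A)"
    then obtain a m where "a \<in> I" "x = a * (1 / 2 ^ m)" by (auto simp: loc2_def)
    then show "x \<in> I" using idealD(5)[OF id A2(2)] by simp
  next
    fix x assume "x \<in> I"
    then show "x \<in> loc2 (I \<inter> A)" using ex loc2I by blast
  qed
  obtain x where "x \<in> I" "x \<noteq> 0" using nonzero_idealsD(2)[OF I] by blast
  then have "\<exists>a\<in>I \<inter> A. a \<noteq> 0" using ex by fastforce
  moreover have "is_ideal A (I \<inter> A)"
    using idealD(2,3)[OF id] idealD(4)[OF id loc2_sub] subringD[OF A] by (auto simp: is_ideal_def)
  ultimately show "I \<inter> A \<in> nonzero_ideals A" using nonzero_idealsI by blast
qed

text \<open>By \<open>residue\<close>, \<open>two\<close> and \<open>nonunit\<close>, the residue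
  ring modulo \<open>l\<close> is the field with two elements; by \<open>two\<close> and
  \<open>pow\<close>, inverting 2 is the same as inverting \<open>l\<close>.
  \<open>finite_val\<close> makes the valuation at \<open>l\<close> finite without factorisation of
  ideals.\<close>

locale prime_over_2 =
  fixes A :: "real set" and l :: real
  assumes subring: "subring A" and l_A: "l \<in> A" and l_0: "l \<noteq> 0"
    and residue: "\<And>x. x \<in> A \<Longrightarrow> \<exists>m. \<exists>y\<in>A. x = of_int m + l * y"
    and two: "\<exists>y\<in>A. 2 = l * y" and pow: "\<exists>M. \<exists>y\<in>A. l ^ M = 2 * y"
    and nonunit: "1 / l \<notin> A"
    and finite_val: "\<And>x. x \<in> A \<Longrightarrow> x \<noteq> 0 \<Longrightarrow> \<exists>e. \<forall>y\<in>A. x \<noteq> l ^ e * y"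
begin

lemmas A_closed = subringD[OF subring]

definition dv :: "real \<Rightarrow> bool" where "dv x \<longleftrightarrow> (\<exists>y\<in>A. x = l * y)"

lemma dv_mult: "dv x \<Longrightarrow> y \<in> A \<Longrightarrow> dv (x * y)" "dv x \<Longrightarrow> y \<in> A \<Longrightarrow> dv (y * x)"
  using A_closed(5) unfolding dv_def by (metis mult.assoc, metis mult.assoc mult.commute)

lemma dv_add: "dv x \<Longrightarrow> dv y \<Longrightarrow> dv (x + y)"
  using A_closed(4) unfolding dv_def by (metis distrib_left)

lemma dv_residue: "x \<in> A \<Longrightarrow> dv x \<or> dv (x - 1)"
proof -
  assume "x \<in> A"
  then obtain m y where my: "y \<in> A" "x = of_int m + l * y" using residue by blast
  have d2: "dv (of_int (2 * k))" for k
  proof -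
    have "dv 2" using two by (simp add: dv_def)
    then have "dv (2 * of_int k)" using A_closed(8) by (rule dv_mult)
    then show ?thesis by simp
  qed
  have ly: "dv (l * y)" using my by (auto simp: dv_def)
  show ?thesis
  proof (cases "even m")
    case True
    then obtain k where "m = 2 * k" by blast
    then show ?thesis using dv_add[OF d2 ly, of k] my by simp
  next
    case False
    then obtain k where "m = 2 * k + 1" by (elim oddE)
    then show ?thesis using dv_add[OF d2 ly, of k] my by simp
  qed
qed

lemma not_dv_1: "\<not> dv 1"
proof
  assume "dv 1"
  then obtain y where "y \<in> A" "1 = l * y" by (auto simp: dv_def)
  then have "1 / l = y" using l_0 by (simp add: field_simps)
  then show False using nonunit \<open>y \<in> A\<close> by simp
qed

text \<open>Outside the ideal of \<open>l\<close> every residue is 1, and so is the product of two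
  such.\<close>

lemma dv_prime: "x \<in> A \<Longrightarrow> y \<in> A \<Longrightarrow> \<not> dv x \<Longrightarrow> \<not> dv y \<Longrightarrow> \<not> dv (x * y)"
proof
  assume *: "x \<in> A" "y \<in> A" "\<not> dv x" "\<not> dv y" "dv (x * y)"
  then obtain a b where ab: "a \<in> A" "b \<in> A" "x - 1 = l * a" "y - 1 = l * b" using dv_residue
    unfolding dv_def by metis
  then have xy: "x = 1 + l * a" "y = 1 + l * b" by simp_all
  have "- (a + b + l * a * b) \<in> A" using ab l_A A_closed by simp
  then have "dv (l * - (a + b + l * a * b))" unfolding dv_def by blast
  then have "dv (x * y + l * - (a + b + l * a * b))" by (rule dv_add[OF *(5)])
  moreover have "x * y + l * - (a + b + l * a * b) = 1" by (simp add: xy algebra_simps)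
  ultimately show False using not_dv_1 by simp
qed

lemma valuation:
  assumes "x \<in> A" "x \<noteq> 0"
  obtains e y where "y \<in> A" "x = l ^ e * y" "\<not> dv y"
proof -
  define e where "e = (LEAST e. \<forall>y\<in>A. x \<noteq> l ^ e * y)"
  have e: "\<forall>y\<in>A. x \<noteq> l ^ e * y" unfolding e_def using finite_val[OF assms]
    by (rule LeastI_ex)
  \<comment> \<open>\<open>l ^ 0\<close> always divides, so the least exponent that fails is
    positive and has a predecessor.\<close>
  then have "x \<noteq> l ^ e * x" using assms(1) by (rule bspec)
  then have "e \<noteq> 0" by (intro notI) simp
  then obtain e' where e': "e = Suc e'" using not0_implies_Suc by blast
  have "\<not> (\<forall>y\<in>A. x \<noteq> l ^ e' * y)"
    by (rule not_less_Least) (use e' in \<open>simp flip: e_def\<close>)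
  then obtain y where y: "y \<in> A" "x = l ^ e' * y" by blast
  have "\<not> dv y"
  proof
    assume "dv y"
    then obtain z where "z \<in> A" "y = l * z" by (auto simp: dv_def)
    then have "x = l ^ e * z" using y(2) by (simp add: e' mult_ac)
    then show False using e \<open>z \<in> A\<close> by simp
  qed
  then show ?thesis using that y by blast
qed

lemma power_eq_unique:
  assumes "x \<in> A" "y \<in> A" "\<not> dv x" "\<not> dv y" "l ^ i * x = l ^ j * y"
  shows "i = j"
proof -
  have *: "\<not> i < j" if xy: "x \<in> A" "y \<in> A" "\<not> dv x" "l ^ i * x = l ^ j * y" for x y i j
  proof
    assume "i < j"
    then have "l ^ j = l ^ i * (l * l ^ (j - Suc i))" by (simp flip: power_Suc power_add)
    then have "x = l * (l ^ (j - Suc i) * y)" using xy(4) l_0 by simp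
    moreover have "l ^ (j - Suc i) * y \<in> A" using xy A_closed l_A by simp
    ultimately show False using xy(3) unfolding dv_def by blast
  qed
  from *[OF assms(1,2,3,5)] *[OF assms(2,1,4) assms(5)[symmetric]] show ?thesis by simp
qed

lemma unit_not_dv: "u \<in> units_of_ring A \<Longrightarrow> \<not> dv u"
  using dv_mult(1)[of u "1 / u"] not_dv_1 by (auto simp: units_iff)

lemma R2: "subring (loc2 A)"
  by (rule subring_loc2[OF subring])

lemma l_unit: "l \<in> units_of_ring (loc2 A)"
proof -
  obtain y where y: "y \<in> A" "2 = l * y" using two by blast
  then have "1 / l = y / 2 ^ 1" using l_0 by (simp add: field_simps)
  then show ?thesis using loc2I[OF y(1)] l_A l_0 loc2_sub by (metis units_iff)
qed

text \<open>Multiplying by a power of \<open>w\<close> turns the product into a power of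
  \<open>l\<close>; comparing exponents leaves the cofactors with product 1.\<close>

lemma factor_2_power:
  assumes "y \<in> A" "z \<in> A" "y * z = 2 ^ N"
  obtains u e where "u \<in> units_of_ring A" "y = l ^ e * u"
proof -
  obtain M w where M: "w \<in> A" "l ^ M = 2 * w" using pow by blast
  have nz: "y \<noteq> 0" "z \<noteq> 0" using assms(3) by auto
  obtain e y' where y': "y' \<in> A" "y = l ^ e * y'" "\<not> dv y'" using valuation[OF assms(1) nz(1)] .
  have "y * (z * w ^ N) = (2 * w) ^ N" using assms(3) by (simp add: power_mult_distrib flip: mult.assoc)
  then have eq: "y * (z * w ^ N) = l ^ (M * N)" by (simp only: power_mult M(2))
  have w0: "z * w ^ N \<noteq> 0"
  proof
    assume "z * w ^ N = 0"
    then show False using eq l_0 by (simp only: mult_zero_right) simp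
  qed
  obtain f z' where z': "z' \<in> A" "z * w ^ N = l ^ f * z'" "\<not> dv z'"
    using valuation[OF A_closed(5)[OF assms(2) A_closed(7)[OF M(1)]] w0] .
  have yz: "l ^ (e + f) * (y' * z') = l ^ (M * N) * 1" using eq unfolding y'(2) z'(2)
    by (simp add: power_add mult_ac)
  have "e + f = M * N"
    by (rule power_eq_unique[OF A_closed(5)[OF y'(1) z'(1)] A_closed(1) dv_prime[OF y'(1) z'(1) y'(3) z'(3)] not_dv_1 yz])
  with yz have "y' * z' = 1" using l_0 by simp
  then have "y' \<in> units_of_ring A"
    using y' z' units_mult_cancel[OF subring, of y' z'] units_1[OF subring] by simp
  then show ?thesis using that y' by blast
qed

text \<open>Localisation adds exactly the powers of \<open>l\<close> to the units. The two exponents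
  stand for their possibly negative difference.\<close>

lemma units_loc2:
  assumes "u \<in> units_of_ring (loc2 A)"
  obtains w e f where "w \<in> units_of_ring A" "u * l ^ f = w * l ^ e"
proof -
  obtain y m z k where u: "u = y / 2 ^ m" "1 / u = z / 2 ^ k" "u \<noteq> 0" "y \<in> A" "z \<in> A"
    using assms by (auto simp: units_iff loc2_def)
  then have "y * z = 2 ^ (m + k)" by (auto simp: field_simps power_add)
  then obtain w e where w: "w \<in> units_of_ring A" "y = l ^ e * w" using factor_2_power u by metis
  obtain v f where v: "v \<in> units_of_ring A" "2 ^ m = l ^ f * v"
    by (rule factor_2_power[of "2 ^ m" 1 m]) (use A_closed in auto)
  have "v \<noteq> 0" using v by (simp add: units_iff)
  have "u * l ^ f = (w / v) * l ^ e" using u(1) w(2) v(2) \<open>v \<noteq> 0\<close> l_0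
    by (simp add: field_simps)
  then show ?thesis using that units_divide[OF subring w(1) v(1)] by blast
qed

text \<open>\<open>l ^ e\<close> is the power of \<open>l\<close> common to all elements of
  \<open>I\<close>; an element of least valuation becomes prime to \<open>l\<close> after division
  by it.\<close>

lemma ideal_factor:
  assumes I: "I \<in> nonzero_ideals A"
  obtains e J x where "is_ideal A J" "I = scl (l ^ e) J" "x \<in> J" "\<not> dv x"
proof -
  note id = nonzero_idealsD(1)[OF I]
  let ?P = "\<lambda>e. \<exists>x\<in>I. \<exists>y\<in>A. x = l ^ e * y \<and> \<not> dv y"
  obtain x0 where x0: "x0 \<in> I" "x0 \<noteq> 0" using nonzero_idealsD(2)[OF I] by blast
  obtain e0 y0 where "y0 \<in> A" "x0 = l ^ e0 * y0" "\<not> dv y0"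
    using valuation idealD(1)[OF id x0(1)] x0(2) by metis
  then have "?P e0" using x0 by blast
  then obtain e where e: "?P e" and min: "\<And>i. ?P i \<Longrightarrow> e \<le> i"
    using exists_least_iff[of ?P] by (metis not_le_imp_less)
  define J where "J = {y \<in> A. l ^ e * y \<in> I}"
  have "is_ideal A J"
    unfolding is_ideal_def
  proof (intro conjI ballI)
    show "x + y \<in> J" if "x \<in> J" "y \<in> J" for x y
      using that A_closed(4) idealD(3)[OF id] by (simp add: J_def distrib_left)
    show "a * x \<in> J" if "a \<in> A" "x \<in> J" for a x
      using that A_closed(5) idealD(4)[OF id, of a "l ^ e * x"] by (simp add: J_def mult.left_commute)
  qed (use A_closed idealD(2)[OF id] in \<open>auto simp: J_def\<close>)
  moreover have "I = scl (l ^ e) J"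
  proof (intro equalityI subsetI)
    fix x assume x: "x \<in> I"
    show "x \<in> scl (l ^ e) J"
    proof (cases "x = 0")
      case True then show ?thesis using idealD(2)[OF id] A_closed
        by (auto simp: J_def intro!: image_eqI[of _ _ 0])
    next
      case False
      then obtain i y where y: "y \<in> A" "x = l ^ i * y" "\<not> dv y" using valuation idealD(1)[OF id x]
        by metis
      then have "e \<le> i" using min x by blast
      then have "x = l ^ e * (l ^ (i - e) * y)" using y by (simp flip: mult.assoc power_add)
      moreover from this have "l ^ (i - e) * y \<in> J" using x y l_A A_closed
        by (auto simp: J_def mult.assoc)
      ultimately show ?thesis by blast
    qed
  qed (auto simp: J_def)
  moreover obtain y where "y \<in> J" "\<not> dv y" using e by (auto simp: J_def)
  ultimately show ?thesis using that by blast
qed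

text \<open>As \<open>x\<close> is 1 modulo \<open>l\<close>, a high power of \<open>1 - x\<close>
  is divisible by \<open>2 ^ m\<close>, so multiplying it by \<open>z = a / 2 ^ m\<close> gives an
  element of \<open>I\<close>. The same power is 1 modulo \<open>x\<close>, and so \<open>z\<close>
  differs from that element by a multiple of \<open>x\<close>.\<close>

lemma saturated:
  assumes id: "is_ideal A I" and x: "x \<in> I" "\<not> dv x"
  shows "loc2 I \<inter> A = I"
proof (intro equalityI subsetI)
  fix z assume z: "z \<in> loc2 I \<inter> A"
  then obtain a m where a: "z = a / 2 ^ m" "a \<in> I" by (auto simp: loc2_def)
  have xA: "x \<in> A" by (rule idealD(1)[OF id x(1)])
  then have "dv (x - 1)" using x(2) dv_residue by blast
  then obtain b where b: "b \<in> A" "x - 1 = l * b" by (auto simp: dv_def)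
  obtain M w where M: "w \<in> A" "l ^ M = 2 * w" using pow by blast
  have pw: "\<exists>c\<in>A. (1 - x) ^ N = 1 - x * c" for N
  proof (induction N)
    case 0 show ?case using A_closed by (intro bexI[of _ 0]) auto
  next
    case (Suc N)
    then obtain c where c: "c \<in> A" "(1 - x) ^ N = 1 - x * c" by blast
    have "(1 - x) ^ Suc N = 1 - x * (1 + c - x * c)" by (simp add: c algebra_simps)
    then show ?case using c xA A_closed by (intro bexI[of _ "1 + c - x * c"]) auto
  qed
  obtain c where c: "c \<in> A" "(1 - x) ^ (M * m) = 1 - x * c" using pw by blast
  have "1 - x = l * - b" using b by simp
  then have "(1 - x) ^ (M * m) = (2 * w) ^ m * (- b) ^ (M * m)"
    by (simp only: power_mult_distrib power_mult[of l] M(2))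
  then have "z * (1 - x * c) = a * (w ^ m * (- b) ^ (M * m))"
    using a(1) by (simp add: c(2)[symmetric] power_mult_distrib)
  then have "z = a * (w ^ m * (- b) ^ (M * m)) + (z * c) * x" by (simp add: algebra_simps)
  moreover have "a * (w ^ m * (- b) ^ (M * m)) \<in> I" using a(2) M b A_closed
    by (intro idealD(5)[OF id]) auto
  moreover have "(z * c) * x \<in> I" using z c A_closed by (intro idealD(4)[OF id _ x(1)]) auto
  ultimately show "z \<in> I" using idealD(3)[OF id] by metis
qed (auto intro: loc2_sub idealD(1)[OF id])

text \<open>Strip the powers of \<open>l\<close> off both ideals; what remains is saturated and so
  is recovered from its localisation.\<close>

lemma scl_loc2_eq:
  assumes I: "I \<in> nonzero_ideals A" and J: "J \<in> nonzero_ideals A"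
    and ab: "a \<in> A" "b \<in> A" "a \<noteq> 0" "b \<noteq> 0" "scl a (loc2 I) = scl b (loc2 J)"
  obtains e f where "scl (l ^ e * a) I = scl (l ^ f * b) J"
proof -
  have aI: "scl a I \<in> nonzero_ideals A" "scl b J \<in> nonzero_ideals A"
    using I J ab by (auto intro!: nonzero_ideals_scl subring)
  obtain e I' x where I': "is_ideal A I'" "scl a I = scl (l ^ e) I'" "x \<in> I'" "\<not> dv x"
    using ideal_factor[OF aI(1)] .
  obtain f J' y where J': "is_ideal A J'" "scl b J = scl (l ^ f) J'" "y \<in> J'" "\<not> dv y"
    using ideal_factor[OF aI(2)] .
  have lu: "l ^ i \<in> units_of_ring (loc2 A)" for i by (rule units_power[OF R2 l_unit])
  have "loc2 I' = scl (l ^ e) (loc2 I')"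
    by (rule scl_unit[OF R2 loc2_ideal[OF subring I'(1)] lu, symmetric])
  also have "\<dots> = scl a (loc2 I)" by (simp only: loc2_scl[symmetric] I'(2))
  also have "\<dots> = scl b (loc2 J)" by (rule ab(5))
  also have "\<dots> = scl (l ^ f) (loc2 J')" by (simp only: loc2_scl[symmetric] J'(2))
  also have "\<dots> = loc2 J'" by (rule scl_unit[OF R2 loc2_ideal[OF subring J'(1)] lu])
  finally have "loc2 I' \<inter> A = loc2 J' \<inter> A" by (rule arg_cong)
  then have "I' = J'" by (simp only: saturated[OF I'(1,3,4)] saturated[OF J'(1,3,4)])
  have "scl (l ^ f * a) I = scl (l ^ f) (scl (l ^ e) I')" by (simp only: scl_scl[symmetric] I'(2))
  also have "\<dots> = scl (l ^ e) (scl (l ^ f) J')" unfolding \<open>I' = J'\<close>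
    by (simp only: scl_scl mult.commute[of "l ^ f" "l ^ e"])
  also have "\<dots> = scl (l ^ e * b) J" by (simp only: scl_scl[symmetric] J'(2))
  finally show ?thesis by (rule that)
qed

text \<open>Localising is surjective on classes by contraction. It is injective because only powers
  of the principal ideal \<open>(l)\<close> are lost.\<close>

lemma class_number_loc2: "class_number A = class_number (loc2 A)"
  unfolding class_number_def
proof (rule card_quotient_eq[OF class_equiv_equiv[OF subring] class_equiv_equiv[OF R2]])
  show "loc2 I \<in> nonzero_ideals (loc2 A)" if "I \<in> nonzero_ideals A" for I
    using loc2_nonzero_ideals[OF subring that] .
  show "\<exists>I\<in>nonzero_ideals A. (loc2 I, J) \<in> class_equiv (loc2 A)"
    if "J \<in> nonzero_ideals (loc2 A)" for J
  proof
    show "J \<inter> A \<in> nonzero_ideals A" by (rule loc2_contract[OF subring that])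
    show "(loc2 (J \<inter> A), J) \<in> class_equiv (loc2 A)"
      unfolding loc2_contract(2)[OF subring that]
      using ideal_equivI[OF that that, of 1 1] subringD(1)[OF R2] by simp
  qed
  fix I J assume IJ: "I \<in> nonzero_ideals A" "J \<in> nonzero_ideals A"
  note loc = loc2_nonzero_ideals[OF subring IJ(1)] loc2_nonzero_ideals[OF subring IJ(2)]
  show "(I, J) \<in> class_equiv A \<longleftrightarrow> (loc2 I, loc2 J) \<in> class_equiv (loc2 A)"
  proof
    assume "(I, J) \<in> class_equiv A"
    then obtain a b where ab: "a \<in> A" "b \<in> A" "a \<noteq> 0" "b \<noteq> 0" "scl a I = scl b J"
      by (rule ideal_equivE)
    then have "scl a (loc2 I) = scl b (loc2 J)" by (simp only: loc2_scl[symmetric])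
    then show "(loc2 I, loc2 J) \<in> class_equiv (loc2 A)"
      by (rule ideal_equivI[OF loc loc2_sub[OF ab(1)] loc2_sub[OF ab(2)] ab(3,4) TrueI TrueI])
  next
    assume "(loc2 I, loc2 J) \<in> class_equiv (loc2 A)"
    then obtain a b where ab: "a \<in> loc2 A" "b \<in> loc2 A" "a \<noteq> 0" "b \<noteq> 0" "scl a (loc2 I) = scl b (loc2 J)"
      by (rule ideal_equivE)
    then obtain c d i j where cd: "a = c / 2 ^ i" "b = d / 2 ^ j" "c \<in> A" "d \<in> A"
      by (auto simp: loc2_def)
    \<comment> \<open>\<open>t\<close> clears the denominators of \<open>a\<close> and
      \<open>b\<close> at once.\<close>
    define t where "t = (2::real) ^ (i + j)"
    have ta: "t * a = c * 2 ^ j" "t * b = d * 2 ^ i" by (simp_all add: t_def cd power_add)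
    have *: "t * a \<in> A" "t * b \<in> A" "t * a \<noteq> 0" "t * b \<noteq> 0"
    proof -
      show "t * a \<in> A" "t * b \<in> A" unfolding ta using cd A_closed by simp_all
      show "t * a \<noteq> 0" "t * b \<noteq> 0" using ab(3,4) by (simp_all add: t_def)
    qed
    have "scl (t * a) (loc2 I) = scl (t * b) (loc2 J)" by (simp only: scl_scl[symmetric] ab(5))
    then obtain e f where "scl (l ^ e * (t * a)) I = scl (l ^ f * (t * b)) J" using scl_loc2_eq[OF IJ *]
      by metis
    moreover have "l ^ e * (t * a) \<in> A" "l ^ f * (t * b) \<in> A" "l ^ e * (t * a) \<noteq> 0" "l ^ f * (t * b) \<noteq> 0"
      using * l_0 A_closed(5)[OF A_closed(7)[OF l_A]] by simp_all
    ultimately show "(I, J) \<in> class_equiv A" using ideal_equivI[OF IJ _ _ _ _ TrueI TrueI] by metis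
  qed
qed

end

text \<open>Hurwitz' finiteness argument: by simultaneous approximation, a bounded multiple of any quotient
  \<open>\<alpha> / \<beta>\<close> lies close to an element of the order, so a fixed integer annihilates \<open>I\<close> modulo a
  suitable element for every ideal \<open>I\<close>.\<close>

locale normed_order =
  fixes A :: "real set" and b :: "nat \<Rightarrow> real" and D d :: nat and \<nu> :: "real \<Rightarrow> real" and C :: real
  assumes subring: "subring A" and d: "d > 0" and C: "C \<ge> 0"
    and b: "\<And>j. j < D \<Longrightarrow> b j \<in> A"
    and span: "\<And>x. x \<in> A \<Longrightarrow> \<exists>c. x = (\<Sum>j<D. of_int (c j) * b j)"
    and \<nu>_nat: "\<And>x. x \<in> A \<Longrightarrow> \<nu> x \<in> \<nat>" and \<nu>_0: "\<And>x. x \<in> A \<Longrightarrow> \<nu> x = 0 \<longleftrightarrow> x = 0"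
    and \<nu>_mult: "\<And>x y. x \<in> A \<Longrightarrow> y \<in> A \<Longrightarrow> \<nu> (x * y) = \<nu> x * \<nu> y"
    and \<nu>_int: "\<And>c. \<nu> (of_int c) = \<bar>of_int c\<bar> ^ d"
    and cofactor: "\<And>x. x \<in> A \<Longrightarrow> x \<noteq> 0 \<Longrightarrow> \<exists>y\<in>A. \<exists>c. c \<noteq> 0 \<and> x * y = of_int c"
    and bound: "\<And>c e. (\<And>j. j < D \<Longrightarrow> \<bar>of_int (c j)\<bar> \<le> e) \<Longrightarrow> \<nu> (\<Sum>j<D. of_int (c j) * b j) \<le> (C * e) ^ d"
begin

lemmas A_closed = subringD[OF subring]

lemma hurwitz:
  obtains T :: nat where "T > 0"
    "\<And>x y. x \<in> A \<Longrightarrow> y \<in> A \<Longrightarrow> y \<noteq> 0 \<Longrightarrow> \<exists>t w. 0 < t \<and> t \<le> int T \<and> w \<in> A \<and> \<nu> (of_int t * x - w * y) < \<nu> y"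
proof -
  \<comment> \<open>\<open>m\<close> exceeds \<open>C\<close>, so that an approximation error of
    \<open>1 / m\<close> shrinks norms; for \<open>D\<close> coordinates Dirichlet's theorem then
    allows multipliers up to \<open>m ^ D\<close>.\<close>
  obtain m :: nat where m: "C < real m" using reals_Archimedean2 by blast
  then have m0: "m > 0" using C by (intro Nat.gr0I) auto
  have "\<exists>t w. 0 < t \<and> t \<le> int (m ^ D) \<and> w \<in> A \<and> \<nu> (of_int t * x - w * y) < \<nu> y"
    if xy: "x \<in> A" "y \<in> A" "y \<noteq> 0" for x y
  proof -
    \<comment> \<open>A cofactor \<open>z\<close> of \<open>y\<close> turns \<open>x / y\<close>
      into \<open>x * z / N\<close>, whose coordinates are rational with denominator
      \<open>N\<close>.\<close>
    obtain z N where z: "z \<in> A" "N \<noteq> 0" "y * z = of_int N" using cofactor[OF xy(2,3)] by blast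
    obtain c where c: "x * z = (\<Sum>j<D. of_int (c j) * b j)" using span A_closed(5)[OF xy(1) z(1)]
      by blast
    obtain q p where q: "0 < q" "q \<le> int (m ^ D)"
      and p: "\<And>j. j < D \<Longrightarrow> \<bar>of_int q * (of_int (c j) / of_int N) - of_int (p j)\<bar> < 1 / m"
      using Dirichlet_approx_simult[OF m0, of D "\<lambda>j. of_int (c j) / of_int N"] by blast
    define w where "w = (\<Sum>j<D. of_int (p j) * b j)"
    have w: "w \<in> A" unfolding w_def using b A_closed by (intro subring_sum[OF subring]) auto
    define g where "g j = q * c j - N * p j" for j
    have g: "\<bar>of_int (g j)\<bar> \<le> \<bar>of_int N\<bar> / real m" if "j < D" for j
    proof -
      have "of_int (g j) = of_int N * (of_int q * (of_int (c j) / of_int N) - real_of_int (p j))"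
        using z(2) by (simp add: g_def field_simps)
      then have "\<bar>of_int (g j)\<bar> = \<bar>of_int N\<bar> * \<bar>of_int q * (of_int (c j) / of_int N) - real_of_int (p j)\<bar>"
        by (simp only: abs_mult)
      also have "\<dots> \<le> \<bar>of_int N\<bar> * (1 / m)" using p[OF that]
        by (intro mult_left_mono) auto
      finally show ?thesis by simp
    qed
    have "z * (of_int q * x - w * y) = of_int q * (x * z) - w * of_int N"
      by (simp add: z(3)[symmetric] algebra_simps)
    also have "\<dots> = (\<Sum>j<D. of_int (g j) * b j)"
      unfolding c w_def g_def by (simp add: sum_distrib_left sum_distrib_right sum_subtractf algebra_simps)
    finally have eq: "z * (of_int q * x - w * y) = (\<Sum>j<D. of_int (g j) * b j)" .
    have r: "of_int q * x - w * y \<in> A" using xy w A_closed by simp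
    have "\<nu> z * \<nu> (of_int q * x - w * y) \<le> (C * (\<bar>of_int N\<bar> / m)) ^ d"
      using bound[of g "\<bar>of_int N\<bar> / m"] g \<nu>_mult[OF z(1) r] eq by simp
    also have "\<dots> < \<bar>of_int N\<bar> ^ d"
    proof (rule power_strict_mono)
      have "C * (\<bar>of_int N\<bar> / m) = (C / m) * \<bar>of_int N\<bar>" by simp
      also have "\<dots> < 1 * \<bar>of_int N\<bar>" using m m0 z(2)
        by (intro mult_strict_right_mono) (auto simp: field_simps)
      finally show "C * (\<bar>of_int N\<bar> / m) < \<bar>real_of_int N\<bar>" by simp
    qed (use C d in auto)
    also have "\<dots> = \<nu> z * \<nu> y" using \<nu>_mult[OF xy(2) z(1)] z(3) \<nu>_int[of N]
      by (simp add: mult.commute)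
    finally have "\<nu> z * \<nu> (of_int q * x - w * y) < \<nu> z * \<nu> y" .
    moreover have "\<nu> z \<ge> 0" using \<nu>_nat[OF z(1)] by (auto elim!: Nats_cases)
    ultimately have "\<nu> (of_int q * x - w * y) < \<nu> y" using mult_less_cancel_left by (metis not_le)
    then show ?thesis using q w by blast
  qed
  then show ?thesis using that[of "m ^ D"] m0 by simp
qed

text \<open>An ideal containing \<open>M\<close> is a union of cosets of \<open>M A\<close>, so it
  is determined by the coordinate vectors with entries in \<open>{0..<M}\<close> whose combinations
  it contains.\<close>

lemma finitely_many_ideals: "finite {I. is_ideal A I \<and> real M \<in> I}" if M: "M > 0"
proof -
  define \<Phi> where "\<Phi> I = {c \<in> {..<D} \<rightarrow>\<^sub>E {0..<int M}. (\<Sum>j<D. of_int (c j) * b j) \<in> I}" for I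
  have mem: "x \<in> I \<longleftrightarrow> (\<Sum>j<D. of_int (c j mod int M) * b j) \<in> I"
    if I: "is_ideal A I" "real M \<in> I" and x: "x = (\<Sum>j<D. of_int (c j) * b j)" for x I c
  proof -
    have "x = (\<Sum>j<D. of_int (c j mod int M) * b j) + (\<Sum>j<D. of_int (c j div int M) * b j) * real M"
    proof -
      have "of_int (c j) = of_int (c j mod int M) + of_int (c j div int M) * real M" for j
        by (metis mod_div_mult_eq of_int_add of_int_mult of_int_of_nat_eq)
      then have "of_int (c j) * b j = of_int (c j mod int M) * b j + of_int (c j div int M) * b j * real M" for j
        by (metis distrib_right mult.assoc mult.commute)
      then show ?thesis unfolding x by (simp add: sum.distrib sum_distrib_right)
    qed
    moreover have "(\<Sum>j<D. of_int (c j div int M) * b j) * real M \<in> I"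
      using b A_closed by (intro idealD(4)[OF I(1) _ I(2)] subring_sum[OF subring]) auto
    ultimately show ?thesis using idealD(3)[OF I(1)] ideal_diff[OF subring I(1)]
      by (metis add_diff_cancel_right')
  qed
  have inj: "inj_on \<Phi> {I. is_ideal A I \<and> real M \<in> I}"
  proof (rule inj_onI)
    have "I \<subseteq> J" if IJ: "is_ideal A I" "real M \<in> I" "is_ideal A J" "real M \<in> J" "\<Phi> I = \<Phi> J" for I J
    proof
      fix x assume xI: "x \<in> I"
      obtain c where c: "x = (\<Sum>j<D. of_int (c j) * b j)" using span idealD(1)[OF IJ(1) xI] by blast
      define c' where "c' = restrict (\<lambda>j. c j mod int M) {..<D}"
      have s: "(\<Sum>j<D. of_int (c' j) * b j) = (\<Sum>j<D. of_int (c j mod int M) * b j)"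
        by (intro sum.cong) (auto simp: c'_def)
      have "c' \<in> {..<D} \<rightarrow>\<^sub>E {0..<int M}" using M by (auto simp: c'_def)
      then have "c' \<in> \<Phi> I" using mem[OF IJ(1,2) c] xI s by (simp add: \<Phi>_def)
      then have "c' \<in> \<Phi> J" using IJ(5) by simp
      then show "x \<in> J" using mem[OF IJ(3,4) c] s by (simp add: \<Phi>_def)
    qed
    then show "I = J" if "I \<in> {I. is_ideal A I \<and> real M \<in> I}" "J \<in> {I. is_ideal A I \<and> real M \<in> I}" "\<Phi> I = \<Phi> J" for I J
      using that by (intro equalityI) (auto simp: set_eq_subset)
  qed
  have "\<Phi> ` {I. is_ideal A I \<and> real M \<in> I} \<subseteq> Pow ({..<D} \<rightarrow>\<^sub>E {0..<int M})" by (auto simp: \<Phi>_def)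
  then have fin: "finite (\<Phi> ` {I. is_ideal A I \<and> real M \<in> I})"
    by (rule finite_subset) (simp add: finite_PiE)
  show ?thesis by (rule finite_imageD[OF fin inj])
qed

lemma finite_class_group: "finite (nonzero_ideals A // class_equiv A)"
proof -
  obtain T :: nat where T: "T > 0" and hur: "\<And>x y. x \<in> A \<Longrightarrow> y \<in> A \<Longrightarrow> y \<noteq> 0 \<Longrightarrow>
      \<exists>t w. 0 < t \<and> t \<le> int T \<and> w \<in> A \<and> \<nu> (of_int t * x - w * y) < \<nu> y" using hurwitz by blast
  \<comment> \<open>The factorial is divisible by every multiplier \<open>t \<le> T\<close> at
    once.\<close>
  define M :: nat where "M = fact T"
  have M: "M > 0" by (simp add: M_def)
  have rep: "\<exists>J. is_ideal A J \<and> real M \<in> J \<and> J \<in> nonzero_ideals A \<and> (J, I) \<in> class_equiv A"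
    if I: "I \<in> nonzero_ideals A" for I
  proof -
    note id = nonzero_idealsD(1)[OF I]
    obtain x0 where "x0 \<in> I \<and> x0 \<noteq> 0" using nonzero_idealsD(2)[OF I] by blast
    \<comment> \<open>An element of least norm: the Hurwitz bound forces a multiple
      \<open>t * x\<close> of every \<open>x\<close> in \<open>I\<close> into
      \<open>(y)\<close>.\<close>
    then obtain y where y: "y \<in> I" "y \<noteq> 0" and min: "\<And>x. x \<in> I \<Longrightarrow> x \<noteq> 0 \<Longrightarrow> nat \<lfloor>\<nu> y\<rfloor> \<le> nat \<lfloor>\<nu> x\<rfloor>"
      using ex_has_least_nat[of "\<lambda>x. x \<in> I \<and> x \<noteq> 0" x0 "\<lambda>x. nat \<lfloor>\<nu> x\<rfloor>"] by blast
    have yA: "y \<in> A" using idealD(1)[OF id y(1)] .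
    have div: "\<exists>w\<in>A. real M * x = y * w" if x: "x \<in> I" for x
    proof -
      have xA: "x \<in> A" using idealD(1)[OF id x] .
      obtain t w where t: "0 < t" "t \<le> int T" "w \<in> A" "\<nu> (of_int t * x - w * y) < \<nu> y"
        using hur[OF xA yA y(2)] by blast
      have r: "of_int t * x - w * y \<in> I"
        using ideal_diff[OF subring id idealD(4)[OF id A_closed(8) x] idealD(4)[OF id t(3) y(1)]] .
      obtain k1 k2 where k: "\<nu> y = real k1" "\<nu> (of_int t * x - w * y) = real k2"
        using \<nu>_nat[OF yA] \<nu>_nat[OF idealD(1)[OF id r]] by (auto elim!: Nats_cases)
      have "of_int t * x - w * y = 0"
      proof (rule ccontr)
        assume "of_int t * x - w * y \<noteq> 0"
        from min[OF r this] show False using t(4) k by simp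
      qed
      then have tx: "of_int t * x = w * y" by simp
      have "nat t dvd M" unfolding M_def using t by (intro dvd_fact) auto
      then obtain s where "M = nat t * s" by blast
      then have "real M = real s * of_int t" using t(1) by (simp add: mult.commute)
      then have "real M * x = y * (real s * w)" using tx by (simp add: mult_ac)
      then show ?thesis using t(3) A_closed by (intro bexI[of _ "real s * w"]) auto
    qed
    \<comment> \<open>\<open>J\<close> is \<open>(M / y) I\<close>: integral because
      \<open>y\<close> divides \<open>M * x\<close> for all \<open>x\<close> in \<open>I\<close>,
      and containing \<open>M\<close> because \<open>y\<close> lies in \<open>I\<close>.\<close>
    define J where "J = {z \<in> A. y * z \<in> scl (real M) I}"
    have eq: "scl y J = scl (real M) I"
    proof (intro equalityI subsetI)
      fix z assume "z \<in> scl (real M) I"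
      then obtain x where x: "x \<in> I" "z = real M * x" by blast
      then obtain w where "w \<in> A" "z = y * w" using div by blast
      then have "w \<in> J" using x unfolding J_def by blast
      then show "z \<in> scl y J" using \<open>z = y * w\<close> by blast
    qed (auto simp: J_def)
    have idM: "is_ideal A (scl (real M) I)" using ideal_scl'[OF subring id] A_closed by simp
    have idJ: "is_ideal A J"
      unfolding is_ideal_def
    proof (intro conjI ballI)
      show "x + z \<in> J" if "x \<in> J" "z \<in> J" for x z
        using that A_closed(4) idealD(3)[OF idM, of "y * x" "y * z"] unfolding J_def
        by (simp add: distrib_left)
      show "a * x \<in> J" if "a \<in> A" "x \<in> J" for a x
        using that A_closed(5) idealD(4)[OF idM, of a "y * x"] unfolding J_def
        by (simp add: mult.left_commute)
    qed (use A_closed idealD(2)[OF idM] in \<open>auto simp: J_def\<close>)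
    have MJ: "real M \<in> J" using y A_closed by (auto simp: J_def mult.commute)
    then have J: "J \<in> nonzero_ideals A" using idJ M nonzero_idealsI by fastforce
    have "(J, I) \<in> class_equiv A"

      by (rule ideal_equivI[OF J I yA A_closed(9)[of M] y(2) _ TrueI TrueI eq]) (use M in simp)
    then show ?thesis using idJ MJ J by blast
  qed
  have "nonzero_ideals A // class_equiv A \<subseteq> (\<lambda>J. class_equiv A `` {J}) ` {I. is_ideal A I \<and> real M \<in> I}"
  proof
    fix X assume "X \<in> nonzero_ideals A // class_equiv A"
    then obtain I where I: "I \<in> nonzero_ideals A" "X = class_equiv A `` {I}" by (auto elim!: quotientE)
    then obtain J where J: "is_ideal A J" "real M \<in> J" "(J, I) \<in> class_equiv A" using rep by blast
    then have "X = class_equiv A `` {J}" using equiv_class_eq[OF class_equiv_equiv[OF subring]] I(2)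
      by metis
    then show "X \<in> (\<lambda>J. class_equiv A `` {J}) ` {I. is_ideal A I \<and> real M \<in> I}" using J
      by blast
  qed
  then show ?thesis by (rule finite_subset) (rule finite_imageI[OF finitely_many_ideals[OF M]])
qed

end

section \<open>Norms to the integers\<close>

lemma emb_relative_norm:
  assumes n: "n > 0" "even n" and wd: "conj_wd n" "conj_wd (2 * n)" and x: "x \<in> Ocyc (2 * n)" and k: "coprime k n"
  shows "emb n k (x * emb (2 * n) (n + 1) x) = emb (2 * n) k x * emb (2 * n) (k + n) x"
proof -
  have co: "coprime (n + 1) (2 * n)" "coprime k (2 * n)" using n(2) k
    by (simp_all only: coprime_double) simp
  have xR: "x \<in> Rcyc (2 * n)" using x by (rule Ocyc_Rcyc)
  have "emb n k (x * emb (2 * n) (n + 1) x) = emb (2 * n) k (x * emb (2 * n) (n + 1) x)"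
    by (rule emb_double_restrict[OF n(2) wd k Ocyc_Rcyc[OF Ocyc_relative_norm[OF n wd(2) x]], symmetric])
  also have "\<dots> = emb (2 * n) k x * emb (2 * n) k (emb (2 * n) (n + 1) x)"
    by (rule emb_mult[OF wd(2) co(2) xR emb_Rcyc[OF wd(2) co(1) xR]])
  also have "emb (2 * n) k (emb (2 * n) (n + 1) x) = emb (2 * n) (k + n) x"
    by (rule emb_compose_shift[OF n wd(2) k xR])
  finally show ?thesis .
qed

text \<open>The working properties of the absolute norm of degree \<open>d\<close>, which arises by
  composing relative norms up the tower. The bound serves the finiteness argument, positivity the
  separation of narrow classes.\<close>

definition int_norm :: "nat \<Rightarrow> nat \<Rightarrow> (real \<Rightarrow> real) \<Rightarrow> bool" where
  "int_norm n d N \<longleftrightarrow> d > 0 \<and>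
     (\<forall>x\<in>Ocyc n. N x \<in> \<int> \<and> (x \<noteq> 0 \<longrightarrow> N x \<noteq> 0) \<and> (\<exists>y\<in>Ocyc n. x * y = N x)) \<and>
     (\<forall>x\<in>Ocyc n. \<forall>y\<in>Ocyc n. N (x * y) = N x * N y) \<and>
     (\<forall>c :: int. N (of_int c) = of_int c ^ d) \<and>
     (\<forall>x\<in>Ocyc n. \<forall>B. (\<forall>k. coprime k n \<longrightarrow> \<bar>emb n k x\<bar> \<le> B) \<longrightarrow> \<bar>N x\<bar> \<le> B ^ d) \<and>
     (\<forall>x\<in>Ocyc n. tpos n x \<longrightarrow> N x > 0)"

lemma int_normD:
  assumes "int_norm n d N"
  shows "d > 0" "x \<in> Ocyc n \<Longrightarrow> N x \<in> \<int>" "x \<in> Ocyc n \<Longrightarrow> x \<noteq> 0 \<Longrightarrow> N x \<noteq> 0"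
    "x \<in> Ocyc n \<Longrightarrow> \<exists>y\<in>Ocyc n. x * y = N x"
    "x \<in> Ocyc n \<Longrightarrow> y \<in> Ocyc n \<Longrightarrow> N (x * y) = N x * N y"
    "N (of_int c) = of_int c ^ d"
    "x \<in> Ocyc n \<Longrightarrow> (\<And>k. coprime k n \<Longrightarrow> \<bar>emb n k x\<bar> \<le> B) \<Longrightarrow> \<bar>N x\<bar> \<le> B ^ d"
    "x \<in> Ocyc n \<Longrightarrow> tpos n x \<Longrightarrow> N x > 0"
  using assms unfolding int_norm_def by blast+

lemma int_norm_double:
  assumes n: "n > 0" "even n" and wd: "conj_wd n" "conj_wd (2 * n)" and N: "int_norm n d N"
  shows "int_norm (2 * n) (2 * d) (\<lambda>x. N (x * emb (2 * n) (n + 1) x))"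
  unfolding int_norm_def
proof (intro conjI ballI allI impI)
  define \<sigma> where "\<sigma> = emb (2 * n) (n + 1)"
  have co: "coprime (n + 1) (2 * n)" using n(2) by (simp add: coprime_double)
  have \<sigma>O: "\<sigma> x \<in> Ocyc (2 * n)" if "x \<in> Ocyc (2 * n)" for x unfolding \<sigma>_def
    using emb_Ocyc[OF wd(2) co that] .
  have nmO: "x * \<sigma> x \<in> Ocyc n" if "x \<in> Ocyc (2 * n)" for x unfolding \<sigma>_def
    by (rule Ocyc_relative_norm[OF n wd(2) that])
  show "2 * d > 0" using int_normD(1)[OF N] by simp
  fix x assume x: "x \<in> Ocyc (2 * n)"
  note xO = nmO[OF x, unfolded \<sigma>_def]
  show "N (x * emb (2 * n) (n + 1) x) \<in> \<int>" by (rule int_normD(2)[OF N xO])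
  show "N (x * emb (2 * n) (n + 1) x) \<noteq> 0" if "x \<noteq> 0"
    using that emb_eq_0[OF wd(2) co Ocyc_Rcyc[OF x]] by (intro int_normD(3)[OF N xO]) simp
  obtain y where y: "y \<in> Ocyc n" "x * emb (2 * n) (n + 1) x * y = N (x * emb (2 * n) (n + 1) x)"
    using int_normD(4)[OF N xO] by blast
  show "\<exists>y\<in>Ocyc (2 * n). x * y = N (x * emb (2 * n) (n + 1) x)"
  proof
    show "x * (\<sigma> x * y) = N (x * emb (2 * n) (n + 1) x)" using y(2)
      by (simp add: \<sigma>_def mult.assoc)
    show "\<sigma> x * y \<in> Ocyc (2 * n)"
      using \<sigma>O[OF x] Ocyc_double_sub[OF y(1)] subringD(5)[OF subring_Ocyc] by blast
  qed
  show "N (x * y * emb (2 * n) (n + 1) (x * y)) = N (x * emb (2 * n) (n + 1) x) * N (y * emb (2 * n) (n + 1) y)"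
    if y: "y \<in> Ocyc (2 * n)" for y
  proof -
    have "x * y * emb (2 * n) (n + 1) (x * y) = (x * emb (2 * n) (n + 1) x) * (y * emb (2 * n) (n + 1) y)"
      unfolding emb_mult[OF wd(2) co Ocyc_Rcyc[OF x] Ocyc_Rcyc[OF y]] by (simp only: mult_ac)
    then show ?thesis using int_normD(5)[OF N xO nmO[OF y, unfolded \<sigma>_def]] by (simp only:)
  qed
  show "\<bar>N (x * emb (2 * n) (n + 1) x)\<bar> \<le> B ^ (2 * d)"
    if B: "\<forall>k. coprime k (2 * n) \<longrightarrow> \<bar>emb (2 * n) k x\<bar> \<le> B" for B
    unfolding power_mult
  proof (rule int_normD(7)[OF N xO])
    fix k assume k: "coprime k n"
    have "\<bar>emb (2 * n) k x\<bar> \<le> B" "\<bar>emb (2 * n) (k + n) x\<bar> \<le> B"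
      using B coprime_double[OF n(2), of k] coprime_shift[OF n(2) k] k by blast+
    then show "\<bar>emb n k (x * emb (2 * n) (n + 1) x)\<bar> \<le> B ^ 2"
      unfolding emb_relative_norm[OF n wd x k] abs_mult power2_eq_square by (intro mult_mono) auto
  qed
  show "N (x * emb (2 * n) (n + 1) x) > 0" if tp: "tpos (2 * n) x"
  proof (rule int_normD(8)[OF N xO])
    have pos: "emb (2 * n) k x > 0" if "coprime k (2 * n)" for k
      using tp that unfolding tpos_iff[OF wd(2) Ocyc_Rcyc[OF x]] by blast
    show "tpos n (x * emb (2 * n) (n + 1) x)"
      unfolding tpos_iff[OF wd(1) Ocyc_Rcyc[OF xO]]
    proof (intro allI impI)
      fix k assume k: "coprime k n"
      have "emb (2 * n) k x > 0" "emb (2 * n) (k + n) x > 0"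
        using pos coprime_double[OF n(2), of k] coprime_shift[OF n(2) k] k by blast+
      then show "emb n k (x * emb (2 * n) (n + 1) x) > 0" unfolding emb_relative_norm[OF n wd x k] by simp
    qed
  qed
next
  fix c :: int
  have co: "coprime (n + 1) (2 * n)" using n(2) by (simp add: coprime_double)
  have "real_of_int c * emb (2 * n) (n + 1) (of_int c) = of_int (c * c)"
    by (simp only: emb_of_int[OF wd(2) co] of_int_mult)
  then show "N (real_of_int c * emb (2 * n) (n + 1) (of_int c)) = of_int c ^ (2 * d)"
    by (simp only: int_normD(6)[OF N]) (simp add: power_mult power2_eq_square)
qed

lemma int_norm_4: "int_norm 4 1 (\<lambda>x. x)"
  unfolding int_norm_def
proof (intro conjI ballI allI impI)
  fix x assume x: "x \<in> Ocyc 4"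
  show "\<exists>y\<in>Ocyc 4. x * y = x" using subringD(1)[OF subring_Ocyc, of 4]
    by (intro bexI[of _ 1]) auto
  show "\<bar>x\<bar> \<le> B ^ 1"
    if "\<forall>k. coprime k 4 \<longrightarrow> \<bar>emb 4 k x\<bar> \<le> B" for B
    using that emb_4[of 1, OF _ Ocyc_Rcyc[OF x]] coprime_1_left[of 4] by (metis power_one_right)
  show "x > 0" if "tpos 4 x"
    using that emb_4[of 1, OF _ Ocyc_Rcyc[OF x]] coprime_1_left[of 4]
    unfolding tpos_iff[OF conj_wd_4 Ocyc_Rcyc[OF x]] by metis
qed (auto simp: Ocyc_4)

lemma int_norm_12: "int_norm 12 2 (\<lambda>x. x * s12 x)"
proof -
  have N6: "int_norm 6 1 (\<lambda>x. x)"
    unfolding int_norm_def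
  proof (intro conjI ballI allI impI)
    fix x assume x: "x \<in> Ocyc 6"
    have e: "emb 6 1 x = x" using emb_Suc_0[OF conj_wd_6 Ocyc_Rcyc[OF x]] .
    show "\<exists>y\<in>Ocyc 6. x * y = x" using subringD(1)[OF subring_Ocyc, of 6]
      by (intro bexI[of _ 1]) auto
    show "\<bar>x\<bar> \<le> B ^ 1"
      if "\<forall>k. coprime k 6 \<longrightarrow> \<bar>emb 6 k x\<bar> \<le> B" for B
      using that e coprime_1_left[of 6] by (metis power_one_right)
    show "x > 0" if "tpos 6 x"
      using that e coprime_1_left[of 6] unfolding tpos_iff[OF conj_wd_6 Ocyc_Rcyc[OF x]] by metis
  qed (auto simp: Ocyc_6)
  show ?thesis using int_norm_double[OF _ _ conj_wd_6 _ N6] conj_wd_12 by simp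
qed

text \<open>The indices \<open>k\<close> form an infinite set. All conjugates of
  \<open>theta n\<close> lie between -2 and 2, so one bound for the polynomial on this interval
  serves for every \<open>k\<close>.\<close>

lemma emb_bounded:
  assumes "conj_wd n" "x \<in> Ocyc n"
  shows "\<exists>B. \<forall>k. coprime k n \<longrightarrow> \<bar>emb n k x\<bar> \<le> B"
proof -
  have bd: "\<exists>B\<ge>0. \<forall>t. \<bar>t\<bar> \<le> 2 \<longrightarrow> \<bar>ev p t\<bar> \<le> B" for p
  proof (induction p)
    case (pCons a p)
    then obtain B where B: "B \<ge> 0" "\<And>t. \<bar>t\<bar> \<le> 2 \<Longrightarrow> \<bar>ev p t\<bar> \<le> B" by blast
    have "\<bar>ev (pCons a p) t\<bar> \<le> \<bar>of_int a\<bar> + 2 * B" if "\<bar>t\<bar> \<le> 2" for t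
    proof -
      have "\<bar>t * ev p t\<bar> \<le> 2 * B" unfolding abs_mult using B(2)[OF that] that
        by (intro mult_mono) auto
      then show ?thesis unfolding ev_pCons by linarith
    qed
    then show ?case using B(1) by (intro exI[of _ "\<bar>of_int a\<bar> + 2 * B"]) auto
  qed auto
  obtain p where p: "x = ev p (theta n)" using assms(2) by (auto simp: Ocyc_iff)
  have "\<bar>theta_conj n k\<bar> \<le> 2" for k
    using abs_cos_le_one[of "2 * pi * real k / real n"] by (simp add: theta_conj_def abs_mult)
  then show ?thesis using bd[of p] emb_ev'[OF assms(1)] unfolding p by metis
qed

lemma Ocyc_span_double:
  assumes n: "n > 0" "even n" and wd: "conj_wd (2 * n)"
    and b: "\<forall>j<D. b j \<in> Ocyc n" "\<forall>x\<in>Ocyc n. \<exists>c :: nat \<Rightarrow> int. x = (\<Sum>j<D. of_int (c j) * b j)"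
  shows "\<exists>D b. (\<forall>j<D. b j \<in> Ocyc (2 * n)) \<and> (\<forall>x\<in>Ocyc (2 * n). \<exists>c :: nat \<Rightarrow> int. x = (\<Sum>j<D. of_int (c j) * b j))"
proof (intro exI[of _ "D + D"] exI[of _ "\<lambda>j. if j < D then b j else theta (2 * n) * b (j - D)"] conjI allI ballI impI)
  fix j assume "j < D + D"
  then show "(if j < D then b j else theta (2 * n) * b (j - D)) \<in> Ocyc (2 * n)"
    using b(1) Ocyc_double_sub subringD(5)[OF subring_Ocyc theta_Ocyc] by auto
next
  fix x assume x: "x \<in> Ocyc (2 * n)"
  obtain y z where yz: "y \<in> Ocyc n" "z \<in> Ocyc n" "x = y + theta (2 * n) * z"
    using Rcyc_double[OF n wd Ocyc_Rcyc[OF x]] x by metis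
  obtain c d :: "nat \<Rightarrow> int" where c: "y = (\<Sum>j<D. of_int (c j) * b j)" and d: "z = (\<Sum>j<D. of_int (d j) * b j)"
    using b(2) yz(1,2) by blast
  have split: "(\<Sum>j<D + E. f j) = (\<Sum>j<D. f j) + (\<Sum>j<E. f (D + j))" for f :: "nat \<Rightarrow> real" and E
    by (induction E) (simp_all add: add.assoc)
  show "\<exists>c :: nat \<Rightarrow> int. x = (\<Sum>j<D + D. of_int (c j) * (if j < D then b j else theta (2 * n) * b (j - D)))"
    by (rule exI[of _ "\<lambda>j. if j < D then c j else d (j - D)"])
      (simp add: split yz(3) c d sum_distrib_left mult.left_commute)
qed

lemma finite_class_group_Ocyc:
  assumes wd: "conj_wd n" and N: "int_norm n d N"
    and b: "\<forall>j<D. b j \<in> Ocyc n" "\<forall>x\<in>Ocyc n. \<exists>c :: nat \<Rightarrow> int. x = (\<Sum>j<D. of_int (c j) * b j)"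
  shows "finite (nonzero_ideals (Ocyc n) // class_equiv (Ocyc n))"
proof -
  note O = subringD[OF subring_Ocyc[of n]]
  have "\<forall>j. \<exists>B. j < D \<longrightarrow> (\<forall>k. coprime k n \<longrightarrow> \<bar>emb n k (b j)\<bar> \<le> B)"
    using emb_bounded[OF wd] b(1) by blast
  then obtain B where B: "\<And>j k. j < D \<Longrightarrow> coprime k n \<Longrightarrow> \<bar>emb n k (b j)\<bar> \<le> B j" by metis
  \<comment> \<open>By the triangle inequality, \<open>C * e\<close> bounds all conjugates of a
    combination with coefficients at most \<open>e\<close>.\<close>
  define C where "C = (\<Sum>j<D. \<bar>B j\<bar>)"
  interpret normed_order "Ocyc n" b D d "\<lambda>x. \<bar>N x\<bar>" C
  proof
    show "subring (Ocyc n)" by (rule subring_Ocyc)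
    show "d > 0" by (rule int_normD(1)[OF N])
    show "C \<ge> 0" unfolding C_def by (intro sum_nonneg) simp
    show "b j \<in> Ocyc n" if "j < D" for j using b(1) that by blast
    show "\<exists>c. x = (\<Sum>j<D. of_int (c j) * b j)" if "x \<in> Ocyc n" for x using b(2) that
      by blast
    fix x assume x: "x \<in> Ocyc n"
    show "\<bar>N x\<bar> \<in> \<nat>"
    proof -
      obtain c where "N x = of_int c" using int_normD(2)[OF N x] by (elim Ints_cases)
      then have "\<bar>N x\<bar> = of_nat (nat \<bar>c\<bar>)" by simp
      then show ?thesis by (simp only: of_nat_in_Nats)
    qed
    show "\<bar>N x\<bar> = 0 \<longleftrightarrow> x = 0"
      using int_normD(3)[OF N x] int_normD(6)[OF N, of 0] int_normD(1)[OF N] by auto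
    show "\<bar>N (x * y)\<bar> = \<bar>N x\<bar> * \<bar>N y\<bar>" if "y \<in> Ocyc n" for y
      using int_normD(5)[OF N x that] by (simp add: abs_mult)
    show "\<exists>y\<in>Ocyc n. \<exists>c. c \<noteq> 0 \<and> x * y = of_int c" if "x \<noteq> 0"
    proof -
      obtain c where "N x = of_int c" using int_normD(2)[OF N x] by (elim Ints_cases)
      then show ?thesis using int_normD(3,4)[OF N x] that by auto
    qed
  next
    show "\<bar>N (of_int c)\<bar> = \<bar>of_int c\<bar> ^ d" for c
      by (simp only: int_normD(6)[OF N] power_abs)
    fix c :: "nat \<Rightarrow> int" and e :: real
    assume c: "\<And>j. j < D \<Longrightarrow> \<bar>of_int (c j)\<bar> \<le> e"
    show "\<bar>N (\<Sum>j<D. of_int (c j) * b j)\<bar> \<le> (C * e) ^ d"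
    proof (rule int_normD(7)[OF N])
      show "(\<Sum>j<D. of_int (c j) * b j) \<in> Ocyc n" using b(1) O
        by (intro subring_sum[OF subring_Ocyc]) auto
      fix k assume k: "coprime k n"
      have bR: "of_int (c j) * b j \<in> Rcyc n" if "j < D" for j using b(1) that O Ocyc_Rcyc by simp
      have hom: "emb n k (\<Sum>j<E. of_int (c j) * b j) = (\<Sum>j<E. of_int (c j) * emb n k (b j))"
        if "E \<le> D" for E
        using that
      proof (induction E)
        case (Suc E)
        have "(\<Sum>j<E. of_int (c j) * b j) \<in> Rcyc n" using Suc.prems bR
          by (intro subring_sum[OF subring_Rcyc]) auto
        moreover have "b E \<in> Rcyc n" "of_int (c E) \<in> Rcyc n" using b(1) Suc.prems Ocyc_Rcyc O(8)
          by auto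
        ultimately show ?case using Suc bR[of E]
          by (simp add: emb_add[OF wd k] emb_mult[OF wd k] emb_of_int[OF wd k])
      qed (simp add: emb_0[OF wd k])
      have "\<bar>emb n k (\<Sum>j<D. of_int (c j) * b j)\<bar> \<le> (\<Sum>j<D. \<bar>of_int (c j) * emb n k (b j)\<bar>)"
        unfolding hom[OF order_refl] by (rule sum_abs)
      also have "\<dots> \<le> (\<Sum>j<D. e * \<bar>B j\<bar>)"
      proof (rule sum_mono)
        fix j assume "j \<in> {..<D}"
        then show "\<bar>of_int (c j) * emb n k (b j)\<bar> \<le> e * \<bar>B j\<bar>"
          unfolding abs_mult using c[of j] B[of j k] k by (intro mult_mono) auto
      qed
      also have "\<dots> = C * e" by (simp add: C_def sum_distrib_left mult.commute)
      finally show "\<bar>emb n k (\<Sum>j<D. of_int (c j) * b j)\<bar> \<le> C * e" .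
    qed
  qed
  show ?thesis by (rule finite_class_group)
qed

section \<open>The prime above 2 along the towers\<close>

definition above_2 :: "real set \<Rightarrow> real \<Rightarrow> bool" where
  "above_2 A l \<longleftrightarrow> (\<exists>y\<in>A. 2 = l * y) \<and> (\<exists>M. \<exists>y\<in>A. l ^ M = 2 * y)"

text \<open>As \<open>2 = l * y\<close>, the element \<open>2 * s \<plusminus> l\<close> is a
  multiple of \<open>l\<close>. So \<open>l\<close> divides \<open>l' ^ 2\<close>, and 2 divides a
  power of \<open>l'\<close> because it divides one of \<open>l\<close>.\<close>

lemma above_2_step:
  assumes B: "subring B" and AB: "\<And>x. x \<in> A \<Longrightarrow> x \<in> B" and l: "above_2 A l" "l \<in> A"
    and "l' \<in> B" "w \<in> B" "s \<in> B" "l = l' * w" "l' ^ 2 = 2 * s + l \<or> l' ^ 2 = 2 * s - l"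
  shows "above_2 B l'"
proof -
  note R = subringD[OF B]
  obtain y M z where y: "y \<in> A" "2 = l * y" and z: "z \<in> A" "l ^ M = 2 * z" using l(1)
    unfolding above_2_def by blast
  have "2 = l' * (w * y)" using y(2) assms(8) by (simp add: mult.assoc)
  moreover have "w * y \<in> B" using assms(6) AB[OF y(1)] R by simp
  moreover have "\<exists>t\<in>B. l' ^ 2 = l * t"
  proof -
    have "l' ^ 2 = l * (y * s + 1) \<or> l' ^ 2 = l * (y * s - 1)"
      using assms(9) y(2) by (auto simp: algebra_simps)
    moreover have "y * s + 1 \<in> B" "y * s - 1 \<in> B" using assms(7) AB[OF y(1)] R by simp_all
    ultimately show ?thesis by blast
  qed
  then obtain t where t: "t \<in> B" "l' ^ 2 = l * t" by blast
  have "l' ^ (2 * M) = 2 * (z * t ^ M)" by (simp add: power_mult t(2) power_mult_distrib z(2))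
  moreover have "z * t ^ M \<in> B" using t(1) AB[OF z(1)] R by simp
  ultimately show ?thesis unfolding above_2_def by blast
qed

text \<open>Beyond \<open>above_2\<close>, everything comes from the norm of \<open>l\<close> being
  2 or -2 and from \<open>theta n\<close> being an integer modulo \<open>l\<close>: 2 is no unit of
  the integers, a nonzero multiple of \<open>l ^ e\<close> has norm at least \<open>2 ^ e\<close> in
  absolute value, and polynomials in \<open>theta n\<close> reduce to integers.\<close>

lemma prime_over_2_Ocyc:
  assumes N: "int_norm n d N" "\<bar>N l\<bar> = 2" and l: "l \<in> Ocyc n" "above_2 (Ocyc n) l"
    and th: "theta n = of_int c + l * w" "w \<in> Ocyc n"
  shows "prime_over_2 (Ocyc n) l"
proof
  note O = subringD[OF subring_Ocyc[of n]]
  show "subring (Ocyc n)" by (rule subring_Ocyc)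
  show "l \<in> Ocyc n" by (rule l(1))
  show l0: "l \<noteq> 0" using N(2) int_normD(6)[OF N(1), of 0] int_normD(1)[OF N(1)]
    by (intro notI) (simp add: zero_power)
  show "\<exists>y\<in>Ocyc n. 2 = l * y" "\<exists>M. \<exists>y\<in>Ocyc n. l ^ M = 2 * y" using l(2)
    by (auto simp: above_2_def)
  show "\<exists>m. \<exists>y\<in>Ocyc n. x = of_int m + l * y" if "x \<in> Ocyc n" for x
  proof -
    have "\<exists>m. \<exists>y\<in>Ocyc n. ev p (theta n) = of_int m + l * y" for p
    proof (induction p)
      case 0 show ?case using O(2) by (intro exI[of _ 0] bexI[of _ 0]) auto
    next
      case (pCons a p)
      then obtain m y where y: "y \<in> Ocyc n" "ev p (theta n) = of_int m + l * y" by blast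
      have "ev (pCons a p) (theta n) = of_int a + theta n * (of_int m + l * y)"
        by (simp only: ev_pCons y(2))
      also have "\<dots> = of_int (a + c * m) + l * (of_int c * y + w * of_int m + l * w * y)"
        unfolding th(1) by (simp add: algebra_simps)
      finally have "ev (pCons a p) (theta n) = of_int (a + c * m) + l * (of_int c * y + w * of_int m + l * w * y)" .
      moreover have "of_int c * y + w * of_int m + l * w * y \<in> Ocyc n" using y(1) th(2) l(1) O by simp
      ultimately show ?case by blast
    qed
    then show ?thesis using that by (auto simp: Ocyc_iff[of x])
  qed
  show "1 / l \<notin> Ocyc n"
  proof
    assume il: "1 / l \<in> Ocyc n"
    have "N l * N (1 / l) = 1" using int_normD(5)[OF N(1) l(1) il] int_normD(6)[OF N(1), of 1] l0 by simp
    moreover obtain k where "N (1 / l) = of_int k" using int_normD(2)[OF N(1) il] by (elim Ints_cases)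
    moreover have "N l = 2 \<or> N l = - 2" using N(2) by linarith
    ultimately have "real_of_int (2 * k) = real_of_int 1 \<or> real_of_int (2 * k) = real_of_int (- 1)"
      by auto
    then have "2 * k = 1 \<or> 2 * k = - 1" unfolding of_int_eq_iff .
    then show False by presburger
  qed
  show "\<exists>e. \<forall>y\<in>Ocyc n. x \<noteq> l ^ e * y" if x: "x \<in> Ocyc n" "x \<noteq> 0" for x
  proof -
    obtain e :: nat where e: "\<bar>N x\<bar> < real e" using reals_Archimedean2 by blast
    have "x \<noteq> l ^ e * y" if y: "y \<in> Ocyc n" for y
    proof
      assume eq: "x = l ^ e * y"
      have pw: "N (l ^ i) = N l ^ i" for i
        using int_normD(6)[OF N(1), of 1] int_normD(5)[OF N(1) l(1) O(7)[OF l(1)]] by (induction i) simp_all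
      have "\<bar>N x\<bar> = 2 ^ e * \<bar>N y\<bar>"
        using int_normD(5)[OF N(1) O(7)[OF l(1)] y] by (simp add: eq pw abs_mult power_abs N(2))
      moreover have "\<bar>N y\<bar> \<ge> 1"
      proof -
        have "y \<noteq> 0" using eq x(2) by auto
        then show ?thesis using int_normD(2,3)[OF N(1) y]
          by (auto elim!: Ints_cases simp: Ints_nonzero_abs_ge1)
      qed
      moreover have "real e < 2 ^ e" by (rule of_nat_less_two_power)
      moreover have "2 ^ e * 1 \<le> 2 ^ e * \<bar>N y\<bar>" if "\<bar>N y\<bar> \<ge> 1" using that
        by (rule mult_left_mono) simp
      ultimately show False using e by linarith
    qed
    then show ?thesis by blast
  qed
qed

section \<open>Main result\<close>

text \<open>Cancels \<open>I\<close> by comparing the valuation at \<open>l\<close> of a suitable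
  element, since invertibility of ideals is available only after 2 is inverted.\<close>

lemma (in prime_over_2) scl_power_eq:
  assumes I: "I \<in> nonzero_ideals A" and eq: "scl (l ^ i) I = scl (l ^ j) I"
  shows "i = j"
proof -
  obtain e J x where J: "is_ideal A J" "I = scl (l ^ e) J" "x \<in> J" "\<not> dv x"
    using ideal_factor[OF I] .
  have "scl (l ^ e) (scl (l ^ i) J) = scl (l ^ e) (scl (l ^ j) J)"
    using eq unfolding J(2) by (simp only: scl_scl mult.commute[of "l ^ i" "l ^ e"] mult.commute[of "l ^ j" "l ^ e"])
  then have eqJ: "scl (l ^ i) J = scl (l ^ j) J" by (rule scl_cancel[rotated]) (simp add: l_0)
  have *: "\<not> i < j" if eq: "scl (l ^ i) J = scl (l ^ j) J" for i j
  proof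
    assume "i < j"
    have "l ^ i * x \<in> scl (l ^ j) J" using J(3) unfolding eq[symmetric] by (rule imageI)
    then obtain y where y: "y \<in> J" "l ^ i * x = l ^ j * y" by blast
    have "l ^ j = l ^ i * (l * l ^ (j - Suc i))" using \<open>i < j\<close>
      by (simp flip: power_Suc power_add)
    then have "x = l * (l ^ (j - Suc i) * y)" using y(2) l_0 by simp
    moreover have "l ^ (j - Suc i) * y \<in> A" using idealD(1)[OF J(1) y(1)] A_closed l_A by simp
    ultimately show False using J(4) unfolding dv_def by blast
  qed
  from *[OF eqJ] *[OF eqJ[symmetric]] show ?thesis by simp
qed

lemma emb_double_ev:
  assumes "n > 0" "even n" "conj_wd (2 * n)"
  shows "emb (2 * n) (n + 1) (ev p (theta (2 * n))) = ev p (- theta (2 * n))"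
proof -
  have "coprime (n + 1) (2 * n)" using assms(2) by (simp add: coprime_double)
  from emb_ev'[OF assms(3) this, of p] show ?thesis using theta_conj_shift[OF assms(1), of 1]
    by (simp add: add.commute)
qed

section \<open>The two towers\<close>

definition spanned :: "nat \<Rightarrow> bool" where
  "spanned n \<longleftrightarrow> (\<exists>D b. (\<forall>j<D. b j \<in> Ocyc n) \<and>
     (\<forall>x\<in>Ocyc n. \<exists>c :: nat \<Rightarrow> int. x = (\<Sum>j<D::nat. of_int (c j) * b j)))"

lemma spanned_double: "n > 0 \<Longrightarrow> even n \<Longrightarrow> conj_wd (2 * n) \<Longrightarrow> spanned n \<Longrightarrow> spanned (2 * n)"
  unfolding spanned_def using Ocyc_span_double by blast

text \<open>At each step \<open>(2 - theta (2 * m)) * (2 + theta (2 * m)) = 2 - theta m\<close>, so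
  relative norms carry each generator above 2 to the one below, down to 2 itself at level 4.\<close>

lemma tower_4:
  defines "n \<equiv> \<lambda>i. 4 * 2 ^ i"
  shows "conj_wd (n i) \<and> nonsquare_step (n i) \<and> level_good Q4 (n i) \<and> spanned (n i) \<and>
    above_2 (Ocyc (n i)) (2 - theta (n i)) \<and> (\<exists>d N. int_norm (n i) d N \<and> N (2 - theta (n i)) = 2)"
proof (induction i)
  case 0
  have "spanned 4" unfolding spanned_def
    by (rule exI[of _ 1], rule exI[of _ "\<lambda>_. 1"]) (auto simp: Ocyc_4 elim!: Ints_cases)
  moreover have "above_2 (Ocyc 4) (2 - theta 4)"
    unfolding above_2_def theta_4 Ocyc_4 by (auto intro!: bexI[of _ 1] exI[of _ 1])
  moreover have "\<exists>d N. int_norm 4 d N \<and> N (2 - theta 4) = 2"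
    using int_norm_4 theta_4 by (intro exI[of _ 1] exI[of _ "\<lambda>x. x"]) simp
  ultimately show ?case using conj_wd_4 nonsquare_step_4 level_good_4 by (simp add: n_def)
next
  case (Suc i)
  define m where "m = n i"
  have m: "m > 0" "4 dvd m" "even m" "n (Suc i) = 2 * m" by (simp_all add: m_def n_def)
  note IH = Suc.IH[folded m_def]
  have wd: "conj_wd (2 * m)" using conj_wd_double m IH by blast
  let ?t = "theta (2 * m)"
  note O = subringD[OF subring_Ocyc[of "2 * m"]]
  have tt: "?t * ?t = 2 + theta m" using theta_double[of m] by (simp add: power2_eq_square)
  have "level_good Q4 (2 * m)"
    using level_good_double[OF m(1,2) _ wd norm_coherent_Q4] IH by (simp add: Q4_def)
  moreover have "above_2 (Ocyc (2 * m)) (2 - ?t)"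
  proof (rule above_2_step[OF subring_Ocyc Ocyc_double_sub])
    show "above_2 (Ocyc m) (2 - theta m)" using IH by blast
    show "2 - theta m = (2 - ?t) * (2 + ?t)" using tt by (simp add: algebra_simps)
    show "(2 - ?t) ^ 2 = 2 * (2 * (2 - ?t)) + (2 - theta m) \<or> (2 - ?t) ^ 2 = 2 * (2 * (2 - ?t)) - (2 - theta m)"
      using tt by (simp add: algebra_simps power2_eq_square)
    show "2 - theta m \<in> Ocyc m" using theta_Ocyc subringD[OF subring_Ocyc] by simp
  qed (use theta_Ocyc O in simp_all)
  moreover have "\<exists>d N. int_norm (2 * m) d N \<and> N (2 - ?t) = 2"
  proof -
    obtain d N where N: "int_norm m d N" "N (2 - theta m) = 2" using IH by blast
    have "emb (2 * m) (m + 1) (2 - ?t) = 2 + ?t"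
      using emb_double_ev[OF m(1,3) wd, of "[:2, - 1:]"] by (simp add: ev_pCons)
    then have "(2 - ?t) * emb (2 * m) (m + 1) (2 - ?t) = 2 - theta m"
      by (simp only:) (use tt in \<open>simp add: algebra_simps\<close>)
    then show ?thesis using int_norm_double[OF m(1,3) _ wd N(1)] IH N(2) by metis
  qed
  ultimately show ?case unfolding m(4) using IH wd spanned_double nonsquare_step_double m by blast
qed

lemma unit_relative_norm:
  assumes n: "n > 0" "even n" and wd: "conj_wd (2 * n)" and u: "u \<in> units_of_ring (Ocyc (2 * n))"
  shows "u * emb (2 * n) (n + 1) u \<in> units_of_ring (Ocyc n)"
proof -
  have co: "coprime (n + 1) (2 * n)" using n(2) by (simp add: coprime_double)
  have u': "u \<in> Ocyc (2 * n)" "1 / u \<in> Ocyc (2 * n)" "u \<noteq> 0" using u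
    by (auto simp: units_iff)
  have "emb (2 * n) (n + 1) u * emb (2 * n) (n + 1) (1 / u) = 1"
    using emb_mult[OF wd co Ocyc_Rcyc[OF u'(1)] Ocyc_Rcyc[OF u'(2)]] u'(3) emb_1[OF wd co] by simp
  then have "(u * emb (2 * n) (n + 1) u) * (1 / u * emb (2 * n) (n + 1) (1 / u)) = 1" using u'(3) by simp
  then show ?thesis
    using units_mult_cancel[OF subring_Ocyc _ Ocyc_relative_norm[OF n wd u'(1)] Ocyc_relative_norm[OF n wd u'(2)]]
      units_1[OF subring_Ocyc] by metis
qed

text \<open>The norm is a unit of the integers, and \<open>norm12_sign\<close> excludes -1.\<close>

lemma norm12_unit:
  assumes u: "u \<in> units_of_ring (Ocyc 12)" shows "u * s12 u = 1"
proof -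
  have "u * s12 u \<in> units_of_ring (Ocyc 6)" using unit_relative_norm[of 6 u] conj_wd_12 u by simp
  then have ints: "u * s12 u \<in> \<int>" "1 / (u * s12 u) \<in> \<int>" "u * s12 u \<noteq> 0"
    unfolding units_iff Ocyc_6 by blast+
  obtain c where c: "u * s12 u = of_int c" using ints(1) by (rule Ints_cases)
  obtain d where d: "1 / of_int c = real_of_int d" using ints(2) unfolding c by (rule Ints_cases)
  have "real_of_int c \<noteq> 0" using ints(3) unfolding c .
  then have "real_of_int (c * d) = 1" by (simp flip: d)
  then have "c * d = 1" by (simp only: of_int_eq_1_iff)
  then have "c = 1 \<or> c = - 1" using zmult_eq_1_iff by auto
  moreover obtain a b where ab: "u = of_int a + of_int b * r3" using u by (auto simp: units_iff Ocyc_12)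
  have "u * s12 u = of_int (a ^ 2 - 3 * b ^ 2)" unfolding ab s12_eq by (rule norm12_eq)
  then have "c = a ^ 2 - 3 * b ^ 2" unfolding c of_int_eq_iff .
  ultimately show ?thesis using norm12_sign[of a b] c by auto
qed

text \<open>Here \<open>1 + theta (2 * m)\<close> has relative norm \<open>- (1 + theta m)\<close>.
  The sign disappears in the norm from level \<open>m\<close> because its degree is even, so the
  absolute norm stays -2, while that of units stays 1.\<close>

lemma tower_12:
  defines "n \<equiv> \<lambda>i. 12 * 2 ^ i"
  shows "conj_wd (n i) \<and> nonsquare_step (n i) \<and> level_good Q12 (n i) \<and> spanned (n i) \<and>
    above_2 (Ocyc (n i)) (1 + theta (n i)) \<and>
    (\<exists>d N. int_norm (n i) d N \<and> even d \<and> N (1 + theta (n i)) = - 2 \<and> (\<forall>u\<in>units_of_ring (Ocyc (n i)). N u = 1))"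
proof (induction i)
  case 0
  have "spanned 6" unfolding spanned_def
    by (rule exI[of _ 1], rule exI[of _ "\<lambda>_. 1"]) (auto simp: Ocyc_6 elim!: Ints_cases)
  then have "spanned 12" using spanned_double[of 6] conj_wd_12 by simp
  moreover have "above_2 (Ocyc 12) (1 + r3)"
    unfolding above_2_def
  proof
    note O = subringD[OF subring_Ocyc[of 12]]
    have "2 = (1 + r3) * (r3 - 1)" using r3_sq by (simp add: algebra_simps)
    then show "\<exists>y\<in>Ocyc 12. 2 = (1 + r3) * y" using theta_Ocyc[of 12] O(6)[OF theta_Ocyc O(1)]
      by blast
    have "(1 + r3) ^ 2 = 2 * (2 + r3)" using r3_sq by (simp add: power2_eq_square algebra_simps)
    then show "\<exists>M. \<exists>y\<in>Ocyc 12. (1 + r3) ^ M = 2 * y" using O(4)[OF O(10) theta_Ocyc]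
      by blast
  qed
  moreover have "\<exists>d N. int_norm 12 d N \<and> even d \<and> N (1 + r3) = - 2 \<and> (\<forall>u\<in>units_of_ring (Ocyc 12). N u = 1)"
  proof (intro exI conjI)
    show "(1 + r3) * s12 (1 + r3) = - 2" using r3_sq by (simp add: s12_1_plus algebra_simps)
  qed (use int_norm_12 norm12_unit in auto)
  ultimately show ?case using conj_wd_12 nonsquare_step_12 level_good_12 by (simp add: n_def)
next
  case (Suc i)
  define m where "m = n i"
  have m: "m > 0" "4 dvd m" "even m" "n (Suc i) = 2 * m" by (simp_all add: m_def n_def)
  note IH = Suc.IH[folded m_def]
  have wd: "conj_wd (2 * m)" using conj_wd_double m IH by blast
  let ?t = "theta (2 * m)"
  note O = subringD[OF subring_Ocyc[of "2 * m"]]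
  have tt: "?t * ?t = 2 + theta m" using theta_double[of m] by (simp add: power2_eq_square)
  have "level_good Q12 (2 * m)"
    using level_good_double[OF m(1,2) _ wd norm_coherent_Q12] IH by (simp add: Q12_def)
  moreover have "above_2 (Ocyc (2 * m)) (1 + ?t)"
  proof (rule above_2_step[OF subring_Ocyc Ocyc_double_sub])
    show "above_2 (Ocyc m) (1 + theta m)" using IH by blast
    show "1 + theta m = (1 + ?t) * (?t - 1)" using tt by (simp add: algebra_simps)
    show "(1 + ?t) ^ 2 = 2 * (1 + ?t) + (1 + theta m) \<or> (1 + ?t) ^ 2 = 2 * (1 + ?t) - (1 + theta m)"
      using tt by (simp add: algebra_simps power2_eq_square)
    show "1 + theta m \<in> Ocyc m" using theta_Ocyc subringD[OF subring_Ocyc] by simp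
  qed (use theta_Ocyc O in simp_all)
  moreover have "\<exists>d N. int_norm (2 * m) d N \<and> even d \<and> N (1 + ?t) = - 2 \<and> (\<forall>u\<in>units_of_ring (Ocyc (2 * m)). N u = 1)"
  proof -
    obtain d N where N: "int_norm m d N" "even d" "N (1 + theta m) = - 2" "\<forall>u\<in>units_of_ring (Ocyc m). N u = 1"
      using IH by blast
    have "emb (2 * m) (m + 1) (1 + ?t) = 1 - ?t"
      using emb_double_ev[OF m(1,3) wd, of "[:1, 1:]"] by (simp add: ev_pCons)
    then have eq: "(1 + ?t) * emb (2 * m) (m + 1) (1 + ?t) = of_int (- 1) * (1 + theta m)"
      by (simp only:) (use tt in \<open>simp add: algebra_simps\<close>)
    have "1 + theta m \<in> Ocyc m" using theta_Ocyc subringD[OF subring_Ocyc] by simp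
    then have "N ((1 + ?t) * emb (2 * m) (m + 1) (1 + ?t)) = of_int (- 1) ^ d * N (1 + theta m)"
      unfolding eq int_normD(5)[OF N(1) subringD(8)[OF subring_Ocyc] \<open>1 + theta m \<in> Ocyc m\<close>] int_normD(6)[OF N(1)] by simp
    then have "N ((1 + ?t) * emb (2 * m) (m + 1) (1 + ?t)) = - 2" using N(2,3) by simp
    moreover have "int_norm (2 * m) (2 * d) (\<lambda>x. N (x * emb (2 * m) (m + 1) x))"
      using IH by (intro int_norm_double[OF m(1,3) _ wd N(1)]) simp
    moreover have "\<forall>u\<in>units_of_ring (Ocyc (2 * m)). N (u * emb (2 * m) (m + 1) u) = 1"
      using N(4) unit_relative_norm[OF m(1,3) wd] by blast
    ultimately show ?thesis by (intro exI[of _ "2 * d"] exI[of _ "\<lambda>x. N (x * emb (2 * m) (m + 1) x)"]) simp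
  qed
  ultimately show ?case unfolding m(4) using IH wd spanned_double nonsquare_step_double m by blast
qed

text \<open>Multiply \<open>scl a I = scl b J\<close> by \<open>a\<close> and insert a unit
  \<open>u\<close> that makes \<open>u * (a * b)\<close> totally positive; the factors become
  \<open>a * a\<close> and \<open>u * (a * b)\<close>.\<close>

lemma narrow_equiv_eq:
  assumes wd: "conj_wd n" and A: "subring A" and sub: "A \<subseteq> Rcyc n"
    and sg: "\<And>x. x \<in> A \<Longrightarrow> x \<noteq> 0 \<Longrightarrow> \<exists>u\<in>units_of_ring A. tpos n (u * x)"
  shows "ideal_equiv A (tpos n) = class_equiv A"
proof (intro equalityI subrelI)
  fix I J assume "(I, J) \<in> class_equiv A"
  then obtain a b where ab: "I \<in> nonzero_ideals A" "J \<in> nonzero_ideals A"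
    "a \<in> A" "b \<in> A" "a \<noteq> 0" "b \<noteq> 0" "scl a I = scl b J" by (rule ideal_equivE)
  note R = subringD[OF A]
  obtain u where u: "u \<in> units_of_ring A" "tpos n (u * (a * b))" using sg[OF R(5)[OF ab(3,4)]] ab
    by auto
  have uA: "u \<in> A" "u \<noteq> 0" using u by (auto simp: units_iff)
  have "scl (a * a) I = scl a (scl b J)" by (simp only: scl_scl[symmetric] ab(7))
  also have "\<dots> = scl (a * b) (scl u J)"
    by (simp only: scl_scl[symmetric] scl_unit[OF A nonzero_idealsD(1)[OF ab(2)] u(1)])
  also have "\<dots> = scl (u * (a * b)) J" by (simp only: scl_scl mult.commute[of "a * b" u])
  finally have eq: "scl (a * a) I = scl (u * (a * b)) J" .
  have tp: "tpos n (a * a)" using tpos_square[OF wd _ ab(5)] ab(3) sub by (auto simp: power2_eq_square)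
  have nz: "a * a \<noteq> 0" "u * (a * b) \<noteq> 0" using ab(5,6) uA(2) by simp_all
  show "(I, J) \<in> ideal_equiv A (tpos n)"
    by (rule ideal_equivI[OF ab(1,2) R(5)[OF ab(3,3)] R(5)[OF uA(1) R(5)[OF ab(3,4)]] nz tp u(2) eq])
next
  fix I J assume "(I, J) \<in> ideal_equiv A (tpos n)"
  then obtain a b where ab: "I \<in> nonzero_ideals A" "J \<in> nonzero_ideals A"
    "a \<in> A" "b \<in> A" "a \<noteq> 0" "b \<noteq> 0" "scl a I = scl b J" by (rule ideal_equivE)
  show "(I, J) \<in> class_equiv A" by (rule ideal_equivI[OF ab(1-6) TrueI TrueI ab(7)])
qed

text \<open>Clear denominators and apply the conjugation negating \<open>theta n\<close>: a root
  would make \<open>2 + theta n\<close> a square up to the square of an integer, against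
  \<open>nonsquare_step\<close>.\<close>

lemma two_minus_theta_nonsquare:
  assumes n: "4 dvd n" "n > 0" and wd: "conj_wd n" and ns: "nonsquare_step n" and v: "v \<in> Rcyc n"
  shows "2 - theta n \<noteq> v ^ 2"
proof
  assume eq: "2 - theta n = v ^ 2"
  obtain m where m: "n = 2 * m" "even m" "m > 0" using n by (auto elim!: dvdE)
  have co: "coprime (m + 1) n" using m by (simp add: coprime_double)
  obtain y k where y: "v = y / 2 ^ k" "y \<in> Ocyc n" using v by (auto simp: Rcyc_eq loc2_def)
  have "y ^ 2 = (2 - theta n) * (2 ^ k) ^ 2" unfolding eq y(1) by (simp add: power_divide)
  then have "emb n (m + 1) (y ^ 2) = emb n (m + 1) ((2 - theta n) * of_int (2 ^ k) ^ 2)" by simp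
  moreover have "emb n (m + 1) (theta n) = - theta n"
    unfolding emb_theta[OF wd co] using theta_conj_shift[OF m(3), of 1] by (simp add: m(1))
  ultimately have "emb n (m + 1) y ^ 2 = (2 + theta n) * of_int (2 ^ k) ^ 2"
    using Ocyc_Rcyc[OF y(2)] Ocyc_Rcyc[OF theta_Ocyc[of n]] subringD[OF subring_Rcyc[of n]]
    by (simp add: emb_power[OF wd co] emb_mult[OF wd co] emb_diff[OF wd co] emb_of_int[OF wd co] emb_numeral[OF wd co]
        del: One_nat_def of_int_power of_int_numeral)
  then have "(of_int (2 ^ k) :: real) = 0"
    using ns emb_Ocyc[OF wd co y(2)] subringD(8)[OF subring_Ocyc] unfolding nonsquare_step_def by blast
  then show False by simp
qed

text \<open>\<open>level_good\<close> leaves the classes of 1 and \<open>2 - theta n\<close>, and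
  these differ because \<open>2 - theta n\<close> is not a square.\<close>

lemma tpos_units_card:
  assumes n: "4 dvd n" "n > 0" and wd: "conj_wd n" and ns: "nonsquare_step n"
    and good: "level_good Q n" and Q: "[:2, - 1:] \<in> Q"
  shows "tpos_units_mod_squares_card n (Rcyc n) = 2"
proof -
  let ?U = "units_of_ring (Rcyc n)" and ?T = "tpos_units n (Rcyc n)"
  define E where "E = {(x, y). x \<in> ?T \<and> y \<in> ?T \<and> (\<exists>v\<in>?U. x = y * v ^ 2)}"
  let ?p = "2 - theta n"
  have T: "x \<in> ?T \<longleftrightarrow> x \<in> ?U \<and> tpos n x" for x by (simp add: tpos_units_def)
  have one: "1 \<in> ?T" using units_1[OF subring_Rcyc] tpos_square[OF wd subringD(1)[OF subring_Rcyc]]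
    by (simp add: T)
  have "\<forall>q\<in>Q. \<forall>k. coprime k n \<longrightarrow> ev q (theta_conj n k) \<in> ?U"
    using good unfolding level_good_def by blast
  then have "ev [:2, - 1:] (theta_conj n 1) \<in> ?U" using Q coprime_1_left[of n] by blast
  moreover have "n > 1" using n by (auto elim!: dvdE)
  ultimately have p: "?p \<in> ?T" using tpos_2_minus_theta[OF wd] by (simp add: T ev_pCons)
  have "equiv ?T E"
  proof (rule equivI)
    show "E \<subseteq> ?T \<times> ?T" by (auto simp: E_def)
    show "refl_on ?T E" using units_1[OF subring_Rcyc, of n]
      by (auto simp: refl_on_def E_def intro!: bexI[of _ 1])
    show "sym E"
    proof (rule symI)
      fix x y assume "(x, y) \<in> E"
      then obtain v where v: "x \<in> ?T" "y \<in> ?T" "v \<in> ?U" "x = y * v ^ 2" by (auto simp: E_def)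
      then have "y = x * (1 / v) ^ 2" by (simp add: units_iff power_divide)
      then show "(y, x) \<in> E" using v units_inverse by (auto simp: E_def)
    qed
    show "trans E"
    proof (rule transI)
      fix x y z assume "(x, y) \<in> E" "(y, z) \<in> E"
      then obtain v w where v: "x \<in> ?T" "z \<in> ?T" "v \<in> ?U" "w \<in> ?U" "x = z * w ^ 2 * v ^ 2"
        by (auto simp: E_def)
      then have "x = z * (w * v) ^ 2" by (simp add: power_mult_distrib)
      then show "(x, z) \<in> E" using v units_mult[OF subring_Rcyc v(4,3)] by (auto simp: E_def)
    qed
  qed
  note eqv = this
  have "?T // E = {E `` {1}, E `` {?p}}"
  proof (intro equalityI subsetI)
    fix X assume "X \<in> ?T // E"
    then obtain u where u: "u \<in> ?T" "X = E `` {u}" by (auto elim!: quotientE)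
    then obtain v where v: "v \<in> ?U" "u = v ^ 2 \<or> u = ?p * v ^ 2" using good
      unfolding level_good_def T by blast
    then have "(u, 1) \<in> E \<or> (u, ?p) \<in> E" using u(1) one p by (auto simp: E_def)
    then show "X \<in> {E `` {1}, E `` {?p}}" using equiv_class_eq[OF eqv] u(2) by blast
  qed (use one p in \<open>auto intro: quotientI\<close>)
  moreover have "E `` {1} \<noteq> E `` {?p}"
  proof
    assume "E `` {1} = E `` {?p}"
    then have "(?p, 1) \<in> E" using eq_equiv_class[OF _ eqv one] by metis
    then obtain v where "v \<in> ?U" "?p = v ^ 2" by (auto simp: E_def)
    then show False using two_minus_theta_nonsquare[OF n wd ns, of v] by (simp add: units_iff)
  qed
  ultimately show ?thesis unfolding tpos_units_mod_squares_card_def E_def[symmetric] by simp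
qed

lemma class_numbers:
  assumes wd: "conj_wd n" and good: "level_good Q n" and prime: "prime_over_2 (Ocyc n) l"
    and N: "int_norm n d N" and sp: "spanned n"
  shows "odd (class_number (Ocyc n))" "narrow_class_number n (Rcyc n) = class_number (Ocyc n)"
proof -
  interpret prime_over_2 "Ocyc n" l by (rule prime)
  have eq: "class_number (Ocyc n) = class_number (Rcyc n)" using class_number_loc2 by (simp add: Rcyc_eq)
  obtain D b where "\<forall>j<D. b j \<in> Ocyc n" "\<forall>x\<in>Ocyc n. \<exists>c :: nat \<Rightarrow> int. x = (\<Sum>j<D::nat. of_int (c j) * b j)"
    using sp unfolding spanned_def by blast
  then have fin: "finite (nonzero_ideals (Ocyc n) // class_equiv (Ocyc n))"
    by (rule finite_class_group_Ocyc[OF wd N])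
  have "class_equiv (Ocyc n) `` {Ocyc n} \<in> nonzero_ideals (Ocyc n) // class_equiv (Ocyc n)"
    by (rule quotientI[OF nonzero_ideals_ring[OF subring]])
  then have "nonzero_ideals (Ocyc n) // class_equiv (Ocyc n) \<noteq> {}" by (metis emptyE)
  with fin have "class_number (Ocyc n) > 0"
    unfolding class_number_def card_gt_0_iff by (intro conjI)
  \<comment> \<open>As \<open>card\<close> of an infinite set is 0, positivity of the common class
    number carries finiteness over to \<open>Rcyc n\<close>.\<close>
  then have "class_number (Rcyc n) > 0" by (simp only: eq)
  then have finR: "finite (nonzero_ideals (Rcyc n) // class_equiv (Rcyc n))"
    unfolding class_number_def by (rule card_ge_0_finite)
  have "ideals_invertible (Rcyc n)" "no_two_torsion (Rcyc n)" using good by (simp_all only: level_good_def)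
  then show "odd (class_number (Ocyc n))"
    unfolding eq by (intro odd_class_number subring_Rcyc finR)
  have "ideal_equiv (Rcyc n) (tpos n) = class_equiv (Rcyc n)"
    using good unfolding level_good_def by (intro narrow_equiv_eq[OF wd subring_Rcyc order_refl]) blast
  then have "narrow_class_number n (Rcyc n) = class_number (Rcyc n)"
    unfolding narrow_class_number_def class_number_def by (simp only:)
  then show "narrow_class_number n (Rcyc n) = class_number (Ocyc n)" by (simp only: eq)
qed

text \<open>Every \<open>E\<close>-class is the union of the \<open>F\<close>-classes of a
  representative \<open>x\<close> and of \<open>g x\<close>. In the application \<open>g\<close>
  multiplies ideals by the prime above 2.\<close>

lemma card_quotient_double:
  assumes E: "equiv S E" and F: "equiv S F" and FE: "F \<subseteq> E" and g: "\<And>x. x \<in> S \<Longrightarrow> (g x, x) \<in> E"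
    and split: "\<And>x y. (x, y) \<in> E \<Longrightarrow> (x, y) \<in> F \<or> (g x, y) \<in> F"
    and not: "\<And>x. x \<in> S \<Longrightarrow> (x, g x) \<notin> F"
  shows "card (S // F) = 2 * card (S // E)"
proof -
  define r where "r X = (SOME x. x \<in> X)" for X :: "'a set"
  have r: "r X \<in> S" "E `` {r X} = X" if X: "X \<in> S // E" for X
  proof -
    obtain x where x: "x \<in> S" "X = E `` {x}" using X by (rule quotientE)
    have "x \<in> X" unfolding x(2) by (rule equiv_class_self[OF E x(1)])
    then have rX: "r X \<in> X" unfolding r_def by (rule someI)
    then show "r X \<in> S" using in_quotient_imp_subset[OF E X] by (rule subsetD[rotated])
    have "(x, r X) \<in> E" using rX x(2) by blast
    then have "E `` {x} = E `` {r X}" by (rule equiv_class_eq[OF E])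
    with x(2) have "X = E `` {r X}" by (rule trans)
    then show "E `` {r X} = X" by (rule sym)
  qed
  have ES: "x \<in> S" "y \<in> S" if "(x, y) \<in> E" for x y using that E by (auto simp: equiv_def)
  have gS: "g x \<in> S" if "x \<in> S" for x using ES(1)[OF g[OF that]] .
  define h where "h = (\<lambda>(X, c). F `` {if c then g (r X) else r X})"
  have hE: "X = Y" if XY: "X \<in> S // E" "Y \<in> S // E" "h (X, c) = h (Y, d)" for X Y c d
  proof -
    let ?x = "if c then g (r X) else r X" and ?y = "if d then g (r Y) else r Y"
    have S: "?x \<in> S" "?y \<in> S" using r(1) XY gS by auto
    have "(?x, ?y) \<in> F" using XY(3) eq_equiv_class[OF _ F S(2)] by (simp add: h_def)
    then have "(?x, ?y) \<in> E" using FE by blast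
    moreover have "E `` {?x} = X" "E `` {?y} = Y"
      using r XY(1,2) equiv_class_eq[OF E g] by (auto split: if_splits)
    ultimately show ?thesis using equiv_class_eq[OF E] by blast
  qed
  have "bij_betw h ((S // E) \<times> UNIV) (S // F)"
  proof (rule bij_betw_imageI)
    show "inj_on h ((S // E) \<times> UNIV)"
    proof (rule inj_onI, clarify)
      fix X Y and c d :: bool
      assume XY: "X \<in> S // E" "Y \<in> S // E" "h (X, c) = h (Y, d)"
      have "X = Y" using hE[OF XY] .
      moreover have "F `` {r X} \<noteq> F `` {g (r X)}"
        using not[OF r(1)[OF XY(1)]] eq_equiv_class[OF _ F gS[OF r(1)[OF XY(1)]]] by blast
      ultimately show "X = Y \<and> c = d" using XY(3) by (cases c; cases d) (auto simp: h_def)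
    qed
    show "h ` ((S // E) \<times> UNIV) = S // F"
    proof (intro equalityI subsetI)
      fix Z assume "Z \<in> h ` ((S // E) \<times> UNIV)"
      then show "Z \<in> S // F" using r(1) gS by (auto simp: h_def intro!: quotientI)
    next
      fix Z assume "Z \<in> S // F"
      then obtain y where y: "y \<in> S" "Z = F `` {y}" by (auto elim!: quotientE)
      let ?X = "E `` {y}"
      have X: "?X \<in> S // E" using y(1) by (rule quotientI)
      have "(r ?X, y) \<in> E" using r[OF X] eq_equiv_class[OF _ E y(1)] by blast
      then have "(r ?X, y) \<in> F \<or> (g (r ?X), y) \<in> F" by (rule split)
      then have "Z = h (?X, False) \<or> Z = h (?X, True)"
        using equiv_class_eq[OF F] y(2) by (auto simp: h_def)
      then show "Z \<in> h ` ((S // E) \<times> UNIV)" using X by blast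
    qed
  qed
  then have "card (S // F) = card ((S // E) \<times> (UNIV :: bool set))"
    by (rule bij_betw_same_card[symmetric])
  then show ?thesis by (simp add: card_cartesian_product)
qed

lemma tpos_power: "conj_wd n \<Longrightarrow> x \<in> Rcyc n \<Longrightarrow> x \<noteq> 0 \<Longrightarrow> even k \<or> tpos n x \<Longrightarrow> tpos n (x ^ k)"
  by (auto simp: tpos_iff emb_power subringD[OF subring_Rcyc] emb_eq_0 zero_less_power_eq)

text \<open>Up to squares, a unit of \<open>Rcyc n\<close> is a unit of \<open>Ocyc n\<close> times a power of the prime above 2.\<close>

lemma Ocyc_signature:
  assumes wd: "conj_wd n" and good: "level_good Q n" and prime: "prime_over_2 (Ocyc n) l"
    and x: "x \<in> Ocyc n" "x \<noteq> 0"
  obtains w k where "w \<in> units_of_ring (Ocyc n)" "tpos n (w * x * l ^ k)"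
proof -
  interpret prime_over_2 "Ocyc n" l by (rule prime)
  note R = subringD[OF subring_Rcyc[of n]]
  obtain u where u: "u \<in> units_of_ring (Rcyc n)" "tpos n (u * x)"
    using good Ocyc_Rcyc[OF x(1)] x(2) unfolding level_good_def by blast
  obtain w e f where w: "w \<in> units_of_ring (Ocyc n)" "u * l ^ f = w * l ^ e"
    using units_loc2 u(1) unfolding Rcyc_eq by blast
  have lR: "l \<in> Rcyc n" by (rule Ocyc_Rcyc[OF l_A])
  \<comment> \<open>The square of \<open>l ^ f\<close> is totally positive; one factor
    \<open>l ^ f\<close> turns \<open>u\<close> into \<open>w * l ^ e\<close>, the other joins the
    power of \<open>l\<close>.\<close>
  have "tpos n (u * x * l ^ (2 * f))"
    using u Ocyc_Rcyc[OF x(1)] R lR l_0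
    by (intro tpos_mult[OF wd _ _ u(2)] tpos_power[OF wd]) (auto simp: units_iff)
  also have "u * x * l ^ (2 * f) = (u * l ^ f) * x * l ^ f" by (simp add: mult_2 power_add)
  also have "\<dots> = w * x * l ^ (e + f)" unfolding w(2) by (simp add: power_add)
  finally show ?thesis using that w(1) by blast
qed

theorem theorem3p14:
  fixes n s :: nat
  assumes "n \<ge> 8"
  shows "(n = 2 ^ s \<longrightarrow>
            (\<forall>u \<in> units_of_ring (Ocyc n). tpos n u \<longrightarrow>
                (\<exists>v \<in> units_of_ring (Ocyc n). u = v ^ 2)) \<and>
            odd (narrow_class_number n (Ocyc n)) \<and>
            odd (class_number (Ocyc n)) \<and>
            tpos_units_mod_squares_card n (Rcyc n) = 2)
       \<and> (n = 3 * 2 ^ s \<longrightarrow>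
            class_number (Ocyc n) = narrow_class_number n (Rcyc n) \<and>
            odd (class_number (Ocyc n)) \<and>
            narrow_class_number n (Ocyc n) = 2 * class_number (Ocyc n) \<and>
            tpos_units_mod_squares_card n (Rcyc n) = 2)"
proof (intro conjI impI)
  have R: "subring (Rcyc n)" and O: "subring (Ocyc n)" by (rule subring_Rcyc, rule subring_Ocyc)
  {
    assume "n = 2 ^ s"
    have "s \<ge> 2"
    proof (rule ccontr)
      assume "\<not> s \<ge> 2"
      then have "s = 0 \<or> s = 1" by auto
      then show False using assms \<open>n = 2 ^ s\<close> by auto
    qed
    then obtain t where "s = t + 2" by (metis le_add_diff_inverse2)
    then have n: "n = 4 * 2 ^ t" using \<open>n = 2 ^ s\<close> by simp
    let ?l = "2 - theta n"
    obtain d N where wd: "conj_wd n" and ns: "nonsquare_step n" and good: "level_good Q4 n" and sp: "spanned n"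
      and ab: "above_2 (Ocyc n) ?l" and N: "int_norm n d N" "N ?l = 2"
      using tower_4[of t] unfolding n[symmetric] by blast
    have lO: "?l \<in> Ocyc n" using theta_Ocyc subringD[OF O] by simp
    \<comment> \<open>The residue of \<open>theta n\<close> is read off from
      \<open>theta n = 2 + ?l * (- 1)\<close>.\<close>
    have prime: "prime_over_2 (Ocyc n) ?l"
      using N subringD(8)[OF O, of "- 1"] by (intro prime_over_2_Ocyc[OF N(1) _ lO ab, of 2 "- 1"]) auto
    interpret prime_over_2 "Ocyc n" ?l by (rule prime)
    have n4: "4 dvd n" "n > 0" "n > 1" using n assms by auto
    have tl: "tpos n ?l" by (rule tpos_2_minus_theta[OF wd n4(3)])
    show "tpos_units_mod_squares_card n (Rcyc n) = 2"
      by (rule tpos_units_card[OF n4(1,2) wd ns good]) (simp add: Q4_def)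
    show odd: "odd (class_number (Ocyc n))" by (rule class_numbers[OF wd good prime N(1) sp])
    \<comment> \<open>The generator \<open>?l\<close> above 2 is itself totally positive, so its
      power can be cancelled: units of \<open>Ocyc n\<close> alone correct all signs, and narrow
      classes are classes.\<close>
    have "\<exists>u\<in>units_of_ring (Ocyc n). tpos n (u * x)" if x: "x \<in> Ocyc n" "x \<noteq> 0" for x
    proof -
      obtain w k where w: "w \<in> units_of_ring (Ocyc n)" "tpos n (w * x * ?l ^ k)"
        using Ocyc_signature[OF wd good prime x] .
      have "w * x \<in> Rcyc n" "?l ^ k \<in> Rcyc n" "tpos n (?l ^ k)"
        using w(1) x(1) lO l_0 tl subringD[OF O]
        by (auto simp: units_iff intro!: Ocyc_Rcyc tpos_power[OF wd])
      then have "tpos n (w * x)" using tpos_cancel[OF wd _ _ w(2)] by blast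
      then show ?thesis using w(1) by blast
    qed
    then have "ideal_equiv (Ocyc n) (tpos n) = class_equiv (Ocyc n)"
      using Ocyc_Rcyc by (intro narrow_equiv_eq[OF wd O]) auto
    then show "odd (narrow_class_number n (Ocyc n))"
      using odd by (simp add: narrow_class_number_def class_number_def)
    show "\<forall>u\<in>units_of_ring (Ocyc n). tpos n u \<longrightarrow> (\<exists>v\<in>units_of_ring (Ocyc n). u = v ^ 2)"
    proof (intro ballI impI)
      fix u assume u: "u \<in> units_of_ring (Ocyc n)" "tpos n u"
      then have "u \<in> units_of_ring (Rcyc n)" using Ocyc_Rcyc by (auto simp: units_iff)
      then obtain v where v: "v \<in> units_of_ring (Rcyc n)" "u = v ^ 2 \<or> u = ?l * v ^ 2"
        using good u(2) unfolding level_good_def by blast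
      obtain w e f where w: "w \<in> units_of_ring (Ocyc n)" "v * ?l ^ f = w * ?l ^ e"
        using units_loc2 v(1) unfolding Rcyc_eq by blast
      have uO: "u \<in> Ocyc n" and w2: "w ^ 2 \<in> units_of_ring (Ocyc n)" "w ^ 2 \<in> Ocyc n"
        using u(1) units_power[OF O w(1), of 2] by (auto simp: units_iff)
      have pw: "?l ^ (2 * i) * x ^ 2 = (x * ?l ^ i) ^ 2" for x i
        unfolding power_mult_distrib power_even_eq by (rule mult.commute)
      have eq: "?l ^ (2 * f) * v ^ 2 = ?l ^ (2 * e) * w ^ 2" unfolding pw w(2) ..
      have "?l ^ (2 * f) * (?l * v ^ 2) = ?l * (?l ^ (2 * f) * v ^ 2)" by (rule mult.left_commute)
      also have "\<dots> = ?l ^ (2 * e + 1) * w ^ 2" unfolding eq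
        by (simp only: power_add power_one_right mult_ac)
      \<comment> \<open>\<open>u\<close> and \<open>w ^ 2\<close> are units, so the exponents of
        \<open>?l\<close> agree; parity leaves \<open>f = e\<close>, and then \<open>v\<close> is
        the unit \<open>w\<close> of \<open>Ocyc n\<close>.\<close>
      finally have "?l ^ (2 * f) * u = ?l ^ (2 * e) * w ^ 2 \<or> ?l ^ (2 * f) * u = ?l ^ (2 * e + 1) * w ^ 2"
        using v(2) eq by presburger
      then have "2 * f = 2 * e \<or> 2 * f = 2 * e + 1"
        using power_eq_unique[OF uO w2(2) unit_not_dv[OF u(1)] unit_not_dv[OF w2(1)]] by blast
      then have ef: "f = e" by presburger
      then have "v = w" using w(2) l_0 by simp
      have "u \<noteq> ?l * v ^ 2"
      proof
        assume "u = ?l * v ^ 2"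
        then have "?l ^ 0 * u = ?l ^ 1 * w ^ 2" using \<open>v = w\<close> by simp
        from power_eq_unique[OF uO w2(2) unit_not_dv[OF u(1)] unit_not_dv[OF w2(1)] this] show False by simp
      qed
      then show "\<exists>v\<in>units_of_ring (Ocyc n). u = v ^ 2" using v(2) \<open>v = w\<close> w(1)
        by blast
    qed
  }
  {
    assume "n = 3 * 2 ^ s"
    have "s \<ge> 2"
    proof (rule ccontr)
      assume "\<not> s \<ge> 2"
      then have "s = 0 \<or> s = 1" by auto
      then show False using assms \<open>n = 3 * 2 ^ s\<close> by auto
    qed
    then obtain t where "s = t + 2" by (metis le_add_diff_inverse2)
    then have n: "n = 12 * 2 ^ t" using \<open>n = 3 * 2 ^ s\<close> by simp
    define l where "l = 1 + theta n"
    obtain d N where wd: "conj_wd n" and ns: "nonsquare_step n" and good: "level_good Q12 n" and sp: "spanned n"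
      and ab: "above_2 (Ocyc n) l" and N: "int_norm n d N" "N l = - 2" "\<forall>u\<in>units_of_ring (Ocyc n). N u = 1"
      using tower_12[of t] unfolding n[symmetric] l_def by blast
    have lO: "l \<in> Ocyc n" using theta_Ocyc subringD[OF O] by (simp add: l_def)
    have prime: "prime_over_2 (Ocyc n) l"
      using N subringD(1)[OF O] by (intro prime_over_2_Ocyc[OF N(1) _ lO ab, of "- 1" 1]) (auto simp: l_def)
    interpret prime_over_2 "Ocyc n" l by (rule prime)
    have n4: "4 dvd n" "n > 0" "n > 1" using n assms by auto
    show "tpos_units_mod_squares_card n (Rcyc n) = 2"
      by (rule tpos_units_card[OF n4(1,2) wd ns good]) (simp add: Q12_def)
    show "odd (class_number (Ocyc n))" "class_number (Ocyc n) = narrow_class_number n (Rcyc n)"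
      using class_numbers[OF wd good prime N(1) sp] by simp_all
    let ?S = "nonzero_ideals (Ocyc n)" and ?F = "ideal_equiv (Ocyc n) (tpos n)"
    have lR: "l \<in> Rcyc n" by (rule Ocyc_Rcyc[OF lO])
    \<comment> \<open>Multiplication by \<open>l\<close> fixes classes but moves narrow classes:
      \<open>l\<close> has negative norm, and units, all of norm 1, cannot repair the sign.\<close>
    have "card (?S // ?F) = 2 * card (?S // class_equiv (Ocyc n))"
    proof (rule card_quotient_double[where g = "scl l"])
      show "equiv ?S (class_equiv (Ocyc n))" by (rule class_equiv_equiv[OF O])
      have "tpos n 1" using tpos_square[OF wd subringD(1)[OF R]] by simp
      then show "equiv ?S ?F" using Ocyc_Rcyc by (intro ideal_equiv_equiv[OF O] tpos_mult[OF wd]) auto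
      show "?F \<subseteq> class_equiv (Ocyc n)" unfolding ideal_equiv_def by blast
      show "(scl l I, I) \<in> class_equiv (Ocyc n)" if I: "I \<in> ?S" for I
        by (rule ideal_equivI[OF nonzero_ideals_scl[OF O I lO l_0] I subringD(1)[OF O] lO one_neq_zero l_0 TrueI TrueI]) simp
      show "(I, J) \<in> ?F \<or> (scl l I, J) \<in> ?F" if IJ: "(I, J) \<in> class_equiv (Ocyc n)" for I J
      proof -
        obtain a b where ab: "I \<in> ?S" "J \<in> ?S" "a \<in> Ocyc n" "b \<in> Ocyc n" "a \<noteq> 0" "b \<noteq> 0" "scl a I = scl b J"
          using IJ by (rule ideal_equivE)
        have abO: "a * b \<in> Ocyc n" "a * b \<noteq> 0" using ab subringD(5)[OF O] by simp_all
        obtain w k where w: "w \<in> units_of_ring (Ocyc n)" "tpos n (w * (a * b) * l ^ k)"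
          using Ocyc_signature[OF wd good prime abO] .
        have wO: "w \<in> Ocyc n" "w \<noteq> 0" using w(1) by (auto simp: units_iff)
        have aa: "a * a \<in> Ocyc n" "a * a \<noteq> 0" "tpos n (a * a)"
          using ab subringD(5)[OF O] tpos_square[OF wd Ocyc_Rcyc[OF ab(3)] ab(5)]
          by (simp_all add: power2_eq_square)
        have wab: "w * (a * b) \<in> Ocyc n" "w * (a * b) \<noteq> 0" using wO abO subringD(5)[OF O]
          by simp_all
        have "scl (a * a) I = scl a (scl b J)" by (simp only: scl_scl[symmetric] ab(7))
        also have "\<dots> = scl (a * b) (scl w J)"
          by (simp only: scl_scl[symmetric] scl_unit[OF O nonzero_idealsD(1)[OF ab(2)] w(1)])
        also have "\<dots> = scl (w * (a * b)) J" by (simp only: scl_scl mult.commute[of "a * b" w])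
        finally have eq: "scl (a * a) I = scl (w * (a * b)) J" .
        have pow: "l ^ (2 * h) \<in> Rcyc n" "tpos n (l ^ (2 * h))" for h
          using lR l_0 subringD(7)[OF R] tpos_power[OF wd lR l_0] by auto
        show ?thesis
        \<comment> \<open>Even powers of \<open>l\<close> are totally positive and cancel; for odd
          \<open>k\<close> one factor \<open>l\<close> is left over and is moved to
          \<open>I\<close>.\<close>
        proof (cases "even k")
          case True
          then obtain h where "k = 2 * h" by (elim evenE)
          then have tp: "tpos n (w * (a * b))"
            using tpos_cancel[OF wd Ocyc_Rcyc[OF wab(1)] pow(1) _ pow(2)] w(2) by blast
          have "(I, J) \<in> ?F" by (rule ideal_equivI[where P = "tpos n", OF ab(1,2) aa(1) wab(1) aa(2) wab(2) aa(3) tp eq])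
          then show ?thesis ..
        next
          case False
          then obtain h where h: "k = 2 * h + 1" by (elim oddE)
          have wabl: "w * (a * b) * l \<in> Ocyc n" "w * (a * b) * l \<noteq> 0"
            using wab lO l_0 subringD(5)[OF O] by simp_all
          have "tpos n (w * (a * b) * l * l ^ (2 * h))" using w(2) unfolding h by (simp add: mult.assoc)
          then have tp: "tpos n (w * (a * b) * l)"
            using tpos_cancel[OF wd Ocyc_Rcyc[OF wabl(1)] pow(1) _ pow(2)] by blast
          have "scl (a * a) (scl l I) = scl l (scl (a * a) I)"
            by (simp only: scl_scl mult.commute[of "a * a" l])
          also have "\<dots> = scl (w * (a * b) * l) J"
            by (simp only: eq scl_scl mult.commute[of l "w * (a * b)"])
          finally have "(scl l I, J) \<in> ?F"
            by (rule ideal_equivI[where P = "tpos n", OF nonzero_ideals_scl[OF O ab(1) lO l_0] ab(2) aa(1) wabl(1) aa(2) wabl(2) aa(3) tp])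
          then show ?thesis ..
        qed
      qed
      show "(I, scl l I) \<notin> ?F" if I: "I \<in> ?S" for I
      proof
        assume "(I, scl l I) \<in> ?F"
        then obtain a b where ab: "a \<in> Ocyc n" "b \<in> Ocyc n" "a \<noteq> 0" "b \<noteq> 0" "tpos n a" "tpos n b" "scl a I = scl b (scl l I)"
          by (rule ideal_equivE)
        have eq: "scl a I = scl (b * l) I" using ab(7) by (simp only: scl_scl)
        have I2: "loc2 I \<in> nonzero_ideals (Rcyc n)" using loc2_nonzero_ideals[OF O I]
          by (simp only: Rcyc_eq)
        \<comment> \<open>\<open>I\<close> is cancelled after inverting 2, where ideals are
          invertible, which gives \<open>b * l = a * u\<close> with a unit \<open>u\<close> of
          \<open>Rcyc n\<close>. Comparing powers of \<open>l\<close> then shows that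
          \<open>u\<close> is the unit \<open>w\<close> of \<open>Ocyc n\<close>.\<close>
        obtain J c where J: "c \<noteq> 0" "iprod (loc2 I) J = scl c (Rcyc n)"
          using good I2 unfolding level_good_def ideals_invertible_def by blast
        have "scl a (loc2 I) = scl (b * l) (loc2 I)" using eq by (simp only: loc2_scl[symmetric])
        then have "iprod (scl a (loc2 I)) J = iprod (scl (b * l) (loc2 I)) J" by (simp only:)
        then have "scl (b * l * c) (Rcyc n) = scl (a * c) (Rcyc n)"
          by (simp only: iprod_scl_left J(2) scl_scl)
        from scl_ring_eqE[OF R this] J(1) ab(3)
        obtain u where u: "u \<in> units_of_ring (Rcyc n)" "b * l * c = a * c * u" by (metis mult_eq_0_iff)
        then have blu: "b * l = a * u" using J(1) by simp
        obtain w e f where w: "w \<in> units_of_ring (Ocyc n)" "u * l ^ f = w * l ^ e"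
          using units_loc2 u(1) unfolding Rcyc_eq by blast
        have blf: "b * l * l ^ f = a * w * l ^ e" unfolding blu using w(2) by (simp add: mult.assoc)
        have "scl a (scl (l ^ f) I) = scl (l ^ f) (scl a I)"
          by (simp only: scl_scl mult.commute[of a "l ^ f"])
        also have "\<dots> = scl (b * l * l ^ f) I"
          by (simp only: eq scl_scl mult.commute[of "l ^ f" "b * l"])
        also have "\<dots> = scl (a * l ^ e) (scl w I)"
        proof -
          have "a * w * l ^ e = a * l ^ e * w" by simp
          then show ?thesis by (simp only: blf scl_scl)
        qed
        also have "\<dots> = scl a (scl (l ^ e) I)"
          by (simp only: scl_unit[OF O nonzero_idealsD(1)[OF I] w(1)] scl_scl)
        finally have "scl (l ^ f) I = scl (l ^ e) I" by (rule scl_cancel[OF ab(3)])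
        then have "f = e" by (rule scl_power_eq[OF I])
        then have bl: "b * l = a * w" using blf l_0 by simp
        have wO: "w \<in> Ocyc n" using w(1) by (simp add: units_iff)
        \<comment> \<open>As \<open>w\<close> has norm 1, the norms of \<open>a\<close> and
          \<open>b\<close> would have opposite signs, although both elements are totally
          positive.\<close>
        have "N b * - 2 = N a" using int_normD(5)[OF N(1) ab(2) lO] int_normD(5)[OF N(1) ab(1) wO] N(2,3) w(1) bl by simp
        then show False using int_normD(8)[OF N(1) ab(1,5)] int_normD(8)[OF N(1) ab(2,6)] by linarith
      qed
    qed
    then show "narrow_class_number n (Ocyc n) = 2 * class_number (Ocyc n)"
      by (simp add: narrow_class_number_def class_number_def)
  }
qed

end
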